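(* Let $a,b,c$ be mutually coprime integers with $a>0$, let $-d = b^2-4ac<0$, and let $\tau = \frac{-b+\sqrt{-d}}{2a}$ (so $a\tau^2+b\tau+c=0$, $\mathrm{Im}(\tau)>0$). Suppose $\tau$ is around $\infty$. Let $\lambda = \lambda(\tau)$, $F = {}_{2}F_{1}(\tfrac12,\tfrac12;1;\lambda)$, and $$g_2 = \tfrac43(\lambda^2-\lambda+1),\qquad g_3 = \tfrac{4}{27}(\lambda+1)(2\lambda-1)(\lambda-2).$$ Then $$-F^2\Big[\frac{2\lambda-1}{3} + \frac{3g_3}{2g_2}\, s_2(\tau)\Big] + \lambda(1-\lambda)\frac{dF^2}{d\lambda} = \frac{2a}{\pi\sqrt{d}},$$ where $\frac{dF^2}{d\lambda}$ denotes the derivative of $\lambda\mapsto {}_{2}F_{1}(\tfrac12,\tfrac12;1;\lambda)^2$ evaluated at $\lambda=\lambda(\tau)$.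
   Context: $\lambda(\tau)$ is the modular lambda function on the upper half-plane, with $q$-expansion $\lambda(\tau) = 16q^{1/2} - 128 q + 704 q^{3/2} - \cdots$, $q = e^{2\pi i\tau}$. "$\tau$ around $\infty$" means $\tau$ lies in the fundamental domain of $\Gamma(2)$ near the cusp $\infty$, where $\lambda(\tau)\to 0$ (so $|\lambda(\tau)|<1$). ${}_{2}F_{1}$ is the Gauss hypergeometric function. With $q=e^{2\pi i\tau}$, define $E_2(\tau) = 1-24\sum_{n\ge1} n\frac{q^n}{1-q^n}$, $E_4(\tau) = 1+240\sum_{n\ge1} n^3\frac{q^n}{1-q^n}$, $E_6(\tau) = 1-504\sum_{n\ge1} n^5\frac{q^n}{1-q^n}$, and $$s_2(\tau) = \frac{E_4(\tau)}{E_6(\tau)}\Big(E_2(\tau) - \frac{3}{\pi\,\mathrm{Im}(\tau)}\Big).$$ *)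

theory Defs
  imports "HOL-Complex_Analysis.Complex_Analysis"
begin

definition theta2 :: "complex \<Rightarrow> complex" where
  "theta2 \<tau> = (\<Sum>\<^sub>\<infinity>n\<in>(UNIV :: int set). exp (\<i> * of_real pi * (of_int n + 1 / 2)\<^sup>2 * \<tau>))"

definition theta3 :: "complex \<Rightarrow> complex" where
  "theta3 \<tau> = (\<Sum>\<^sub>\<infinity>n\<in>(UNIV :: int set). exp (\<i> * of_real pi * (of_int n)\<^sup>2 * \<tau>))"

(* In terms of q = exp (2 pi i tau), this normalisation has the expansion
   16 q^(1/2) - 128 q + 704 q^(3/2) - ..., so it vanishes at the cusp infinity. *)
definition modular_lambda :: "complex \<Rightarrow> complex" where
  "modular_lambda \<tau> = theta2 \<tau> ^ 4 / theta3 \<tau> ^ 4"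

definition nome :: "complex \<Rightarrow> complex" where
  "nome \<tau> = exp (2 * of_real pi * \<i> * \<tau>)"

definition E2 :: "complex \<Rightarrow> complex" where
  "E2 \<tau> = 1 - 24 * (\<Sum>n. of_nat (Suc n) * nome \<tau> ^ Suc n / (1 - nome \<tau> ^ Suc n))"

definition E4 :: "complex \<Rightarrow> complex" where
  "E4 \<tau> = 1 + 240 * (\<Sum>n. of_nat (Suc n) ^ 3 * nome \<tau> ^ Suc n / (1 - nome \<tau> ^ Suc n))"

definition E6 :: "complex \<Rightarrow> complex" where
  "E6 \<tau> = 1 - 504 * (\<Sum>n. of_nat (Suc n) ^ 5 * nome \<tau> ^ Suc n / (1 - nome \<tau> ^ Suc n))"

(* At a zero of E6 the quotient is 0 by the convention x / 0 = 0. *)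
definition s2 :: "complex \<Rightarrow> complex" where
  "s2 \<tau> = E4 \<tau> / E6 \<tau> * (E2 \<tau> - 3 / of_real (pi * Im \<tau>))"

(* The Gauss series; meaningful as the hypergeometric function for norm z < 1 only. *)
definition hyp2F1 :: "complex \<Rightarrow> complex \<Rightarrow> complex \<Rightarrow> complex \<Rightarrow> complex" where
  "hyp2F1 a b c z = eval_fps (fps_hypergeo [a, b] [c] 1) z"

(* The closed fundamental domain: the boundary lines Re tau = 1, -1 and the
   boundary semicircles, with diameters [-1, 0] and [0, 1], are all included. *)
definition Gamma2_fundamental_domain :: "complex set" where
  "Gamma2_fundamental_domain =
     {\<tau>. Im \<tau> > 0 \<and> \<bar>Re \<tau>\<bar> \<le> 1 \<and> norm (\<tau> - 1 / 2) \<ge> 1 / 2 \<and> norm (\<tau> + 1 / 2) \<ge> 1 / 2}"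

(* The part of the fundamental domain on which lambda lies in the disc of
   convergence of the Gauss series; lambda tends to 0 at the cusp infinity, and
   to 1 and infinity at the other two cusps. *)
definition around_infinity :: "complex \<Rightarrow> bool" where
  "around_infinity \<tau> \<longleftrightarrow> \<tau> \<in> Gamma2_fundamental_domain \<and> norm (modular_lambda \<tau>) < 1"

end

theory Submission
  imports Defs "HOL-Probability.Distributions" "HOL-Real_Asymp.Real_Asymp"
begin

text \<open>
  Put \<open>f = theta3\<^sup>2\<close> and \<open>D = (1 / (\<i> \<pi>)) d/d\<tau>\<close>. A function on the upper half-plane that is invariant under
  \<open>\<tau> \<mapsto> 2\<tau>\<close> and has a limit at the cusp is constant. Together with the doubling formulas for the theta
  constants this gives \<open>D \<lambda> = \<lambda> (1 - \<lambda>) f\<^sup>2\<close>, the equation \<open>D u = u\<^sup>2 + \<lambda> (1 - \<lambda>) f\<^sup>4 / 4\<close> for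
  \<open>u = D f / f\<close>, and \<open>E2 = 6 u + theta4\<^sup>4 - theta2\<^sup>4\<close> (here the product of Gauss for \<open>theta4\<close> enters). Hence
  \<open>f\<close> solves the hypergeometric equation as a function of \<open>\<lambda>\<close>, so that \<open>f = F(\<lambda>)\<close>, and Ramanujan's
  formulas for \<open>D E2\<close> and \<open>D E4\<close> express \<open>E4\<close> and \<open>E6\<close> through the theta constants. Inserting all this, the
  left-hand side collapses to the non-holomorphic term \<open>1 / (\<pi> Im \<tau>)\<close> of \<open>s2\<close>.

  Two points need the inversion \<open>\<tau> \<mapsto> -1/\<tau>\<close>, which is obtained by comparing two solutions of the same
  differential system along the imaginary axis; the Gaussian integral fixes the constant. First,
  reflection in the circle \<open>\<bar>\<tau> - 1\<bar> = 1\<close> turns \<open>\<lambda>\<close> into the conjugate of \<open>1/\<lambda>\<close>, so by the maximum principle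
  \<open>\<bar>\<lambda>\<bar> < 1\<close> holds in the fundamental domain exactly outside the circles around 1 and -1, a region on
  which \<open>f = F(\<lambda>)\<close> continues from the cusp. Second, at a zero of \<open>E6\<close>, where \<open>s2\<close> takes the junk value 0,
  one has \<open>\<lambda> = 1/2\<close>; this forces \<open>\<tau> = \<i>\<close>, and there \<open>u = 1 / (2\<pi>)\<close>.
\<close>

section \<open>Theta series\<close>

text \<open>Doubling is chosen because 2^n tau runs into the cusp from every point: an identity then
  needs only the duplication formulas and limits at infinity, without group generators or growth
  conditions at other cusps. A weight is removed beforehand, by a quotient of the same weight or by
  a power of Im tau; in the second case the exponential decay at the cusp forces the value 0. What
  doubling does not give is the behaviour under -1/tau. On the imaginary axis f = F(lambda) holds
  for the theta functions and for their transforms alike, so both versions of lambda obey the same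
  equation y' = - pi y (1 - y) F(y)^2 in t and differ by a shift of t. Both run through exactly the
  values between 0 and 1, so the shift is 0. The other obstacle is that F is a power series: f =
  F(lambda) can be continued only within a connected set on which |lambda| < 1, and
  \<open>around_infinity\<close> must be shown to lie in such a set, boundary lines
  included.\<close>

abbreviation (input) ipi :: complex ("\<i>\<pi>") where "\<i>\<pi> \<equiv> \<i> * of_real pi"

abbreviation (input) theta_term :: "real \<Rightarrow> complex \<Rightarrow> int \<Rightarrow> complex" where
  "theta_term a \<tau> n \<equiv> exp (\<i>\<pi> * of_real ((of_int n + a)\<^sup>2) * \<tau>)"

text \<open>Splitting a product of two such series by parity shifts the parameter by 1/2. The family
  in \<open>a\<close> is therefore closed under duplication, which the separate series for
  \<open>theta3\<close> and \<open>theta2\<close> are not.\<close>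

definition theta_series :: "real \<Rightarrow> complex \<Rightarrow> complex" where
  "theta_series a \<tau> = (\<Sum>\<^sub>\<infinity>n. theta_term a \<tau> n)"

lemma theta3_eq: "theta3 = theta_series 0"
  by (simp add: theta3_def theta_series_def fun_eq_iff)

lemma theta2_eq: "theta2 = theta_series (1/2)"
  by (simp add: theta2_def theta_series_def fun_eq_iff)

abbreviation upper :: "complex set" where "upper \<equiv> {\<tau>. Im \<tau> > 0}"

text \<open>Limits along this filter are uniform in Re tau; this is what lets Cauchy's inequality
  pass them on to derivatives.\<close>

abbreviation cusp :: "complex filter" where "cusp \<equiv> filtercomap Im at_top"

lemma open_upper: "open upper"
  by (simp add: open_halfspace_Im_gt)

lemma convex_upper: "convex upper"
  by (simp add: convex_halfspace_Im_gt)

lemma norm_theta_term: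
  "norm (exp (\<i>\<pi> * of_real r * \<tau>)) = exp (- pi * r * Im \<tau>)"
  by simp

lemma summable_on_int_power_abs:
  fixes r :: real
  assumes "0 \<le> r" "r < 1"
  shows "(\<lambda>n::int. r ^ nat \<bar>n\<bar>) summable_on UNIV"
proof -
  have g: "(\<lambda>n::nat. r ^ n) summable_on UNIV"
    using assms by (intro norm_summable_imp_summable_on) simp
  have 1: "(\<lambda>n::int. r ^ nat \<bar>n\<bar>) summable_on {0..}"
  proof -
    have "(\<lambda>n::int. r ^ nat \<bar>n\<bar>) summable_on {0..} \<longleftrightarrow> (\<lambda>n::nat. r ^ n) summable_on UNIV"
      by (rule summable_on_reindex_bij_witness[where i = int and j = nat]) auto
    with g show ?thesis by simp
  qed
  have 2: "(\<lambda>n::int. r ^ nat \<bar>n\<bar>) summable_on {..0}"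
  proof -
    have "(\<lambda>n::int. r ^ nat \<bar>n\<bar>) summable_on {..0} \<longleftrightarrow> (\<lambda>n::nat. r ^ n) summable_on UNIV"
      by (rule summable_on_reindex_bij_witness[where i = "\<lambda>n. - int n" and j = "\<lambda>n. nat (- n)"]) auto
    with g show ?thesis by simp
  qed
  have U: "(UNIV :: int set) = {0..} \<union> ({..0} - {0..})" by auto
  show ?thesis
    by (subst U) (intro summable_on_Un_disjoint 1 summable_on_subset_banach[OF 2]; auto)
qed

lemma summable_theta_majorant:
  assumes "y > 0"
  shows "(\<lambda>n::int. exp (- pi * (of_int n + a)\<^sup>2 * y)) summable_on (A :: int set)"
proof -
  define r where "r = exp (- (pi * y))"
  have r: "0 \<le> r" "r < 1"
    using assms by (auto simp: r_def)
  have "(\<lambda>n::int. exp (pi * y * (\<bar>a\<bar> + 1/4)) * r ^ nat \<bar>n\<bar>) summable_on UNIV"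
    by (intro summable_on_cmult_right summable_on_int_power_abs r)
  then have "(\<lambda>n::int. exp (- pi * (of_int n + a)\<^sup>2 * y)) summable_on UNIV"
  proof (rule summable_on_comparison_test)
    fix n :: int
    \<comment> \<open>For x = n + a the square gives |x| - 1/4 <= x^2, so the Gaussian is dominated
      by a geometric series in |n|.\<close>
    have "0 \<le> (\<bar>of_int n + a\<bar> - 1/2)\<^sup>2" by simp
    also have "\<dots> = (of_int n + a)\<^sup>2 - \<bar>of_int n + a\<bar> + 1/4"
      by (simp add: power2_eq_square algebra_simps abs_if)
    finally have "\<bar>of_int n\<bar> - \<bar>a\<bar> - 1/4 \<le> (of_int n + a)\<^sup>2"
      by linarith
    then have "pi * y * (\<bar>of_int n\<bar> - \<bar>a\<bar> - 1/4) \<le> pi * y * (of_int n + a)\<^sup>2"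
      using assms by (intro mult_left_mono) auto
    then have "exp (- pi * (of_int n + a)\<^sup>2 * y) \<le> exp (pi * y * (\<bar>a\<bar> + 1/4) + - (pi * y) * \<bar>of_int n\<bar>)"
      by (simp add: algebra_simps)
    also have "exp (- (pi * y) * \<bar>of_int n\<bar>) = r ^ nat \<bar>n\<bar>"
      by (simp add: r_def flip: exp_of_nat_mult)
    then have "exp (pi * y * (\<bar>a\<bar> + 1/4) + - (pi * y) * \<bar>of_int n\<bar>) = exp (pi * y * (\<bar>a\<bar> + 1/4)) * r ^ nat \<bar>n\<bar>"
      by (simp only: exp_add)
    finally show "exp (- pi * (of_int n + a)\<^sup>2 * y) \<le> exp (pi * y * (\<bar>a\<bar> + 1/4)) * r ^ nat \<bar>n\<bar>" .
  qed auto
  then show ?thesis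
    by (rule summable_on_subset_banach) auto
qed

lemma abs_summable_theta:
  assumes "Im \<tau> > 0"
  shows "(\<lambda>n::int. norm (theta_term a \<tau> n)) summable_on A"
  unfolding norm_theta_term using assms by (rule summable_theta_majorant)

lemma summable_theta:
  assumes "Im \<tau> > 0"
  shows "(\<lambda>n::int. theta_term a \<tau> n) summable_on A"
  using abs_summable_theta[OF assms] by (rule abs_summable_summable)

lemma holomorphic_theta_series: "theta_series a holomorphic_on upper"
proof -
  have *: "\<exists>f'. (theta_series a has_field_derivative f') (at z)" if e: "e > 0" and z: "Im z > e" for e z
  proof -
    have U: "uniform_limit {\<tau>. Im \<tau> > e}
       (\<lambda>X \<tau>. \<Sum>n\<in>X. theta_term a \<tau> n)
       (theta_series a) (finite_subsets_at_top (UNIV :: int set))"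
      unfolding theta_series_def
    proof (rule Weierstrass_m_test_general)
      show "(\<lambda>n::int. exp (- pi * (of_int n + a)\<^sup>2 * e)) summable_on UNIV"
        using e by (rule summable_theta_majorant)
      show "norm (theta_term a \<tau> n) \<le> exp (- pi * (of_int n + a)\<^sup>2 * e)"
        if "\<tau> \<in> {\<tau>. Im \<tau> > e}" for n :: int and \<tau>
        using that unfolding norm_theta_term by (simp add: mult_left_mono)
    qed
    have o: "open {\<tau>. Im \<tau> > e}"
      by (simp add: open_halfspace_Im_gt)
    show ?thesis
    proof -
      obtain r where r: "r > 0" "cball z r \<subseteq> {\<tau>. Im \<tau> > e}"
        using open_contains_cball o z by blast
      have "theta_series a holomorphic_on ball z r"
      proof (rule holomorphic_uniform_limit[THEN conjunct2])
        show "uniform_limit (cball z r)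
            (\<lambda>X \<tau>. \<Sum>n\<in>X. theta_term a \<tau> n)
            (theta_series a) (finite_subsets_at_top (UNIV :: int set))"
          using U r(2) by (rule uniform_limit_on_subset)
        show "\<forall>\<^sub>F X in finite_subsets_at_top (UNIV :: int set).
           continuous_on (cball z r) (\<lambda>\<tau>. \<Sum>n\<in>X. theta_term a \<tau> n) \<and>
           (\<lambda>\<tau>. \<Sum>n\<in>X. theta_term a \<tau> n) holomorphic_on ball z r"
          by (intro always_eventually allI conjI continuous_intros holomorphic_intros)
      qed auto
      then show ?thesis
        using r(1) by (simp add: holomorphic_on_open)
    qed
  qed
  then have "\<exists>f'. (theta_series a has_field_derivative f') (at z)" if "Im z > 0" for z
    using that * by (metis dense)
  then show ?thesis
    by (simp add: holomorphic_on_open[OF open_upper])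
qed

text \<open>Split Im tau as (Im tau - 1) + 1: on \<open>A\<close> the first part yields at least the
  decay exp (- pi m (Im tau - 1)), and the second leaves a convergent sum that does not depend on
  tau.\<close>

lemma norm_theta_tail:
  assumes "Im \<tau> \<ge> 1" "\<And>n. n \<in> A \<Longrightarrow> m \<le> (of_int n + a)\<^sup>2"
  shows "norm (\<Sum>\<^sub>\<infinity>n\<in>A. theta_term a \<tau> n)
          \<le> exp (- pi * m * (Im \<tau> - 1)) * (\<Sum>\<^sub>\<infinity>n::int. exp (- pi * (of_int n + a)\<^sup>2 * 1))"
proof -
  have "norm (\<Sum>\<^sub>\<infinity>n\<in>A. theta_term a \<tau> n)
     \<le> (\<Sum>\<^sub>\<infinity>n\<in>A. norm (theta_term a \<tau> n))"
    using assms by (intro norm_infsum_bound abs_summable_theta) auto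
  also have "\<dots> \<le> (\<Sum>\<^sub>\<infinity>n. exp (- pi * m * (Im \<tau> - 1)) * exp (- pi * (of_int n + a)\<^sup>2 * 1))"
  proof (rule infsum_mono_neutral)
    show "(\<lambda>n. norm (theta_term a \<tau> n)) summable_on A"
      using assms by (intro abs_summable_theta) auto
    show "(\<lambda>n. exp (- pi * m * (Im \<tau> - 1)) * exp (- pi * (of_int n + a)\<^sup>2 * 1)) summable_on UNIV"
      by (intro summable_on_cmult_right summable_theta_majorant) auto
    fix n assume n: "n \<in> A \<inter> UNIV"
    have "m * (Im \<tau> - 1) \<le> (of_int n + a)\<^sup>2 * (Im \<tau> - 1)"
      using assms n by (intro mult_right_mono) auto
    then have "pi * (m * (Im \<tau> - 1)) \<le> pi * ((of_int n + a)\<^sup>2 * (Im \<tau> - 1))"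
      by (intro mult_left_mono) auto
    then show "norm (theta_term a \<tau> n)
       \<le> exp (- pi * m * (Im \<tau> - 1)) * exp (- pi * (of_int n + a)\<^sup>2 * 1)"
      unfolding norm_theta_term exp_add[symmetric] by (simp add: algebra_simps)
  qed auto
  also have "\<dots> = exp (- pi * m * (Im \<tau> - 1)) * (\<Sum>\<^sub>\<infinity>n::int. exp (- pi * (of_int n + a)\<^sup>2 * 1))"
    by (rule infsum_cmult_right')
  finally show ?thesis .
qed

lemma holomorphic_theta3: "theta3 holomorphic_on upper"
  unfolding theta3_eq by (rule holomorphic_theta_series)

lemma holomorphic_theta2: "theta2 holomorphic_on upper"
  unfolding theta2_eq by (rule holomorphic_theta_series)

text \<open>As exp (i pi n^2) = (-1)^n, this is the alternating series of (-1)^n exp (i pi n^2 tau).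
  Defined by translation, it inherits its formulas from those of \<open>theta3\<close> at tau +
  1.\<close>

definition theta4 :: "complex \<Rightarrow> complex" where
  "theta4 \<tau> = theta3 (\<tau> + 1)"

lemma holomorphic_theta4: "theta4 holomorphic_on upper"
  unfolding theta4_def
  by (rule holomorphic_on_compose_gen[OF _ holomorphic_theta3, unfolded o_def])
     (auto intro!: holomorphic_intros)

section \<open>Behaviour at the cusp and the doubling principle\<close>

lemma theta3_cusp:
  obtains K where "\<And>\<tau>. Im \<tau> \<ge> 1 \<Longrightarrow> norm (theta3 \<tau> - 1) \<le> K * exp (- pi * Im \<tau>)"
proof
  fix \<tau> :: complex assume \<tau>: "Im \<tau> \<ge> 1"
  let ?t = "\<lambda>n::int. exp (\<i>\<pi> * of_real ((of_int n + 0)\<^sup>2) * \<tau>)"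
  have "theta3 \<tau> = infsum ?t ({0} \<union> - {0})"
    by (simp add: theta3_eq theta_series_def)
  also have "\<dots> = infsum ?t {0} + infsum ?t (- {0})"
    using \<tau> by (intro infsum_Un_disjoint summable_theta) auto
  finally have "theta3 \<tau> - 1 = infsum ?t (- {0})" by simp
  moreover have "norm (infsum ?t (- {0})) \<le> exp (- pi * 1 * (Im \<tau> - 1)) * (\<Sum>\<^sub>\<infinity>n::int. exp (- pi * (of_int n + 0)\<^sup>2 * 1))"
  proof (rule norm_theta_tail[OF \<tau>])
    fix n :: int assume "n \<in> - {0}"
    then have "1 \<le> \<bar>n\<bar>" by auto
    then have "1 \<le> \<bar>n\<bar>\<^sup>2" by (rule one_le_power)
    then show "1 \<le> (real_of_int n + 0)\<^sup>2"
      by (metis add.right_neutral of_int_1_le_iff of_int_power power2_abs)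
  qed
  moreover have "exp (- pi * 1 * (Im \<tau> - 1)) = exp pi * exp (- pi * Im \<tau>)"
    by (simp add: algebra_simps flip: exp_add)
  ultimately show "norm (theta3 \<tau> - 1) \<le> (exp pi * (\<Sum>\<^sub>\<infinity>n::int. exp (- pi * (of_int n + 0)\<^sup>2 * 1))) * exp (- pi * Im \<tau>)"
    by (simp add: mult_ac)
qed

lemma theta2_cusp:
  obtains K where "\<And>\<tau>. Im \<tau> \<ge> 1 \<Longrightarrow> norm (theta2 \<tau> * exp (- (\<i>\<pi> * \<tau> / 4)) - 2) \<le> K * exp (- pi * Im \<tau>)"
proof
  fix \<tau> :: complex assume \<tau>: "Im \<tau> \<ge> 1"
  let ?t = "\<lambda>n::int. exp (\<i>\<pi> * of_real ((of_int n + 1/2)\<^sup>2) * \<tau>)"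
  define K where "K = (\<Sum>\<^sub>\<infinity>n::int. exp (- pi * (of_int n + 1/2)\<^sup>2 * 1))"
  have "K \<ge> 0" unfolding K_def by (intro infsum_nonneg) auto
  \<comment> \<open>The terms n = 0 and n = -1 share the least exponent 1/4; all others have at
    least (3/2)^2 = 9/4, so dividing by exp (i pi tau / 4) leaves a decay of order exp (- 2 pi Im
    tau).\<close>
  have "theta2 \<tau> = infsum ?t ({0,-1} \<union> - {0,-1})"
    by (simp add: theta2_eq theta_series_def)
  also have "\<dots> = infsum ?t {0,-1} + infsum ?t (- {0,-1})"
    using \<tau> by (intro infsum_Un_disjoint summable_theta) auto
  also have "infsum ?t {0,-1} = 2 * exp (\<i>\<pi> * \<tau> / 4)"
    by (simp add: power2_eq_square field_simps)
  finally have "theta2 \<tau> * exp (- (\<i>\<pi> * \<tau> / 4)) - 2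
      = infsum ?t (- {0,-1}) * exp (- (\<i>\<pi> * \<tau> / 4))"
    by (simp add: distrib_right flip: exp_add)
  moreover have "norm (infsum ?t (- {0,-1})) \<le> exp (- pi * (9/4) * (Im \<tau> - 1)) * K"
    unfolding K_def
  proof (rule norm_theta_tail[OF \<tau>])
    fix n :: int assume "n \<in> - {0,-1}"
    then have "1 \<le> n \<or> n \<le> -2" by auto
    then have "3/2 \<le> \<bar>real_of_int n + 1/2\<bar>" by linarith
    then have "(3/2)\<^sup>2 \<le> \<bar>real_of_int n + 1/2\<bar>\<^sup>2" by (intro power_mono) auto
    then show "9/4 \<le> (real_of_int n + 1/2)\<^sup>2"
      by (simp add: power2_eq_square)
  qed
  moreover have "norm (exp (- (\<i>\<pi> * \<tau> / 4))) = exp (pi * Im \<tau> / 4)"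
    by simp
  ultimately have "norm (theta2 \<tau> * exp (- (\<i>\<pi> * \<tau> / 4)) - 2)
      \<le> exp (- pi * (9/4) * (Im \<tau> - 1)) * K * exp (pi * Im \<tau> / 4)"
    by (simp add: norm_mult)
  also have "\<dots> = exp (9/4 * pi) * K * exp (- (2 * pi * Im \<tau>))"
    by (simp add: field_simps flip: exp_add)
  also have "\<dots> \<le> exp (9/4 * pi) * K * exp (- pi * Im \<tau>)"
    using \<tau> \<open>K \<ge> 0\<close> by (intro mult_left_mono) auto
  finally show "norm (theta2 \<tau> * exp (- (\<i>\<pi> * \<tau> / 4)) - 2) \<le> exp (9/4 * pi) * K * exp (- pi * Im \<tau>)" .
qed

lemma eventually_cusp: "eventually (\<lambda>\<tau>. Im \<tau> > c) cusp"
  using eventually_filtercomap[of "\<lambda>\<tau>. Im \<tau> > c" Im at_top] eventually_gt_at_top by blast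

lemma filterlim_Im_cusp: "filterlim Im at_top cusp"
  by (rule filterlim_filtercomap)

lemma filterlim_cuspI: "filterlim (\<lambda>x. Im (f x)) at_top F \<Longrightarrow> filterlim f cusp F"
  by (simp add: filterlim_filtercomap_iff o_def)

lemma filterlim_double_cusp:
  assumes "Im \<tau> > 0"
  shows "filterlim (\<lambda>n. 2 ^ n * \<tau>) cusp sequentially"
proof (rule filterlim_cuspI)
  have "filterlim (\<lambda>n. c * 2 ^ n :: real) at_top sequentially" if "c > 0" for c
    using that by real_asymp
  moreover have "Im (of_real x * \<tau>) = Im \<tau> * x" for x
    by simp
  then have "Im (2 ^ n * \<tau>) = Im \<tau> * 2 ^ n" for n
    by (metis of_real_numeral of_real_power)
  ultimately show "filterlim (\<lambda>n. Im (2 ^ n * \<tau>)) at_top sequentially"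
    using assms by presburger
qed

text \<open>f takes the same value along the sequence 2^n tau, whose imaginary parts tend to
  infinity.\<close>

lemma doubling_invariant:
  fixes f :: "complex \<Rightarrow> complex"
  assumes f: "\<And>\<tau>. Im \<tau> > 0 \<Longrightarrow> f (2 * \<tau>) = f \<tau>" and lim: "(f \<longlongrightarrow> c) cusp" and "Im \<tau> > 0"
  shows "f \<tau> = c"
proof -
  have "Im (2 ^ n * \<tau>) > 0 \<and> f (2 ^ n * \<tau>) = f \<tau>" for n
  proof (induction n)
    case (Suc n)
    have "2 ^ Suc n * \<tau> = 2 * (2 ^ n * \<tau>)" by simp
    with Suc f[of "2 ^ n * \<tau>"] show ?case by (metis mult_2 plus_complex.simps(2) add_pos_pos)
  qed (use assms in auto)
  then have "(\<lambda>n. f (2 ^ n * \<tau>)) = (\<lambda>_. f \<tau>)" by auto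
  moreover have "(\<lambda>n. f (2 ^ n * \<tau>)) \<longlonglongrightarrow> c"
    using filterlim_compose[OF lim filterlim_double_cusp[OF \<open>Im \<tau> > 0\<close>]] .
  ultimately have "(\<lambda>_::nat. f \<tau>) \<longlonglongrightarrow> c" by (simp only:)
  then show ?thesis
    by (rule LIMSEQ_unique[OF tendsto_const])
qed

lemma decay_cusp:
  assumes "\<And>\<tau>. Im \<tau> \<ge> 1 \<Longrightarrow> norm (f \<tau>) \<le> K * exp (- pi * Im \<tau>)"
  shows "((\<lambda>\<tau>. of_real (Im \<tau>) ^ k * f \<tau> :: complex) \<longlongrightarrow> 0) cusp"
proof (rule Lim_null_comparison)
  show "\<forall>\<^sub>F \<tau> in cusp. norm (of_real (Im \<tau>) ^ k * f \<tau>) \<le> Im \<tau> ^ k * (K * exp (- pi * Im \<tau>))"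
    using eventually_cusp[of 1]
    by eventually_elim (use assms in \<open>auto simp: norm_mult norm_power intro!: mult_left_mono\<close>)
  have "((\<lambda>y. y ^ k * (K * exp (- pi * y))) \<longlongrightarrow> 0) at_top"
    using pi_gt_zero by real_asymp
  from filterlim_compose[OF this filterlim_Im_cusp]
  show "((\<lambda>\<tau>. Im \<tau> ^ k * (K * exp (- pi * Im \<tau>))) \<longlongrightarrow> 0) cusp" .
qed

lemma deriv_decay_cusp:
  assumes hol: "f holomorphic_on upper" and lim: "((\<lambda>\<tau>. of_real (Im \<tau>) ^ k * f \<tau>) \<longlongrightarrow> 0) cusp"
  shows "((\<lambda>\<tau>. of_real (Im \<tau>) ^ k * deriv f \<tau>) \<longlongrightarrow> 0) cusp"
proof (rule tendstoI)
  fix e :: real assume "e > 0"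
  \<comment> \<open>On the unit disc around tau the imaginary part is at least Im tau / 2, which
    costs the factor 2^k; the last factor 2 makes the final inequality strict.\<close>
  define e' where "e' = e / 2 ^ k / 2"
  have "e' > 0" using \<open>e > 0\<close> by (simp add: e'_def)
  from tendstoD[OF lim this] obtain P where P: "eventually P at_top"
      "\<And>\<tau>. P (Im \<tau>) \<Longrightarrow> norm (of_real (Im \<tau>) ^ k * f \<tau>) < e'"
    by (auto simp: eventually_filtercomap)
  then obtain Y where Y: "\<And>\<tau>. Im \<tau> > Y \<Longrightarrow> norm (of_real (Im \<tau>) ^ k * f \<tau>) < e'"
    by (auto simp: eventually_at_top_dense)
  show "\<forall>\<^sub>F \<tau> in cusp. dist (of_real (Im \<tau>) ^ k * deriv f \<tau>) 0 < e"
    using eventually_cusp[of "max 2 (Y + 1)"]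
  proof eventually_elim
    case (elim \<tau>)
    then have \<tau>: "Im \<tau> > 2" "Im \<tau> - 1 > Y" by auto
    define B where "B = e' * 2 ^ k / Im \<tau> ^ k"
    have "norm ((deriv ^^ 1) f \<tau>) \<le> fact 1 * B / 1 ^ 1"
    proof (rule Cauchy_inequality)
      have sub: "cball \<tau> 1 \<subseteq> upper"
      proof
        fix z assume "z \<in> cball \<tau> 1"
        then have "\<bar>Im (\<tau> - z)\<bar> \<le> 1"
          using abs_Im_le_cmod[of "\<tau> - z"] by (simp add: dist_norm)
        then show "z \<in> upper" using \<tau> by simp
      qed
      show "f holomorphic_on ball \<tau> 1"
        by (rule holomorphic_on_subset[OF hol]) (use sub ball_subset_cball in blast)
      show "continuous_on (cball \<tau> 1) f"
        by (rule continuous_on_subset[OF holomorphic_on_imp_continuous_on[OF hol] sub])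
      fix z assume "norm (\<tau> - z) = 1"
      then have z: "\<bar>Im (\<tau> - z)\<bar> \<le> 1"
        using abs_Im_le_cmod[of "\<tau> - z"] by simp
      then have "Im z > Y" "Im z \<ge> Im \<tau> / 2" "Im z > 0" using \<tau> by auto
      have "(Im \<tau> / 2) ^ k * norm (f z) \<le> Im z ^ k * norm (f z)"
        using \<open>Im z \<ge> Im \<tau> / 2\<close> \<tau> by (intro mult_right_mono power_mono) auto
      also have "\<dots> \<le> e'"
        using Y[OF \<open>Im z > Y\<close>] \<open>Im z > 0\<close> by (simp add: norm_mult norm_power)
      finally show "norm (f z) \<le> B"
        using \<tau> by (simp add: B_def field_simps power_divide)
    qed auto
    then have "Im \<tau> ^ k * norm (deriv f \<tau>) \<le> Im \<tau> ^ k * B"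
      using \<tau> by (intro mult_left_mono) auto
    also have "\<dots> = e / 2" using \<tau> by (simp add: B_def e'_def)
    also have "\<dots> < e" using \<open>e > 0\<close> by simp
    finally show ?case using \<tau> by (simp add: norm_mult norm_power)
  qed
qed

section \<open>Products of theta series, duplication and translation formulas\<close>

lemma summable_on_product_complex:
  fixes f :: "'a \<Rightarrow> complex" and g :: "'b \<Rightarrow> complex"
  assumes f: "f summable_on A" and g: "g summable_on B"
  shows "(\<lambda>(x, y). f x * g y) summable_on A \<times> B"
proof -
  have f': "(\<lambda>x. norm (f x)) summable_on A" and g': "(\<lambda>x. norm (g x)) summable_on B"
    using f g summable_on_iff_abs_summable_on_complex by auto
  have "(\<lambda>z. norm (case z of (x, y) \<Rightarrow> f x * g y)) summable_on Sigma A (\<lambda>_. B)"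
    by (rule summable_on_SigmaI[where g = "\<lambda>x. norm (f x) * (\<Sum>\<^sub>\<infinity>y\<in>B. norm (g y))"])
       (auto simp: norm_mult intro!: has_sum_cmult_right has_sum_infsum g' summable_on_cmult_left f')
  then show ?thesis by (rule abs_summable_summable)
qed

lemma infsum_product_complex:
  fixes f :: "'a \<Rightarrow> complex" and g :: "'b \<Rightarrow> complex"
  assumes f: "f summable_on A" and g: "g summable_on B"
  shows "(\<Sum>\<^sub>\<infinity>(x, y)\<in>A \<times> B. f x * g y) = infsum f A * infsum g B"
  by (subst infsum_Sigma'_banach[OF summable_on_product_complex[OF f g], symmetric])
     (simp add: infsum_cmult_right' infsum_cmult_left')

text \<open>The substitution keeps sums of two squares diagonal: (a + b)^2 + (a - b)^2 = 2 a^2 + 2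
  b^2. This factor 2 is the origin of the doubling of tau.\<close>

lemma infsum_int_pairs_parity:
  fixes h :: "int \<times> int \<Rightarrow> complex"
  assumes "h summable_on UNIV"
  shows "infsum h UNIV = infsum (\<lambda>(a, b). h (a + b, a - b)) UNIV + infsum (\<lambda>(a, b). h (a + b + 1, a - b)) UNIV"
    and "(\<lambda>(a, b). h (a + b, a - b)) summable_on UNIV"
    and "(\<lambda>(a, b). h (a + b + 1, a - b)) summable_on UNIV"
proof -
  let ?E = "{(m :: int, n :: int). even (m + n)}" and ?O = "{(m :: int, n :: int). odd (m + n)}"
  have U: "(UNIV :: (int \<times> int) set) = ?E \<union> ?O" "?E \<inter> ?O = {}" by auto
  have s: "h summable_on X" for X
    by (rule summable_on_subset_banach[OF assms]) auto
  have E: "infsum (\<lambda>(a, b). h (a + b, a - b)) UNIV = infsum h ?E"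
    by (rule infsum_reindex_bij_witness[where i = "\<lambda>(m, n). ((m + n) div 2, (m - n) div 2)"
          and j = "\<lambda>(a, b). (a + b, a - b)"]) (auto, presburger+)
  have O: "infsum (\<lambda>(a, b). h (a + b + 1, a - b)) UNIV = infsum h ?O"
    by (rule infsum_reindex_bij_witness[where i = "\<lambda>(m, n). ((m + n - 1) div 2, (m - n - 1) div 2)"
          and j = "\<lambda>(a, b). (a + b + 1, a - b)"]) (auto, presburger+)
  show "(\<lambda>(a, b). h (a + b, a - b)) summable_on UNIV"
    by (rule summable_on_reindex_bij_witness[where i = "\<lambda>(m, n). ((m + n) div 2, (m - n) div 2)"
          and j = "\<lambda>(a, b). (a + b, a - b)", THEN iffD2, OF _ _ _ _ _ s[of ?E]]) (auto, presburger+)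
  show "(\<lambda>(a, b). h (a + b + 1, a - b)) summable_on UNIV"
    by (rule summable_on_reindex_bij_witness[where i = "\<lambda>(m, n). ((m + n - 1) div 2, (m - n - 1) div 2)"
          and j = "\<lambda>(a, b). (a + b + 1, a - b)", THEN iffD2, OF _ _ _ _ _ s[of ?O]]) (auto, presburger+)
  show "infsum h UNIV = infsum (\<lambda>(a, b). h (a + b, a - b)) UNIV + infsum (\<lambda>(a, b). h (a + b + 1, a - b)) UNIV"
    unfolding E O by (subst U(1)) (intro infsum_Un_disjoint s U(2))
qed

lemma theta_series_mult:
  assumes "Im \<tau> > 0"
  shows "theta_series a \<tau> * theta_series b \<tau> =
    (\<Sum>\<^sub>\<infinity>(m, n). exp (\<i>\<pi> * of_real ((of_int m + a)\<^sup>2 + (of_int n + b)\<^sup>2) * \<tau>))" (is "_ = infsum ?h UNIV")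
    and "(\<lambda>(m, n). exp (\<i>\<pi> * of_real ((of_int m + a)\<^sup>2 + (of_int n + b)\<^sup>2) * \<tau>)) summable_on (UNIV :: (int \<times> int) set)"
proof -
  have *: "exp (\<i>\<pi> * of_real ((of_int m + a)\<^sup>2 + (of_int n + b)\<^sup>2) * \<tau>)
      = exp (\<i>\<pi> * of_real ((of_int m + a)\<^sup>2) * \<tau>) * exp (\<i>\<pi> * of_real ((of_int n + b)\<^sup>2) * \<tau>)" for m n :: int
    by (simp add: algebra_simps flip: exp_add)
  show "theta_series a \<tau> * theta_series b \<tau> = infsum ?h UNIV"
    unfolding theta_series_def * infsum_product_complex[OF summable_theta[OF assms] summable_theta[OF assms], symmetric]
    by simp
  show "?h summable_on UNIV"
    unfolding * using summable_on_product_complex[OF summable_theta[OF assms] summable_theta[OF assms]]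
    by (metis UNIV_Times_UNIV)
qed

text \<open>Pairs of even sum yield the parameters a and 0 at 2 tau; pairs of odd sum yield a + 1/2
  and 1/2, because the extra 1 is shared equally between the two new variables.\<close>

lemma theta_series_square:
  assumes "Im \<tau> > 0"
  shows "(theta_series a \<tau>)\<^sup>2 = theta_series a (2 * \<tau>) * theta_series 0 (2 * \<tau>)
    + theta_series (a + 1/2) (2 * \<tau>) * theta_series (1/2) (2 * \<tau>)"
proof -
  have 2: "Im (2 * \<tau>) > 0" using assms by simp
  let ?h = "\<lambda>(m :: int, n :: int). exp (\<i>\<pi> * of_real ((of_int m + a)\<^sup>2 + (of_int n + a)\<^sup>2) * \<tau>)"
  have e: "of_real ((of_int (c + d) + a)\<^sup>2 + (of_int (c - d) + a)\<^sup>2) * \<tau>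
      = of_real ((of_int c + a)\<^sup>2 + (of_int d + 0)\<^sup>2) * (2 * \<tau>)" for c d :: int
    by (simp add: power2_eq_square algebra_simps)
  have o: "of_real ((of_int (c + d + 1) + a)\<^sup>2 + (of_int (c - d) + a)\<^sup>2) * \<tau>
      = of_real ((of_int c + (a + 1/2))\<^sup>2 + (of_int d + 1/2)\<^sup>2) * (2 * \<tau>)" for c d :: int
    by (simp add: power2_eq_square algebra_simps)
  have "(theta_series a \<tau>)\<^sup>2 = infsum ?h UNIV"
    unfolding power2_eq_square by (rule theta_series_mult[OF assms, unfolded power2_eq_square])
  also have "\<dots> = infsum (\<lambda>(c, d). ?h (c + d, c - d)) UNIV + infsum (\<lambda>(c, d). ?h (c + d + 1, c - d)) UNIV"
    by (rule infsum_int_pairs_parity[OF theta_series_mult(2)[OF assms]])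
  also have "infsum (\<lambda>(c, d). ?h (c + d, c - d)) UNIV = theta_series a (2 * \<tau>) * theta_series 0 (2 * \<tau>)"
    unfolding theta_series_mult(1)[OF 2] prod.case mult.assoc e ..
  also have "infsum (\<lambda>(c, d). ?h (c + d + 1, c - d)) UNIV = theta_series (a + 1/2) (2 * \<tau>) * theta_series (1/2) (2 * \<tau>)"
    unfolding theta_series_mult(1)[OF 2] prod.case mult.assoc o ..
  finally show ?thesis .
qed

lemma theta_series_shift: "theta_series (a + 1) \<tau> = theta_series a \<tau>"
  unfolding theta_series_def
  by (rule infsum_reindex_bij_witness[where i = "\<lambda>n. n - 1" and j = "\<lambda>n. n + 1"]) (auto simp: add_ac)

lemma theta3_double:
  assumes "Im \<tau> > 0"
  shows "(theta3 \<tau>)\<^sup>2 = (theta3 (2 * \<tau>))\<^sup>2 + (theta2 (2 * \<tau>))\<^sup>2"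
  using theta_series_square[OF assms, of 0] by (simp add: theta3_eq theta2_eq power2_eq_square)

lemma theta2_double:
  assumes "Im \<tau> > 0"
  shows "(theta2 \<tau>)\<^sup>2 = 2 * theta2 (2 * \<tau>) * theta3 (2 * \<tau>)"
  using theta_series_square[OF assms, of "1/2"] theta_series_shift[of 0 "2 * \<tau>"]
  by (simp add: theta3_eq theta2_eq)

lemma theta3_plus2: "theta3 (\<tau> + 2) = theta3 \<tau>"
proof -
  have "exp (\<i>\<pi> * (of_int n)\<^sup>2 * (\<tau> + 2)) = exp (\<i>\<pi> * (of_int n)\<^sup>2 * \<tau>)" for n :: int
    by (rule exp_eq[THEN iffD2], rule exI[of _ "n\<^sup>2"]) (simp add: algebra_simps)
  then show ?thesis by (simp add: theta3_def)
qed

lemma theta2_plus2: "theta2 (\<tau> + 2) = \<i> * theta2 \<tau>"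
proof -
  have "exp (\<i>\<pi> * (of_int n + 1/2)\<^sup>2 * (\<tau> + 2)) = \<i> * exp (\<i>\<pi> * (of_int n + 1/2)\<^sup>2 * \<tau>)" for n :: int
  proof -
    have "exp (\<i>\<pi> * (of_int n + 1/2)\<^sup>2 * (\<tau> + 2))
        = exp (of_real pi / 2 * \<i> + \<i>\<pi> * (of_int n + 1/2)\<^sup>2 * \<tau>)"
      \<comment> \<open>2 (n + 1/2)^2 = 2 (n^2 + n) + 1/2: an even multiple of i pi, and the quarter
        turn that becomes the factor i.\<close>
      by (rule exp_eq[THEN iffD2], rule exI[of _ "n\<^sup>2 + n"]) (simp add: power2_eq_square algebra_simps)
    also have "\<dots> = \<i> * exp (\<i>\<pi> * (of_int n + 1/2)\<^sup>2 * \<tau>)"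
    proof -
      have "exp (of_real pi / 2 * \<i>) = \<i>" by (simp add: exp_eq_polar)
      then show ?thesis by (simp only: exp_add)
    qed
    finally show ?thesis .
  qed
  then show ?thesis by (simp add: theta2_def infsum_cmult_right')
qed

lemma theta4_plus1: "theta4 (\<tau> + 1) = theta3 \<tau>"
  using theta3_plus2[of \<tau>] by (simp add: theta4_def add.assoc)

text \<open>This is \<open>theta3_double\<close> at tau + 1: there the argument 2 tau moves by 2,
  which fixes \<open>theta3\<close> and reverses the sign of the square of
  \<open>theta2\<close>.\<close>

lemma theta4_double:
  assumes "Im \<tau> > 0"
  shows "(theta4 \<tau>)\<^sup>2 = (theta3 (2 * \<tau>))\<^sup>2 - (theta2 (2 * \<tau>))\<^sup>2"
  using theta3_double[of "\<tau> + 1"] assms theta3_plus2[of "2 * \<tau>"] theta2_plus2[of "2 * \<tau>"]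
  by (simp add: theta4_def algebra_simps power_mult_distrib)

text \<open>With X and Y the squares of \<open>theta3\<close> and \<open>theta2\<close> at 2 tau,
  the duplication formulas turn the claim into (X + Y)^2 = 4 X Y + (X - Y)^2.\<close>

lemma jacobi_identity:
  assumes "Im \<tau> > 0"
  shows "theta3 \<tau> ^ 4 = theta2 \<tau> ^ 4 + theta4 \<tau> ^ 4"
proof -
  have *: "x ^ 4 = (x\<^sup>2)\<^sup>2" for x :: complex by (simp flip: power_mult)
  show ?thesis
    unfolding * theta3_double[OF assms] theta4_double[OF assms] theta2_double[OF assms]
    by (simp add: power2_eq_square algebra_simps)
qed

text \<open>Translation by 1 exchanges \<open>theta3\<close> and \<open>theta4\<close>; Jacobi's
  identity at tau and at tau + 1 then differ only in the sign of the \<open>theta2\<close>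
  term.\<close>

lemma theta2_plus1:
  assumes "Im \<tau> > 0"
  shows "theta2 (\<tau> + 1) ^ 4 = - (theta2 \<tau> ^ 4)"
proof -
  have "theta4 \<tau> ^ 4 = theta2 (\<tau> + 1) ^ 4 + theta3 \<tau> ^ 4"
    using jacobi_identity[of "\<tau> + 1"] assms by (simp only: theta4_plus1 theta4_def[symmetric]) simp
  with jacobi_identity[OF assms] show ?thesis
    by (metis add_diff_cancel_left' add_uminus_conv_diff diff_add_cancel minus_diff_eq)
qed

lemma theta3_tendsto: "(theta3 \<longlongrightarrow> 1) cusp"
proof -
  obtain K where "\<And>\<tau>. Im \<tau> \<ge> 1 \<Longrightarrow> norm (theta3 \<tau> - 1) \<le> K * exp (- pi * Im \<tau>)"
    by (rule theta3_cusp) blast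
  from decay_cusp[OF this, of 0] show ?thesis by (simp add: LIM_zero_cancel)
qed

lemma theta2_tendsto: "((\<lambda>\<tau>. theta2 \<tau> * exp (- (\<i>\<pi> * \<tau> / 4))) \<longlongrightarrow> 2) cusp"
proof -
  obtain K where "\<And>\<tau>. Im \<tau> \<ge> 1 \<Longrightarrow> norm (theta2 \<tau> * exp (- (\<i>\<pi> * \<tau> / 4)) - 2) \<le> K * exp (- pi * Im \<tau>)"
    by (rule theta2_cusp) blast
  from decay_cusp[OF this, of 0] show ?thesis by (simp add: LIM_zero_cancel)
qed

lemma filterlim_shift_cusp: "filterlim (\<lambda>\<tau>. \<tau> + of_real x) cusp cusp"
  by (rule filterlim_cuspI) (simp add: filterlim_Im_cusp)

lemma theta4_tendsto: "(theta4 \<longlongrightarrow> 1) cusp"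
  using filterlim_compose[OF theta3_tendsto filterlim_shift_cusp[of 1]]
  by (simp add: theta4_def[abs_def])

text \<open>A zero would propagate along 2^n tau to the cusp and make the limit there 0. This yields
  non-vanishing without a product formula.\<close>

lemma nonzero_by_doubling:
  fixes f :: "complex \<Rightarrow> complex"
  assumes f: "\<And>\<tau>. Im \<tau> > 0 \<Longrightarrow> f \<tau> = 0 \<Longrightarrow> f (2 * \<tau>) = 0"
    and lim: "(f \<longlongrightarrow> c) cusp" and "c \<noteq> 0" and "Im \<tau> > 0"
  shows "f \<tau> \<noteq> 0"
proof
  assume "f \<tau> = 0"
  have *: "Im (2 ^ n * \<tau>) > 0 \<and> f (2 ^ n * \<tau>) = 0" for n
  proof (induction n)
    case (Suc n)
    have "2 ^ Suc n * \<tau> = 2 * (2 ^ n * \<tau>)" by simp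
    with Suc f[of "2 ^ n * \<tau>"] show ?case by (metis mult_2 plus_complex.simps(2) add_pos_pos)
  qed (use assms \<open>f \<tau> = 0\<close> in auto)
  have "(\<lambda>n. f (2 ^ n * \<tau>)) \<longlonglongrightarrow> c"
    using filterlim_compose[OF lim filterlim_double_cusp[OF \<open>Im \<tau> > 0\<close>]] .
  with * have "(\<lambda>_::nat. 0 :: complex) \<longlonglongrightarrow> c" by simp
  with \<open>c \<noteq> 0\<close> show False using LIMSEQ_unique[OF tendsto_const] by metis
qed

text \<open>If \<open>theta4\<close> vanishes at tau, then \<open>theta3\<close> and
  \<open>theta2\<close> have equal fourth powers at 2 tau, and Jacobi's identity moves the zero of
  \<open>theta4\<close> to 2 tau.\<close>

lemma theta4_nonzero:
  assumes "Im \<tau> > 0"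
  shows "theta4 \<tau> \<noteq> 0"
proof (rule nonzero_by_doubling[OF _ theta4_tendsto _ assms])
  fix \<tau> :: complex assume \<tau>: "Im \<tau> > 0" and 0: "theta4 \<tau> = 0"
  then have "(theta3 (2 * \<tau>))\<^sup>2 = (theta2 (2 * \<tau>))\<^sup>2"
    using theta4_double[OF \<tau>] by simp
  then have "((theta3 (2 * \<tau>))\<^sup>2)\<^sup>2 = ((theta2 (2 * \<tau>))\<^sup>2)\<^sup>2" by simp
  then have "theta3 (2 * \<tau>) ^ 4 = theta2 (2 * \<tau>) ^ 4" by (simp flip: power_mult)
  then show "theta4 (2 * \<tau>) = 0"
    using jacobi_identity[of "2 * \<tau>"] \<tau> by simp
qed auto

lemma theta3_nonzero: "Im \<tau> > 0 \<Longrightarrow> theta3 \<tau> \<noteq> 0"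
  using theta4_nonzero[of "\<tau> + 1"] by (simp add: theta4_plus1)

lemma theta2_nonzero:
  assumes "Im \<tau> > 0"
  shows "theta2 \<tau> \<noteq> 0"
proof -
  \<comment> \<open>\<open>theta2\<close> itself tends to 0 at the cusp; the exponential restores
    the nonzero limit 2 that the doubling argument needs.\<close>
  have "theta2 \<tau> * exp (- (\<i>\<pi> * \<tau> / 4)) \<noteq> 0"
  proof (rule nonzero_by_doubling[OF _ theta2_tendsto _ assms])
    fix \<tau> :: complex assume \<tau>: "Im \<tau> > 0" and 0: "theta2 \<tau> * exp (- (\<i>\<pi> * \<tau> / 4)) = 0"
    then show "theta2 (2 * \<tau>) * exp (- (\<i>\<pi> * (2 * \<tau>) / 4)) = 0"
      using theta2_double[OF \<tau>] theta3_nonzero[of "2 * \<tau>"] by simp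
  qed auto
  then show ?thesis by simp
qed

section \<open>Differential equations\<close>

lemma eventually_cuspI: "(\<And>\<tau>. Im \<tau> > 0 \<Longrightarrow> P \<tau>) \<Longrightarrow> eventually P cusp"
  using eventually_mono[OF eventually_cusp[of 0]] by blast

lemma has_deriv_upper:
  "f holomorphic_on upper \<Longrightarrow> Im \<tau> > 0 \<Longrightarrow> (f has_field_derivative deriv f \<tau>) (at \<tau>)"
  by (rule holomorphic_derivI[OF _ open_upper]) auto

lemma DERIV_double:
  assumes "(f has_field_derivative D) (at (2 * \<tau> :: complex))"
  shows "((\<lambda>\<tau>. f (2 * \<tau>)) has_field_derivative 2 * D) (at \<tau>)"
proof -
  have "((\<lambda>\<tau>. 2 * \<tau>) has_field_derivative 2) (at \<tau>)"
    by (auto intro!: derivative_eq_intros)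
  from DERIV_chain2[where f = f and g = "\<lambda>\<tau>. 2 * \<tau>" and x = \<tau> and s = UNIV, OF assms this]
  show ?thesis by (simp add: mult.commute)
qed

lemma has_deriv_upper_double:
  assumes "f holomorphic_on upper" "Im \<tau> > 0"
  shows "((\<lambda>\<tau>. f (2 * \<tau>)) has_field_derivative 2 * deriv f (2 * \<tau>)) (at \<tau>)"
  using assms by (intro DERIV_double has_deriv_upper) auto

lemma upper_deriv_unique:
  assumes "\<And>\<tau>. Im \<tau> > 0 \<Longrightarrow> g \<tau> = h \<tau>" "Im \<tau> > 0"
    "(g has_field_derivative a) (at \<tau>)" "(h has_field_derivative b) (at \<tau>)"
  shows "a = b"
proof -
  have "(h has_field_derivative a) (at \<tau>)"
    by (rule has_field_derivative_transform_within_open[OF assms(3) open_upper]) (use assms in auto)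
  then show ?thesis using assms(4) by (rule DERIV_unique)
qed

lemma deriv_theta3_double:
  assumes "Im \<tau> > 0"
  shows "theta3 \<tau> * deriv theta3 \<tau> =
    2 * (theta3 (2 * \<tau>) * deriv theta3 (2 * \<tau>) + theta2 (2 * \<tau>) * deriv theta2 (2 * \<tau>))"
proof -
  have "2 * theta3 \<tau> * deriv theta3 \<tau> = 2 * theta3 (2 * \<tau>) * (2 * deriv theta3 (2 * \<tau>))
     + 2 * theta2 (2 * \<tau>) * (2 * deriv theta2 (2 * \<tau>))"
    by (rule upper_deriv_unique[OF theta3_double assms])
       (auto intro!: derivative_eq_intros has_deriv_upper_double has_deriv_upper assms
          holomorphic_theta3 holomorphic_theta2)
  then have "2 * (theta3 \<tau> * deriv theta3 \<tau>) =
    2 * (2 * (theta3 (2 * \<tau>) * deriv theta3 (2 * \<tau>) + theta2 (2 * \<tau>) * deriv theta2 (2 * \<tau>)))"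
    by (simp add: algebra_simps)
  then show ?thesis by (rule mult_left_cancel[THEN iffD1, rotated]) simp
qed

lemma deriv_theta2_double:
  assumes "Im \<tau> > 0"
  shows "theta2 \<tau> * deriv theta2 \<tau> =
    2 * (deriv theta2 (2 * \<tau>) * theta3 (2 * \<tau>) + theta2 (2 * \<tau>) * deriv theta3 (2 * \<tau>))"
proof -
  have "2 * theta2 \<tau> * deriv theta2 \<tau> = 2 * (2 * deriv theta2 (2 * \<tau>)) * theta3 (2 * \<tau>)
     + 2 * theta2 (2 * \<tau>) * (2 * deriv theta3 (2 * \<tau>))"
    by (rule upper_deriv_unique[OF theta2_double assms])
       (auto intro!: derivative_eq_intros has_deriv_upper_double has_deriv_upper assms
          holomorphic_theta3 holomorphic_theta2)
  then have "2 * (theta2 \<tau> * deriv theta2 \<tau>) =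
    2 * (2 * (deriv theta2 (2 * \<tau>) * theta3 (2 * \<tau>) + theta2 (2 * \<tau>) * deriv theta3 (2 * \<tau>)))"
    by (simp add: algebra_simps)
  then show ?thesis by (rule mult_left_cancel[THEN iffD1, rotated]) simp
qed

lemma deriv_theta3_decay: "((\<lambda>\<tau>. of_real (Im \<tau>) ^ k * deriv theta3 \<tau>) \<longlongrightarrow> 0) cusp"
proof -
  obtain K where "\<And>\<tau>. Im \<tau> \<ge> 1 \<Longrightarrow> norm (theta3 \<tau> - 1) \<le> K * exp (- pi * Im \<tau>)"
    by (rule theta3_cusp) blast
  from decay_cusp[OF this, of k]
  have *: "((\<lambda>\<tau>. of_real (Im \<tau>) ^ k * deriv (\<lambda>\<tau>. theta3 \<tau> - 1) \<tau>) \<longlongrightarrow> 0) cusp"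
    by (intro deriv_decay_cusp holomorphic_intros holomorphic_theta3)
  have "deriv (\<lambda>\<tau>. theta3 \<tau> - 1) \<tau> = deriv theta3 \<tau>" if "Im \<tau> > 0" for \<tau>
    by (rule DERIV_imp_deriv) (auto intro!: derivative_eq_intros has_deriv_upper that holomorphic_theta3)
  then have "\<forall>\<^sub>F \<tau> in cusp. of_real (Im \<tau>) ^ k * deriv (\<lambda>\<tau>. theta3 \<tau> - 1) \<tau> = of_real (Im \<tau>) ^ k * deriv theta3 \<tau>"
    by (intro eventually_cuspI) simp
  from Lim_transform_eventually[OF * this] show ?thesis .
qed

text \<open>The limit is the exponent of the leading term 2 exp (i pi tau / 4).\<close>

lemma dlog_theta2_tendsto: "((\<lambda>\<tau>. deriv theta2 \<tau> / theta2 \<tau>) \<longlongrightarrow> \<i>\<pi> / 4) cusp"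
proof -
  let ?e = "\<lambda>\<tau>. exp (- (\<i>\<pi> * \<tau> / 4))"
  let ?g = "\<lambda>\<tau>. theta2 \<tau> * ?e \<tau> - 2"
  obtain K where "\<And>\<tau>. Im \<tau> \<ge> 1 \<Longrightarrow> norm (?g \<tau>) \<le> K * exp (- pi * Im \<tau>)"
    by (rule theta2_cusp) blast
  from decay_cusp[OF this, of 0]
  have 1: "((\<lambda>\<tau>. of_real (Im \<tau>) ^ 0 * deriv ?g \<tau>) \<longlongrightarrow> 0) cusp"
    by (intro deriv_decay_cusp holomorphic_intros holomorphic_theta2) auto
  have "deriv ?g \<tau> = (deriv theta2 \<tau> - \<i>\<pi> / 4 * theta2 \<tau>) * ?e \<tau>" if "Im \<tau> > 0" for \<tau>
    by (rule DERIV_imp_deriv)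
       (auto intro!: derivative_eq_intros has_deriv_upper that holomorphic_theta2 simp: algebra_simps)
  then have e: "\<forall>\<^sub>F \<tau> in cusp. deriv ?g \<tau> / (theta2 \<tau> * ?e \<tau>) + \<i>\<pi> / 4 = deriv theta2 \<tau> / theta2 \<tau>"
    by (intro eventually_cuspI) (simp add: theta2_nonzero field_simps)
  have "((\<lambda>\<tau>. deriv ?g \<tau> / (theta2 \<tau> * ?e \<tau>) + \<i>\<pi> / 4) \<longlongrightarrow> 0 / 2 + \<i>\<pi> / 4) cusp"
    using 1 by (intro tendsto_intros theta2_tendsto) auto
  from Lim_transform_eventually[OF this e] show ?thesis by simp
qed

lemma dlog_theta3_tendsto: "((\<lambda>\<tau>. deriv theta3 \<tau> / theta3 \<tau>) \<longlongrightarrow> 0) cusp"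
  using tendsto_divide[OF deriv_theta3_decay[of 0] theta3_tendsto] by simp

text \<open>Both sides have weight 2, so their quotient \<open>h\<close> is a candidate for
  doubling. Differentiating the duplication formulas shows that it is invariant, and its limit at
  the cusp is i pi / 4 because \<open>theta4\<close> tends to 1.\<close>

lemma dlog_theta2_minus_dlog_theta3:
  assumes "Im \<tau> > 0"
  shows "deriv theta2 \<tau> / theta2 \<tau> - deriv theta3 \<tau> / theta3 \<tau> = \<i>\<pi> / 4 * theta4 \<tau> ^ 4"
proof -
  define h where "h \<tau> = (deriv theta2 \<tau> / theta2 \<tau> - deriv theta3 \<tau> / theta3 \<tau>) / theta4 \<tau> ^ 4" for \<tau>
  have "h \<tau> = (\<i>\<pi> / 4 - 0) / 1 ^ 4"
  proof (rule doubling_invariant[OF _ _ assms])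
    show "(h \<longlongrightarrow> (\<i>\<pi> / 4 - 0) / 1 ^ 4) cusp"
      unfolding h_def[abs_def]
      by (intro tendsto_intros dlog_theta2_tendsto dlog_theta3_tendsto theta4_tendsto) auto
  next
    fix \<tau> :: complex assume \<tau>: "Im \<tau> > 0"
    define a b a' b' where ab: "a = theta3 (2 * \<tau>)" "b = theta2 (2 * \<tau>)" "a' = deriv theta3 (2 * \<tau>)" "b' = deriv theta2 (2 * \<tau>)"
    have nz: "a \<noteq> 0" "b \<noteq> 0" "theta3 \<tau> \<noteq> 0" "theta2 \<tau> \<noteq> 0" "theta4 \<tau> \<noteq> 0"
      using \<tau> by (auto simp: ab theta3_nonzero theta2_nonzero theta4_nonzero)
    have sq: "theta3 \<tau> ^ 2 = a\<^sup>2 + b\<^sup>2" "theta2 \<tau> ^ 2 = 2 * b * a" "theta4 \<tau> ^ 2 = a\<^sup>2 - b\<^sup>2"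
      using theta3_double[OF \<tau>] theta2_double[OF \<tau>] theta4_double[OF \<tau>] by (simp_all add: ab)
    have nz2: "a\<^sup>2 + b\<^sup>2 \<noteq> 0" "a\<^sup>2 - b\<^sup>2 \<noteq> 0"
      using nz sq by (metis power_not_zero)+
    have "deriv theta2 \<tau> / theta2 \<tau> = theta2 \<tau> * deriv theta2 \<tau> / theta2 \<tau> ^ 2"
      using nz by (simp add: power2_eq_square)
    also have "\<dots> = 2 * (b' * a + b * a') / (2 * b * a)"
      unfolding deriv_theta2_double[OF \<tau>] sq by (simp add: ab)
    finally have 2: "deriv theta2 \<tau> / theta2 \<tau> = 2 * (b' * a + b * a') / (2 * b * a)" .
    have "deriv theta3 \<tau> / theta3 \<tau> = theta3 \<tau> * deriv theta3 \<tau> / theta3 \<tau> ^ 2"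
      using nz by (simp add: power2_eq_square)
    also have "\<dots> = 2 * (a * a' + b * b') / (a\<^sup>2 + b\<^sup>2)"
      unfolding deriv_theta3_double[OF \<tau>] sq by (simp add: ab)
    finally have 3: "deriv theta3 \<tau> / theta3 \<tau> = 2 * (a * a' + b * b') / (a\<^sup>2 + b\<^sup>2)" .
    have 4: "theta4 \<tau> ^ 4 = (a\<^sup>2 - b\<^sup>2)\<^sup>2"
      unfolding sq(3)[symmetric] by (simp flip: power_mult)
    \<comment> \<open>Jacobi's identity at 2 tau, factored: one of the two factors a^2 - b^2 in the
      denominator of \<open>h\<close> at tau cancels, and what remains is the denominator of
      \<open>h\<close> at 2 tau.\<close>
    have 5: "theta4 (2 * \<tau>) ^ 4 = (a\<^sup>2 + b\<^sup>2) * (a\<^sup>2 - b\<^sup>2)"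
      using jacobi_identity[of "2 * \<tau>"] \<tau> by (simp add: ab power4_eq_xxxx power2_eq_square algebra_simps)
    have "2 * (b' * a + b * a') / (2 * b * a) - 2 * (a * a' + b * b') / (a\<^sup>2 + b\<^sup>2)
       = (b' / b - a' / a) * (a\<^sup>2 - b\<^sup>2) / (a\<^sup>2 + b\<^sup>2)"
      using nz nz2(1) by (simp add: divide_simps) (simp add: power2_eq_square algebra_simps)
    then have "h \<tau> = (b' / b - a' / a) * (a\<^sup>2 - b\<^sup>2) / (a\<^sup>2 + b\<^sup>2) / (a\<^sup>2 - b\<^sup>2)\<^sup>2"
      unfolding h_def 2 3 4 by simp
    also have "\<dots> = (b' / b - a' / a) / ((a\<^sup>2 + b\<^sup>2) * (a\<^sup>2 - b\<^sup>2))"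
      using nz2(2) by (simp add: power2_eq_square[of "a\<^sup>2 - b\<^sup>2"])
    also have "\<dots> = h (2 * \<tau>)"
      unfolding h_def 5 by (simp add: ab)
    finally show "h (2 * \<tau>) = h \<tau>" by simp
  qed
  then show ?thesis
    using theta4_nonzero[OF assms] by (simp add: h_def field_simps)
qed

text \<open>The u of the overview: D f / f for f = \<open>theta3\<close> squared. It is only
  quasimodular of weight 2, as the extra term in \<open>hyp_solution_inversion\<close>
  reflects.\<close>

definition theta_dlog :: "complex \<Rightarrow> complex" where
  "theta_dlog \<tau> = 2 * (deriv theta3 \<tau> / theta3 \<tau>) / (\<i>\<pi>)"

lemma deriv_theta3: "Im \<tau> > 0 \<Longrightarrow> deriv theta3 \<tau> = \<i>\<pi> / 2 * theta_dlog \<tau> * theta3 \<tau>"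
  using theta3_nonzero[of \<tau>] by (simp add: theta_dlog_def)

lemma deriv_theta2:
  "Im \<tau> > 0 \<Longrightarrow> deriv theta2 \<tau> = \<i>\<pi> / 2 * (theta_dlog \<tau> + theta4 \<tau> ^ 4 / 2) * theta2 \<tau>"
proof -
  assume \<tau>: "Im \<tau> > 0"
  define p where "p = \<i>\<pi>"
  have "p \<noteq> 0" by (simp add: p_def)
  then have "p / 2 * (2 * x / p + t / 2) = x + p / 4 * t" for x t
    by (simp add: field_simps)
  from this[of "deriv theta3 \<tau> / theta3 \<tau>" "theta4 \<tau> ^ 4"]
  have "p / 2 * (theta_dlog \<tau> + theta4 \<tau> ^ 4 / 2) = deriv theta2 \<tau> / theta2 \<tau>"
    using dlog_theta2_minus_dlog_theta3[OF \<tau>] unfolding theta_dlog_def p_def[symmetric]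
    by (simp only: diff_eq_eq add.commute)
  then show ?thesis using theta2_nonzero[OF \<tau>] by (simp add: p_def)
qed

lemma DERIV_theta3_sq:
  assumes "Im \<tau> > 0"
  shows "((\<lambda>\<tau>. theta3 \<tau> ^ 2) has_field_derivative \<i>\<pi> * theta_dlog \<tau> * theta3 \<tau> ^ 2) (at \<tau>)"
  by (auto intro!: derivative_eq_intros has_deriv_upper assms holomorphic_theta3
      simp: deriv_theta3[OF assms] power2_eq_square)

lemma DERIV_theta2_sq:
  assumes "Im \<tau> > 0"
  shows "((\<lambda>\<tau>. theta2 \<tau> ^ 2) has_field_derivative \<i>\<pi> * (theta_dlog \<tau> + theta4 \<tau> ^ 4 / 2) * theta2 \<tau> ^ 2) (at \<tau>)"
  by (auto intro!: derivative_eq_intros has_deriv_upper assms holomorphic_theta2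
      simp: deriv_theta2[OF assms] power2_eq_square)

lemma DERIV_theta3_pow4:
  assumes "Im \<tau> > 0"
  shows "((\<lambda>\<tau>. theta3 \<tau> ^ 4) has_field_derivative \<i>\<pi> * (2 * theta_dlog \<tau>) * theta3 \<tau> ^ 4) (at \<tau>)"
  by (auto intro!: derivative_eq_intros has_deriv_upper assms holomorphic_theta3
      simp: deriv_theta3[OF assms] power4_eq_xxxx power3_eq_cube)

lemma DERIV_theta2_pow4:
  assumes "Im \<tau> > 0"
  shows "((\<lambda>\<tau>. theta2 \<tau> ^ 4) has_field_derivative \<i>\<pi> * (2 * theta_dlog \<tau> + theta4 \<tau> ^ 4) * theta2 \<tau> ^ 4) (at \<tau>)"
  by (auto intro!: derivative_eq_intros has_deriv_upper assms holomorphic_theta2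
      simp: deriv_theta2[OF assms] power4_eq_xxxx power3_eq_cube algebra_simps)

lemma DERIV_theta4_pow4:
  assumes "Im \<tau> > 0"
  shows "((\<lambda>\<tau>. theta4 \<tau> ^ 4) has_field_derivative \<i>\<pi> * (2 * theta_dlog \<tau> - theta2 \<tau> ^ 4) * theta4 \<tau> ^ 4) (at \<tau>)"
proof -
  have "((\<lambda>\<tau>. theta3 \<tau> ^ 4 - theta2 \<tau> ^ 4) has_field_derivative
      \<i>\<pi> * (2 * theta_dlog \<tau>) * theta3 \<tau> ^ 4
      - \<i>\<pi> * (2 * theta_dlog \<tau> + theta4 \<tau> ^ 4) * theta2 \<tau> ^ 4) (at \<tau>)"
    by (intro derivative_intros DERIV_theta3_pow4 DERIV_theta2_pow4 assms)
  then have "((\<lambda>\<tau>. theta4 \<tau> ^ 4) has_field_derivative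
      \<i>\<pi> * (2 * theta_dlog \<tau>) * theta3 \<tau> ^ 4
      - \<i>\<pi> * (2 * theta_dlog \<tau> + theta4 \<tau> ^ 4) * theta2 \<tau> ^ 4) (at \<tau>)"
    by (rule has_field_derivative_transform_within_open[OF _ open_upper])
       (use assms jacobi_identity in auto)
  then show ?thesis
    by (rule back_subst[of "\<lambda>x. (_ has_field_derivative x) _"])
       (simp add: jacobi_identity[OF assms] algebra_simps)
qed

lemma holomorphic_theta_dlog: "theta_dlog holomorphic_on upper"
  unfolding theta_dlog_def
  by (intro holomorphic_intros holomorphic_theta3 holomorphic_deriv open_upper) (auto simp: theta3_nonzero)

lemma theta_dlog_decay: "((\<lambda>\<tau>. of_real (Im \<tau>) ^ k * theta_dlog \<tau>) \<longlongrightarrow> 0) cusp"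
proof -
  have "((\<lambda>\<tau>. 2 / (\<i>\<pi>) * ((of_real (Im \<tau>) ^ k * deriv theta3 \<tau>) / theta3 \<tau>)) \<longlongrightarrow> 2 / (\<i>\<pi>) * (0 / 1)) cusp"
    by (intro tendsto_intros deriv_theta3_decay theta3_tendsto) auto
  moreover have "k * (2 * (d / t) / p) = 2 / p * ((k * d) / t)" for k d t p :: complex
    by (simp add: mult_ac)
  then have "of_real (Im \<tau>) ^ k * theta_dlog \<tau> = 2 / (\<i>\<pi>) * ((of_real (Im \<tau>) ^ k * deriv theta3 \<tau>) / theta3 \<tau>)" for \<tau>
    unfolding theta_dlog_def .
  ultimately show ?thesis by simp
qed

lemma theta2_pow4_decay: "((\<lambda>\<tau>. of_real (Im \<tau>) ^ k * theta2 \<tau> ^ 4) \<longlongrightarrow> 0) cusp"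
proof -
  have "((\<lambda>\<tau>. of_real (Im \<tau>) ^ k * exp (\<i>\<pi> * \<tau>)) \<longlongrightarrow> 0) cusp"
    by (rule decay_cusp[of _ 1]) simp
  from tendsto_mult[OF this tendsto_power[OF theta2_tendsto, of 4]]
  have "((\<lambda>\<tau>. of_real (Im \<tau>) ^ k * exp (\<i>\<pi> * \<tau>) * (theta2 \<tau> * exp (- (\<i>\<pi> * \<tau> / 4))) ^ 4) \<longlongrightarrow> 0) cusp"
    by simp
  moreover have "exp (\<i>\<pi> * \<tau>) * (theta2 \<tau> * exp (- (\<i>\<pi> * \<tau> / 4))) ^ 4 = theta2 \<tau> ^ 4" for \<tau>
    by (simp add: power_mult_distrib flip: exp_of_nat_mult exp_add)
  ultimately show ?thesis by (simp add: mult.assoc)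
qed

lemma theta_dlog_double:
  assumes "Im \<tau> > 0"
  shows "theta_dlog \<tau> = 2 * theta_dlog (2 * \<tau>) + theta2 (2 * \<tau>) ^ 2 * (theta3 (2 * \<tau>) ^ 2 - theta2 (2 * \<tau>) ^ 2)"
proof -
  define a b u where ab: "a = theta3 (2 * \<tau>)" "b = theta2 (2 * \<tau>)" "u = theta_dlog (2 * \<tau>)"
  have 2: "Im (2 * \<tau>) > 0" using assms by simp
  have 4: "theta4 (2 * \<tau>) ^ 4 = (a\<^sup>2 + b\<^sup>2) * (a\<^sup>2 - b\<^sup>2)"
    using jacobi_identity[OF 2] by (simp add: ab power4_eq_xxxx power2_eq_square algebra_simps)
  have nz: "a\<^sup>2 + b\<^sup>2 \<noteq> 0" using theta3_double[OF assms] theta3_nonzero[OF assms] by (auto simp: ab)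
  have "theta3 \<tau> * deriv theta3 \<tau> = \<i>\<pi> / 2 * theta_dlog \<tau> * theta3 \<tau> ^ 2"
    by (simp add: deriv_theta3[OF assms] power2_eq_square)
  then have "\<i>\<pi> / 2 * theta_dlog \<tau> * (a\<^sup>2 + b\<^sup>2)
     = 2 * (a * (\<i>\<pi> / 2 * u * a) + b * (\<i>\<pi> / 2 * (u + (a\<^sup>2 + b\<^sup>2) * (a\<^sup>2 - b\<^sup>2) / 2) * b))"
    unfolding deriv_theta3_double[OF assms] deriv_theta3[OF 2] deriv_theta2[OF 2] 4 theta3_double[OF assms]
    by (simp add: ab)
  also have "\<dots> = \<i>\<pi> / 2 * (2 * u + b\<^sup>2 * (a\<^sup>2 - b\<^sup>2)) * (a\<^sup>2 + b\<^sup>2)"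
    by (simp add: power2_eq_square field_simps)
  finally show ?thesis using nz by (simp add: ab)
qed

text \<open>The defect \<open>N\<close> of the equation satisfies N(tau) = 4 N(2 tau), so Im(tau)^2
  N(tau) is invariant under doubling. Each term of \<open>N\<close> contains a factor that decays
  faster than every power of Im tau, so the limit is 0.\<close>

lemma deriv_theta_dlog:
  assumes "Im \<tau> > 0"
  shows "deriv theta_dlog \<tau> = \<i>\<pi> * (theta_dlog \<tau> ^ 2 + theta2 \<tau> ^ 4 * theta4 \<tau> ^ 4 / 4)"
proof -
  define N where "N \<tau> = deriv theta_dlog \<tau> / (\<i>\<pi>) - theta_dlog \<tau> ^ 2 - theta2 \<tau> ^ 4 * theta4 \<tau> ^ 4 / 4" for \<tau>
  define h where "h \<tau> = of_real (Im \<tau>) ^ 2 * N \<tau>" for \<tau>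
  \<comment> \<open>This spelling of 0 is the limit as it arises term by term.\<close>
  have "h \<tau> = 0 / (\<i>\<pi>) - 0 * 0 - 0 * 1 ^ 4 / 4"
  proof (rule doubling_invariant[OF _ _ assms])
    have "((\<lambda>\<tau>. (of_real (Im \<tau>) ^ 2 * deriv theta_dlog \<tau>) / (\<i>\<pi>)
        - (of_real (Im \<tau>) ^ 2 * theta_dlog \<tau>) * (of_real (Im \<tau>) ^ 0 * theta_dlog \<tau>)
        - (of_real (Im \<tau>) ^ 2 * theta2 \<tau> ^ 4) * theta4 \<tau> ^ 4 / 4) \<longlongrightarrow> 0 / (\<i>\<pi>) - 0 * 0 - 0 * 1 ^ 4 / 4) cusp"
      by (intro tendsto_intros deriv_decay_cusp holomorphic_theta_dlog theta_dlog_decay theta2_pow4_decay theta4_tendsto) auto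
    then show "(h \<longlongrightarrow> 0 / (\<i>\<pi>) - 0 * 0 - 0 * 1 ^ 4 / 4) cusp"
      by (simp add: h_def[abs_def] N_def right_diff_distrib power2_eq_square mult_ac)
  next
    fix \<tau> :: complex assume \<tau>: "Im \<tau> > 0"
    then have 2: "Im (2 * \<tau>) > 0" by simp
    define a b u where ab: "a = theta3 (2 * \<tau>)" "b = theta2 (2 * \<tau>)" "u = theta_dlog (2 * \<tau>)"
    have 4: "theta4 (2 * \<tau>) ^ 4 = (a\<^sup>2 + b\<^sup>2) * (a\<^sup>2 - b\<^sup>2)"
      using jacobi_identity[OF 2] by (simp add: ab power4_eq_xxxx power2_eq_square algebra_simps)
    have q: "theta2 \<tau> ^ 4 = 4 * a\<^sup>2 * b\<^sup>2" "theta4 \<tau> ^ 4 = (a\<^sup>2 - b\<^sup>2)\<^sup>2"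
    proof -
      have *: "x ^ 4 = (x\<^sup>2)\<^sup>2" for x :: complex by (simp flip: power_mult)
      show "theta2 \<tau> ^ 4 = 4 * a\<^sup>2 * b\<^sup>2" "theta4 \<tau> ^ 4 = (a\<^sup>2 - b\<^sup>2)\<^sup>2"
        unfolding * theta2_double[OF \<tau>] theta4_double[OF \<tau>] by (simp_all add: ab power2_eq_square)
    qed
    let ?g = "\<lambda>\<tau>. 2 * theta_dlog \<tau> + theta2 \<tau> ^ 2 * (theta3 \<tau> ^ 2 - theta2 \<tau> ^ 2)"
    define x where "x = (a\<^sup>2 + b\<^sup>2) * (a\<^sup>2 - b\<^sup>2)"
    define g' where "g' = 2 * deriv theta_dlog (2 * \<tau>) + (\<i>\<pi> * (u + x / 2) * b ^ 2 * (a ^ 2 - b ^ 2)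
        + b ^ 2 * (\<i>\<pi> * u * a ^ 2 - \<i>\<pi> * (u + x / 2) * b ^ 2))"
    have "(?g has_field_derivative g') (at (2 * \<tau>))"
      by (rule back_subst[of "\<lambda>x. (_ has_field_derivative x) _",
            OF DERIV_add[OF DERIV_cmult[OF has_deriv_upper[OF holomorphic_theta_dlog 2]]
              DERIV_mult[OF DERIV_theta2_sq[OF 2] DERIV_diff[OF DERIV_theta3_sq[OF 2] DERIV_theta2_sq[OF 2]]]]])
         (simp only: g'_def x_def 4, simp only: ab mult_ac)
    note D = DERIV_double[OF this]
    have "deriv theta_dlog \<tau> = 2 * g'"
      by (rule upper_deriv_unique[OF _ \<tau> has_deriv_upper[OF holomorphic_theta_dlog \<tau>] D])
         (rule theta_dlog_double)
    then have "N \<tau> = 2 * g' / (\<i>\<pi>) - (2 * u + b\<^sup>2 * (a\<^sup>2 - b\<^sup>2))\<^sup>2 - 4 * a\<^sup>2 * b\<^sup>2 * (a\<^sup>2 - b\<^sup>2)\<^sup>2 / 4"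
      unfolding N_def theta_dlog_double[OF \<tau>] q by (simp add: ab)
    also have "2 * g' / (\<i>\<pi>) = 4 * (deriv theta_dlog (2 * \<tau>) / (\<i>\<pi>)) +
        2 * ((u + x / 2) * b\<^sup>2 * (a\<^sup>2 - b\<^sup>2) + b\<^sup>2 * (u * a\<^sup>2 - (u + x / 2) * b\<^sup>2))"
      by (simp add: g'_def field_simps)
    also have "4 * D + 2 * ((u + x / 2) * b\<^sup>2 * (a\<^sup>2 - b\<^sup>2) + b\<^sup>2 * (u * a\<^sup>2 - (u + x / 2) * b\<^sup>2))
        - (2 * u + b\<^sup>2 * (a\<^sup>2 - b\<^sup>2))\<^sup>2 - 4 * a\<^sup>2 * b\<^sup>2 * (a\<^sup>2 - b\<^sup>2)\<^sup>2 / 4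
        = 4 * (D - u\<^sup>2 - b ^ 4 * x / 4)" for D
      by (simp add: x_def power2_eq_square power4_eq_xxxx field_simps)
    also have "deriv theta_dlog (2 * \<tau>) / (\<i>\<pi>) - u\<^sup>2 - b ^ 4 * x / 4 = N (2 * \<tau>)"
      unfolding N_def 4 x_def ab ..
    finally have "N \<tau> = 4 * N (2 * \<tau>)" .
    then show "h (2 * \<tau>) = h \<tau>"
      by (simp add: h_def power_mult_distrib)
  qed
  then have "N \<tau> = 0" using assms by (simp add: h_def)
  then show ?thesis by (simp add: N_def field_simps)
qed

section \<open>The modular lambda function\<close>

lemma modular_lambda_nonzero: "Im \<tau> > 0 \<Longrightarrow> modular_lambda \<tau> \<noteq> 0"
  by (simp add: modular_lambda_def theta2_nonzero theta3_nonzero)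

lemma one_minus_modular_lambda: "Im \<tau> > 0 \<Longrightarrow> 1 - modular_lambda \<tau> = theta4 \<tau> ^ 4 / theta3 \<tau> ^ 4"
  using jacobi_identity[of \<tau>] theta3_nonzero[of \<tau>]
  by (metis add_diff_cancel_left' diff_divide_distrib divide_self modular_lambda_def power_not_zero)

lemma holomorphic_modular_lambda: "modular_lambda holomorphic_on upper"
  unfolding modular_lambda_def
  by (intro holomorphic_intros holomorphic_theta2 holomorphic_theta3) (auto simp: theta3_nonzero)

text \<open>In D log lambda the contributions 2 u of the two fourth powers cancel; what remains is
  the fourth power of \<open>theta4\<close>, that is (1 - lambda) times that of
  \<open>theta3\<close>.\<close>

lemma DERIV_modular_lambda:
  assumes "Im \<tau> > 0"
  shows "(modular_lambda has_field_derivative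
    \<i>\<pi> * modular_lambda \<tau> * (1 - modular_lambda \<tau>) * theta3 \<tau> ^ 4) (at \<tau>)"
  unfolding one_minus_modular_lambda[OF assms] unfolding modular_lambda_def
  by (rule derivative_eq_intros DERIV_theta3_pow4 DERIV_theta2_pow4 assms refl)+
     (use theta3_nonzero[OF assms] in \<open>auto simp: field_simps\<close>)

lemma modular_lambda_tendsto: "(modular_lambda \<longlongrightarrow> 0) cusp"
  using tendsto_divide[OF theta2_pow4_decay[of 0] tendsto_power[OF theta3_tendsto, of 4]]
  by (simp add: modular_lambda_def[abs_def])

section \<open>The hypergeometric function\<close>

abbreviation (input) hypK_fps :: "complex fps" where
  "hypK_fps \<equiv> fps_hypergeo [1/2, 1/2] [1] 1"

abbreviation (input) hypK :: "complex \<Rightarrow> complex" where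
  "hypK \<equiv> hyp2F1 (1/2) (1/2) 1"

text \<open>The numbers ((1/2)_n / n!)^2, kept real so that their positivity and monotonicity can be
  used in \<open>hypK_nonzero\<close>.\<close>

fun hypK_coeff :: "nat \<Rightarrow> real" where
  "hypK_coeff 0 = 1"
| "hypK_coeff (Suc n) = ((real n + 1/2) / (real n + 1))\<^sup>2 * hypK_coeff n"

lemma hypK_fps_rec: "hypK_fps $ Suc n = ((of_nat n + 1/2) / (of_nat n + 1))\<^sup>2 * hypK_fps $ n"
  unfolding fps_hypergeo_rec by (simp add: power2_eq_square add_ac)

lemma hypK_fps_nth: "hypK_fps $ n = of_real (hypK_coeff n)"
proof (induction n)
  case (Suc n)
  then show ?case unfolding hypK_fps_rec by simp
qed (simp del: fps_hypergeo_nth)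

lemma hypK_coeff_decreasing: "hypK_coeff (Suc n) \<le> hypK_coeff n"
  and hypK_coeff_pos: "hypK_coeff n > 0"
proof -
  show pos: "hypK_coeff n > 0" for n
    by (induction n) (auto intro!: mult_pos_pos)
  have "((real n + 1/2) / (real n + 1))\<^sup>2 \<le> 1"
    by (intro power_le_one) auto
  then show "hypK_coeff (Suc n) \<le> hypK_coeff n"
    using pos[of n] by (simp add: mult_left_le_one_le)
qed

lemma hypK_coeff_le_1: "hypK_coeff n \<le> 1"
  by (induction n) (use hypK_coeff_decreasing order_trans in \<open>auto simp del: hypK_coeff.simps(2) intro: order_trans\<close>)

lemma fps_conv_radius_hypK: "fps_conv_radius hypK_fps \<ge> 1"
  unfolding fps_conv_radius_def
proof (rule conv_radius_geI_ex')
  fix r :: real assume r: "0 < r" "ereal r < 1"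
  then have "summable (\<lambda>n. r ^ n)" by (simp add: one_ereal_def)
  then show "summable (\<lambda>n. hypK_fps $ n * of_real r ^ n)"
  proof (rule summable_comparison_test')
    fix n
    show "norm (hypK_fps $ n * of_real r ^ n) \<le> r ^ n"
      unfolding hypK_fps_nth using r hypK_coeff_pos[of n] hypK_coeff_le_1[of n]
      by (simp add: norm_mult norm_power mult_left_le_one_le)
  qed
qed

lemma norm_less_conv_radius_hypK: "norm z < 1 \<Longrightarrow> ereal (norm z) < fps_conv_radius hypK_fps"
  using fps_conv_radius_hypK by (metis ereal_less(3) less_le_trans)

lemma sums_hypK: "norm z < 1 \<Longrightarrow> (\<lambda>n. of_real (hypK_coeff n) * z ^ n) sums hypK z"
  using sums_eval_fps[OF norm_less_conv_radius_hypK, of z] by (simp only: hypK_fps_nth hyp2F1_def)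

text \<open>The argument of Enestroem and Kakeya: (1 - z) F(z) equals 1 minus the series of (a_n -
  a_(n+1)) z^(n+1), whose coefficients are nonnegative with sum at most 1. At a zero of F this
  series would have the value 1 although its norm is at most |z| < 1. The result makes 1 / F^2
  available in \<open>hypK_primitive\<close>.\<close>

lemma hypK_nonzero:
  assumes z: "norm z < 1"
  shows "hypK z \<noteq> 0"
proof
  assume F0: "hypK z = 0"
  let ?a = "\<lambda>n. complex_of_real (hypK_coeff n)"
  have s: "(\<lambda>n. ?a n * z ^ n) sums 0"
    using sums_hypK[OF z] F0 by simp
  have 1: "(\<lambda>n. ?a (Suc n) * z ^ Suc n) sums (- 1)"
    using sums_Suc_iff[of "\<lambda>n. ?a n * z ^ n" "- 1"] s by simp
  have 2: "(\<lambda>n. z * (?a n * z ^ n)) sums (z * 0)"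
    by (intro sums_mult s)
  have "(\<lambda>n. ?a (Suc n) * z ^ Suc n - z * (?a n * z ^ n)) sums (- 1 - z * 0)"
    by (intro sums_diff 1 2)
  then have S: "(\<lambda>n. of_real (hypK_coeff (Suc n) - hypK_coeff n) * z ^ Suc n) sums (- 1)"
    by (simp add: algebra_simps del: hypK_coeff.simps(2))
  obtain L where L: "hypK_coeff \<longlonglongrightarrow> L"
    using decseq_convergent[of hypK_coeff 0] hypK_coeff_pos hypK_coeff_decreasing
    by (metis decseq_SucI less_imp_le)
  have "L \<ge> 0"
    using L hypK_coeff_pos by (intro LIMSEQ_le_const) (auto intro: less_imp_le)
  have T: "(\<lambda>n. (hypK_coeff n - hypK_coeff (Suc n)) * norm z) sums ((hypK_coeff 0 - L) * norm z)"
    by (intro sums_mult2 telescope_sums' L)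
  have "norm (- 1 :: complex) \<le> (hypK_coeff 0 - L) * norm z"
  proof -
    have b: "norm (of_real (hypK_coeff (Suc n) - hypK_coeff n) * z ^ Suc n) \<le> (hypK_coeff n - hypK_coeff (Suc n)) * norm z" for n
    proof -
      have "norm z ^ Suc n \<le> norm z"
        using z by (simp add: mult_left_le power_le_one)
      then have "(hypK_coeff n - hypK_coeff (Suc n)) * norm z ^ Suc n \<le> (hypK_coeff n - hypK_coeff (Suc n)) * norm z"
        using hypK_coeff_decreasing[of n] by (intro mult_left_mono) auto
      then show ?thesis
        using hypK_coeff_decreasing[of n] by (simp only: norm_mult norm_of_real norm_power) simp
    qed
    have "norm (suminf (\<lambda>n. of_real (hypK_coeff (Suc n) - hypK_coeff n) * z ^ Suc n))
       \<le> suminf (\<lambda>n. (hypK_coeff n - hypK_coeff (Suc n)) * norm z)"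
      by (rule norm_suminf_le[OF b]) (use T in \<open>simp add: sums_iff\<close>)
    then show ?thesis using S T by (simp only: sums_iff)
  qed
  also have "\<dots> \<le> 1 * norm z"
    using \<open>L \<ge> 0\<close> by (intro mult_right_mono) auto
  finally show False using z by simp
qed

lemma DERIV_hypK:
  assumes "norm z < 1"
  shows "(hypK has_field_derivative eval_fps (fps_deriv hypK_fps) z) (at z)"
  unfolding hyp2F1_def by (intro has_field_derivative_eval_fps norm_less_conv_radius_hypK assms)

lemma holomorphic_hypK: "hypK holomorphic_on ball 0 1"
  by (rule holomorphic_on_open[THEN iffD2], simp, intro ballI exI, rule DERIV_hypK) simp

lemma hypK_0: "hypK 0 = 1"
  by (simp add: hyp2F1_def eval_fps_at_0)

text \<open>The hypergeometric equation in self-adjoint form. Coefficientwise it is the recursion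
  (n+1)^2 a_(n+1) = (n+1/2)^2 a_n together with (n+1/2)^2 - n (n+1) = 1/4.\<close>

lemma hypK_fps_ode: "fps_deriv (fps_X * (1 - fps_X) * fps_deriv hypK_fps) = fps_const (1/4) * hypK_fps"
proof (rule fps_ext)
  fix n
  have *: "fps_X * (1 - fps_X) * fps_deriv hypK_fps = fps_X * fps_deriv hypK_fps - fps_X * (fps_X * fps_deriv hypK_fps)"
    by (simp add: algebra_simps)
  have "fps_deriv (fps_X * (1 - fps_X) * fps_deriv hypK_fps) $ n =
      of_nat (n + 1) * (of_nat (n + 1) * hypK_fps $ Suc n - of_nat n * hypK_fps $ n)"
    unfolding * by (cases n) (simp_all add: algebra_simps del: fps_hypergeo_nth)
  also have "\<dots> = (of_nat n + 1)\<^sup>2 * hypK_fps $ Suc n - of_nat n * (of_nat n + 1) * hypK_fps $ n"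
    by (simp add: power2_eq_square algebra_simps del: fps_hypergeo_nth)
  also have "(of_nat n + 1)\<^sup>2 * hypK_fps $ Suc n = (of_nat n + 1/2)\<^sup>2 * hypK_fps $ n"
  proof -
    have "of_nat n + 1 \<noteq> (0 :: complex)"
      by (metis of_nat_Suc add.commute of_nat_neq_0)
    then show ?thesis unfolding hypK_fps_rec by (simp add: power_divide del: fps_hypergeo_nth)
  qed
  also have "(of_nat n + 1/2)\<^sup>2 * hypK_fps $ n - of_nat n * (of_nat n + 1) * hypK_fps $ n = 1/4 * hypK_fps $ n"
    by (simp add: power2_eq_square algebra_simps del: fps_hypergeo_nth)
  finally show "fps_deriv (fps_X * (1 - fps_X) * fps_deriv hypK_fps) $ n = (fps_const (1/4) * hypK_fps) $ n"
    by (simp del: fps_hypergeo_nth)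
qed

lemma hypK_ode:
  assumes z: "norm z < 1"
  shows "((\<lambda>z. z * (1 - z) * deriv hypK z) has_field_derivative hypK z / 4) (at z)"
proof -
  have r1: "ereal (norm z) < fps_conv_radius (fps_deriv hypK_fps)" if "norm z < 1" for z
    using norm_less_conv_radius_hypK[OF that] fps_conv_radius_deriv by (rule less_le_trans)
  have rX: "fps_conv_radius (1 - fps_X :: complex fps) = \<infinity>"
    using fps_conv_radius_diff[of "1 :: complex fps" fps_X] by simp
  have rX2: "fps_conv_radius (fps_X * (1 - fps_X) :: complex fps) = \<infinity>"
    using fps_conv_radius_mult[of "fps_X :: complex fps" "1 - fps_X"] by (simp add: rX)
  have r2: "ereal (norm z) < fps_conv_radius (fps_X * (1 - fps_X) * fps_deriv hypK_fps)"
    using r1[OF z] fps_conv_radius_mult[of "fps_X * (1 - fps_X)" "fps_deriv hypK_fps"]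
    by (simp add: rX2)
  have "(eval_fps (fps_X * (1 - fps_X) * fps_deriv hypK_fps) has_field_derivative
     eval_fps (fps_const (1/4) * hypK_fps) z) (at z)"
    using has_field_derivative_eval_fps[OF r2] by (simp only: hypK_fps_ode)
  moreover have "eval_fps (fps_const (1/4) * hypK_fps) z = hypK z / 4"
    using norm_less_conv_radius_hypK[OF z] by (subst eval_fps_mult) (auto simp: hyp2F1_def)
  ultimately have "(eval_fps (fps_X * (1 - fps_X) * fps_deriv hypK_fps) has_field_derivative hypK z / 4) (at z)"
    by simp
  then show ?thesis
  proof (rule has_field_derivative_transform_within_open[where S = "ball 0 1"])
    fix w :: complex assume "w \<in> ball 0 1"
    then have w: "norm w < 1" by simp
    have "deriv hypK w = eval_fps (fps_deriv hypK_fps) w"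
      by (rule DERIV_imp_deriv[OF DERIV_hypK[OF w]])
    then show "eval_fps (fps_X * (1 - fps_X) * fps_deriv hypK_fps) w = w * (1 - w) * deriv hypK w"
      using r1[OF w] by (simp add: eval_fps_mult eval_fps_diff rX rX2)
  qed (use z in auto)
qed

lemma deriv_hypK: "norm z < 1 \<Longrightarrow> (hypK has_field_derivative deriv hypK z) (at z)"
  using DERIV_hypK[of z] DERIV_imp_deriv[OF DERIV_hypK[of z]] by simp

text \<open>
  The combination W below is the Wronskian of the two solutions f and F(l) of the
  same second order equation, divided by f squared; so it is constant.
\<close>

lemma hypK_ratio_affine:
  fixes f u l :: "complex \<Rightarrow> complex" and k :: complex
  assumes U: "open U" "connected U" and nz: "\<And>\<tau>. \<tau> \<in> U \<Longrightarrow> f \<tau> \<noteq> 0" and lt: "\<And>\<tau>. \<tau> \<in> U \<Longrightarrow> norm (l \<tau>) < 1"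
    and l': "\<And>\<tau>. \<tau> \<in> U \<Longrightarrow> (l has_field_derivative k * l \<tau> * (1 - l \<tau>) * f \<tau> ^ 2) (at \<tau>)"
    and f': "\<And>\<tau>. \<tau> \<in> U \<Longrightarrow> (f has_field_derivative k * u \<tau> * f \<tau>) (at \<tau>)"
    and u': "\<And>\<tau>. \<tau> \<in> U \<Longrightarrow> (u has_field_derivative k * (u \<tau> ^ 2 + l \<tau> * (1 - l \<tau>) * f \<tau> ^ 4 / 4)) (at \<tau>)"
  obtains \<alpha> \<beta> where "\<And>\<tau>. \<tau> \<in> U \<Longrightarrow> hypK (l \<tau>) = (\<alpha> + \<beta> * \<tau>) * f \<tau>"
proof -
  define G where "G z = z * (1 - z) * deriv hypK z" for z
  define W where "W \<tau> = f \<tau> * G (l \<tau>) - u \<tau> * (hypK (l \<tau>) / f \<tau>)" for \<tau>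
  have G': "((\<lambda>\<tau>. G (l \<tau>)) has_field_derivative hypK (l \<tau>) / 4 * (k * l \<tau> * (1 - l \<tau>) * f \<tau> ^ 2)) (at \<tau>)" if "\<tau> \<in> U" for \<tau>
    using DERIV_chain2[where f = G and g = l and x = \<tau> and s = UNIV, OF hypK_ode[OF lt[OF that], folded G_def] l'[OF that]] .
  have F': "((\<lambda>\<tau>. hypK (l \<tau>)) has_field_derivative k * f \<tau> ^ 2 * G (l \<tau>)) (at \<tau>)" if "\<tau> \<in> U" for \<tau>
    using DERIV_chain2[where f = hypK and g = l and x = \<tau> and s = UNIV, OF deriv_hypK[OF lt[OF that]] l'[OF that]]
    by (simp add: G_def mult_ac)
  have R': "((\<lambda>\<tau>. hypK (l \<tau>) / f \<tau>) has_field_derivative k * W \<tau>) (at \<tau>)" if "\<tau> \<in> U" for \<tau>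
    by (rule back_subst[of "\<lambda>x. (_ has_field_derivative x) _", OF DERIV_divide[OF F'[OF that] f'[OF that] nz[OF that]]])
       (use nz[OF that] in \<open>simp add: W_def field_simps power2_eq_square\<close>)
  have W': "(W has_field_derivative 0) (at \<tau>)" if "\<tau> \<in> U" for \<tau>
  proof -
    have "(W has_field_derivative (k * u \<tau> * f \<tau> * G (l \<tau>)
        + hypK (l \<tau>) / 4 * (k * l \<tau> * (1 - l \<tau>) * f \<tau> ^ 2) * f \<tau>
        - (k * (u \<tau> ^ 2 + l \<tau> * (1 - l \<tau>) * f \<tau> ^ 4 / 4) * (hypK (l \<tau>) / f \<tau>) + k * W \<tau> * u \<tau>))) (at \<tau>)"
      unfolding W_def by (intro DERIV_diff DERIV_mult f' G' u' R'[unfolded W_def] that)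
    moreover have "k * u \<tau> * f \<tau> * G (l \<tau>)
        + hypK (l \<tau>) / 4 * (k * l \<tau> * (1 - l \<tau>) * f \<tau> ^ 2) * f \<tau>
        - (k * (u \<tau> ^ 2 + l \<tau> * (1 - l \<tau>) * f \<tau> ^ 4 / 4) * (hypK (l \<tau>) / f \<tau>) + k * W \<tau> * u \<tau>) = 0"
      using nz[OF that] by (simp add: W_def field_simps power2_eq_square power4_eq_xxxx)
    ultimately show ?thesis by simp
  qed
  from has_field_derivative_0_imp_constant_on[OF W' U(2,1)] obtain w where w: "\<And>\<tau>. \<tau> \<in> U \<Longrightarrow> W \<tau> = w"
    by (auto simp: constant_on_def)
  have "((\<lambda>\<tau>. hypK (l \<tau>) / f \<tau> - k * w * \<tau>) has_field_derivative 0) (at \<tau>)" if "\<tau> \<in> U" for \<tau>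
    using DERIV_diff[OF R'[OF that] DERIV_cmult_Id[of "k * w"]] w[OF that] by simp
  from has_field_derivative_0_imp_constant_on[OF this U(2,1)]
  obtain \<alpha> where a: "\<And>\<tau>. \<tau> \<in> U \<Longrightarrow> hypK (l \<tau>) / f \<tau> - k * w * \<tau> = \<alpha>"
    by (auto simp: constant_on_def)
  have "hypK (l \<tau>) = (\<alpha> + k * w * \<tau>) * f \<tau>" if "\<tau> \<in> U" for \<tau>
    using a[OF that] nz[OF that] by (auto simp: field_simps)
  then show ?thesis by (rule that)
qed

section \<open>The inversion\<close>

lemma gaussian_integral_scaled:
  assumes s: "s > 0"
  shows "has_bochner_integral lborel (\<lambda>x::real. indicator {0..} x *\<^sub>R exp (- pi * s * x\<^sup>2)) (1 / (2 * sqrt s))"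
proof -
  define c where "c = sqrt (pi * s)"
  have c: "c > 0" using s by (simp add: c_def)
  have "has_bochner_integral lborel (\<lambda>x::real. indicator {0..} (0 + c * x) *\<^sub>R exp (- (0 + c * x)\<^sup>2)) ((sqrt pi / 2) /\<^sub>R \<bar>c\<bar>)"
    using lborel_has_bochner_integral_real_affine_iff[of c "\<lambda>x. indicator {0..} x *\<^sub>R exp (- x\<^sup>2)" "sqrt pi / 2" 0] c gaussian_moment_0 by simp
  also have "(\<lambda>x::real. indicator {0..} (0 + c * x) *\<^sub>R exp (- (0 + c * x)\<^sup>2)) = (\<lambda>x. indicator {0..} x *\<^sub>R exp (- pi * s * x\<^sup>2))"
  proof
    fix x
    have "indicator {0..} (0 + c * x) = (indicator {0..} x :: real)"
      using c by (auto simp: indicator_def zero_le_mult_iff)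
    moreover have "(0 + c * x)\<^sup>2 = pi * s * x\<^sup>2"
      using s by (simp add: c_def power_mult_distrib)
    ultimately show "indicator {0..} (0 + c * x) *\<^sub>R exp (- (0 + c * x)\<^sup>2) = indicator {0..} x *\<^sub>R exp (- pi * s * x\<^sup>2)"
      by simp
  qed
  also have "(sqrt pi / 2) /\<^sub>R \<bar>c\<bar> = 1 / (2 * sqrt s)"
    using c s by (simp add: c_def real_sqrt_mult field_simps)
  finally show ?thesis .
qed

lemma gaussian_integral_limit:
  assumes s: "s > 0"
  shows "(\<lambda>n. integral {0..real n} (\<lambda>x. exp (- pi * s * x\<^sup>2))) \<longlonglongrightarrow> 1 / (2 * sqrt s)"
proof -
  let ?f = "\<lambda>x::real. exp (- pi * s * x\<^sup>2)"
  let ?g = "\<lambda>x::real. indicator {0..} x *\<^sub>R ?f x"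
  note G = gaussian_integral_scaled[OF s]
  have int: "integrable lborel ?g" and val: "integral\<^sup>L lborel ?g = 1 / (2 * sqrt s)"
    using G by (auto simp: has_bochner_integral_iff)
  have "((\<lambda>y. \<integral>x. indicator {..y} x *\<^sub>R ?g x \<partial>lborel) \<longlongrightarrow> integral\<^sup>L lborel ?g) at_top"
    by (rule tendsto_integral_at_top) (use int in auto)
  then have "(\<lambda>n. \<integral>x. indicator {..real n} x *\<^sub>R ?g x \<partial>lborel) \<longlonglongrightarrow> 1 / (2 * sqrt s)"
    unfolding val by (rule filterlim_compose[OF _ filterlim_real_sequentially])
  moreover have "(\<integral>x. indicator {..real n} x *\<^sub>R ?g x \<partial>lborel) = integral {0..real n} ?f" for n
  proof -
    have "set_integrable lborel {0..real n} ?f"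
      by (rule borel_integrable_atLeastAtMost') (intro continuous_intros)
    then have "(LINT x:{0..real n}|lborel. ?f x) = integral {0..real n} ?f"
      by (rule set_borel_integral_eq_integral(2))
    moreover have "(\<lambda>x. indicator {..real n} x *\<^sub>R ?g x) = (\<lambda>x. indicator {0..real n} x *\<^sub>R ?f x)"
      by (auto simp: indicator_def fun_eq_iff)
    ultimately show ?thesis by (simp add: set_lebesgue_integral_def)
  qed
  ultimately show ?thesis by simp
qed

definition theta_real :: "real \<Rightarrow> real \<Rightarrow> real" where
  "theta_real a t = (\<Sum>\<^sub>\<infinity>n::int. exp (- pi * (of_int n + a)\<^sup>2 * t))"

lemma theta_series_imag:
  assumes "t > 0"
  shows "theta_series a (\<i> * of_real t) = of_real (theta_real a t)"
proof -
  have "exp (\<i>\<pi> * of_real ((of_int n + a)\<^sup>2) * (\<i> * of_real t)) = of_real (exp (- pi * (of_int n + a)\<^sup>2 * t))" for n :: int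
    by (simp add: exp_of_real[symmetric] algebra_simps)
  moreover have "((\<lambda>n::int. complex_of_real (exp (- pi * (of_int n + a)\<^sup>2 * t))) has_sum of_real (theta_real a t)) UNIV"
    unfolding theta_real_def has_sum_of_real_iff by (intro has_sum_infsum summable_theta_majorant assms)
  ultimately show ?thesis
    unfolding theta_series_def by (simp only: infsumI)
qed

text \<open>The sum over all integers is 2 S - 1 with S the sum over n >= 0. For a decreasing
  function S exceeds the integral by at least 0 and at most the first term 1; the integral is 1 / (2
  sqrt s), so the difference lies between -1 and 1.\<close>

lemma theta_real_0_bounds:
  assumes s: "s > 0"
  shows "\<bar>theta_real 0 s - 1 / sqrt s\<bar> \<le> 1"
proof -
  let ?f = "\<lambda>x::real. exp (- pi * s * x\<^sup>2)"
  interpret antimono_fun_sum_integral_diff ?f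
  proof
    fix x y :: real assume "0 \<le> x" "x \<le> y"
    then show "?f y \<le> ?f x"
      using s by (auto intro!: mult_left_mono power_mono)
  qed (auto intro!: continuous_intros)
  have summ: "(\<lambda>n::int. exp (- pi * (of_int n + 0)\<^sup>2 * s)) summable_on A" for A
    by (rule summable_theta_majorant[OF s])
  have nat: "(\<lambda>n::int. exp (- pi * (of_int n + 0)\<^sup>2 * s)) summable_on {0..} \<longleftrightarrow> (\<lambda>n::nat. ?f (real n)) summable_on UNIV"
    by (rule summable_on_reindex_bij_witness[where i = int and j = nat]) (auto simp: mult_ac)
  then have sn: "(\<lambda>n::nat. ?f (real n)) summable_on UNIV" using summ by blast
  then have summable: "summable (\<lambda>n. ?f (real n))" by (rule summable_on_imp_summable)
  have S: "infsum (\<lambda>n::nat. ?f (real n)) UNIV = suminf (\<lambda>n. ?f (real n))"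
    by (intro infsumI sums_nonneg_imp_has_sum summable_sums[OF summable]) auto
  have pos: "infsum (\<lambda>n::int. exp (- pi * (of_int n + 0)\<^sup>2 * s)) {0..} = infsum (\<lambda>n::nat. ?f (real n)) UNIV"
    by (rule infsum_reindex_bij_witness[where i = int and j = nat]) (auto simp: mult_ac)
  have neg: "infsum (\<lambda>n::int. exp (- pi * (of_int n + 0)\<^sup>2 * s)) {..-1} = suminf (\<lambda>n. ?f (real n)) - 1"
  proof -
    have "infsum (\<lambda>n::int. exp (- pi * (of_int n + 0)\<^sup>2 * s)) {..-1} = infsum (\<lambda>n::nat. ?f (real (Suc n))) UNIV"
      by (rule infsum_reindex_bij_witness[where i = "\<lambda>n. - int (Suc n)" and j = "\<lambda>n. nat (- n) - 1"])
         (auto simp: mult_ac of_nat_diff power2_eq_square algebra_simps)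
    also have "\<dots> = suminf (\<lambda>n. ?f (real (Suc n)))"
    proof -
      have "summable (\<lambda>n. ?f (real (Suc n)))" using summable_Suc_iff[of "\<lambda>n. ?f (real n)"] summable by blast
      then show ?thesis by (intro infsumI sums_nonneg_imp_has_sum summable_sums) auto
    qed
    also have "\<dots> = suminf (\<lambda>n. ?f (real n)) - 1"
      using suminf_split_head[OF summable] by simp
    finally show ?thesis .
  qed
  have U: "(UNIV :: int set) = {0..} \<union> {..-1}" "{0..} \<inter> {..-1 :: int} = {}" by auto
  have "theta_real 0 s = infsum (\<lambda>n::int. exp (- pi * (of_int n + 0)\<^sup>2 * s)) {0..} + infsum (\<lambda>n::int. exp (- pi * (of_int n + 0)\<^sup>2 * s)) {..-1}"
    unfolding theta_real_def by (subst U(1)) (intro infsum_Un_disjoint summ U(2))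
  then have T: "theta_real 0 s = 2 * suminf (\<lambda>n. ?f (real n)) - 1"
    using pos neg S by simp
  have "(\<lambda>n. \<Sum>k\<le>n. ?f (real k)) \<longlonglongrightarrow> suminf (\<lambda>n. ?f (real n))"
    using summable by (rule summable_LIMSEQ')
  from tendsto_diff[OF this gaussian_integral_limit[OF s]]
  have lim: "sum_integral_diff_series \<longlonglongrightarrow> suminf (\<lambda>n. ?f (real n)) - 1 / (2 * sqrt s)"
    by (simp only: sum_integral_diff_series_def[abs_def])
  have "0 \<le> suminf (\<lambda>n. ?f (real n)) - 1 / (2 * sqrt s)"
    by (rule LIMSEQ_le_const[OF lim]) (intro exI allI impI sum_integral_diff_series_nonneg)
  moreover have "suminf (\<lambda>n. ?f (real n)) - 1 / (2 * sqrt s) \<le> 1"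
  proof (rule LIMSEQ_le_const2[OF lim], rule exI, intro allI impI)
    fix n :: nat
    have "sum_integral_diff_series n \<le> sum_integral_diff_series 0"
      by (rule sum_integral_diff_series_antimono) simp
    also have "sum_integral_diff_series 0 = 1"
      unfolding sum_integral_diff_series_def by simp
    finally show "sum_integral_diff_series n \<le> 1" .
  qed
  ultimately show ?thesis unfolding T by (simp add: abs_le_iff)
qed

text \<open>The quotient is the value at i t of the transform i f(-1/tau) / tau of f. Its limit 1 at
  infinity is the normalisation that \<open>theta3\<close> squared has itself, and it fixes the
  constant in the inversion formula.\<close>

lemma theta3_near_0: "((\<lambda>t. theta3 (\<i> / of_real t) ^ 2 / of_real t) \<longlongrightarrow> 1) at_top"
proof -
  have "((\<lambda>t. theta_real 0 (1 / t) / sqrt t - 1) \<longlongrightarrow> 0) at_top"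
  proof (rule Lim_null_comparison)
    show "\<forall>\<^sub>F t in at_top. norm (theta_real 0 (1 / t) / sqrt t - 1) \<le> 1 / sqrt t"
      using eventually_gt_at_top[of 0]
    proof eventually_elim
      case (elim t)
      have "\<bar>(theta_real 0 (1 / t) - sqrt t) / sqrt t\<bar> \<le> 1 / sqrt t"
        using theta_real_0_bounds[of "1 / t"] elim by (simp add: abs_div_pos[symmetric] real_sqrt_divide divide_right_mono)
      then show ?case using elim by (simp add: diff_divide_distrib)
    qed
    show "((\<lambda>t. 1 / sqrt t) \<longlongrightarrow> 0) at_top" by real_asymp
  qed
  then have "((\<lambda>t. theta_real 0 (1 / t) / sqrt t) \<longlongrightarrow> 1) at_top"
    by (rule LIM_zero_cancel)
  from tendsto_of_real[OF tendsto_power[OF this, of 2], where ?'a = complex]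
  have "((\<lambda>t. complex_of_real ((theta_real 0 (1 / t) / sqrt t)\<^sup>2)) \<longlongrightarrow> 1) at_top" by simp
  moreover have "\<forall>\<^sub>F t in at_top. complex_of_real ((theta_real 0 (1 / t) / sqrt t)\<^sup>2) = theta3 (\<i> / of_real t) ^ 2 / of_real t"
    using eventually_gt_at_top[of 0]
  proof eventually_elim
    case (elim t)
    have "theta3 (\<i> / of_real t) = of_real (theta_real 0 (1 / t))"
      using theta_series_imag[of "1 / t" 0] elim by (simp add: theta3_eq)
    then show ?case using elim by (simp add: power_divide flip: of_real_power)
  qed
  ultimately show ?thesis by (rule Lim_transform_eventually)
qed

text \<open>The hypergeometric equation for f as a function of l, parametrised by tau. As a
  first-order system whose right-hand sides do not contain tau, it can be tested for invariance
  under -1/tau by the chain rule alone.\<close>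

definition hyp_solution :: "(complex \<Rightarrow> complex) \<Rightarrow> (complex \<Rightarrow> complex) \<Rightarrow> (complex \<Rightarrow> complex) \<Rightarrow> bool" where
  "hyp_solution f u l \<longleftrightarrow> (\<forall>\<tau>. Im \<tau> > 0 \<longrightarrow> f \<tau> \<noteq> 0
     \<and> (l has_field_derivative \<i>\<pi> * l \<tau> * (1 - l \<tau>) * f \<tau> ^ 2) (at \<tau>)
     \<and> (f has_field_derivative \<i>\<pi> * u \<tau> * f \<tau>) (at \<tau>)
     \<and> (u has_field_derivative \<i>\<pi> * (u \<tau> ^ 2 + l \<tau> * (1 - l \<tau>) * f \<tau> ^ 4 / 4)) (at \<tau>))"

lemma hyp_solution_theta: "hyp_solution (\<lambda>\<tau>. theta3 \<tau> ^ 2) theta_dlog modular_lambda"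
  unfolding hyp_solution_def
proof (intro allI impI conjI)
  fix \<tau> :: complex assume \<tau>: "Im \<tau> > 0"
  show "(theta3 \<tau>)\<^sup>2 \<noteq> 0" using theta3_nonzero[OF \<tau>] by simp
  show "(modular_lambda has_field_derivative \<i>\<pi> * modular_lambda \<tau> * (1 - modular_lambda \<tau>) * ((theta3 \<tau>)\<^sup>2)\<^sup>2) (at \<tau>)"
    using DERIV_modular_lambda[OF \<tau>] by (simp flip: power_mult)
  show "((\<lambda>\<tau>. theta3 \<tau> ^ 2) has_field_derivative \<i>\<pi> * theta_dlog \<tau> * (theta3 \<tau>)\<^sup>2) (at \<tau>)"
    by (rule DERIV_theta3_sq[OF \<tau>])
  have "modular_lambda \<tau> * (1 - modular_lambda \<tau>) * ((theta3 \<tau>)\<^sup>2) ^ 4 = theta2 \<tau> ^ 4 * theta4 \<tau> ^ 4"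
    unfolding one_minus_modular_lambda[OF \<tau>] unfolding modular_lambda_def
    using theta3_nonzero[OF \<tau>] by (simp add: field_simps flip: power_mult power_add)
  then show "(theta_dlog has_field_derivative \<i>\<pi> * ((theta_dlog \<tau>)\<^sup>2 + modular_lambda \<tau> * (1 - modular_lambda \<tau>) * ((theta3 \<tau>)\<^sup>2) ^ 4 / 4)) (at \<tau>)"
    using has_deriv_upper[OF holomorphic_theta_dlog \<tau>] deriv_theta_dlog[OF \<tau>] by simp
qed

lemma Im_minus_inverse: "Im \<tau> > 0 \<Longrightarrow> Im (- 1 / \<tau>) > 0"
  by (auto simp: Im_divide intro!: divide_pos_pos add_nonneg_pos)

text \<open>f transforms with weight 1, and its logarithmic derivative acquires the term -1 / (i pi
  tau). The factor i squares to -1 and reverses the sign of the derivative of l, which passing to 1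
  - l compensates while l (1 - l) stays the same.\<close>

lemma hyp_solution_inversion:
  assumes "hyp_solution f u l"
  shows "hyp_solution (\<lambda>\<tau>. \<i> * f (- 1 / \<tau>) / \<tau>) (\<lambda>\<tau>. u (- 1 / \<tau>) / \<tau> ^ 2 - 1 / (\<i>\<pi> * \<tau>)) (\<lambda>\<tau>. 1 - l (- 1 / \<tau>))"
  unfolding hyp_solution_def
proof (intro allI impI conjI)
  fix \<tau> :: complex assume \<tau>: "Im \<tau> > 0"
  then have nz: "\<tau> \<noteq> 0" by auto
  define p where "p = \<i>\<pi>"
  have p: "p \<noteq> 0" by (simp add: p_def)
  note \<sigma> = Im_minus_inverse[OF \<tau>]
  from assms \<sigma> have f0: "f (- 1 / \<tau>) \<noteq> 0"
    and l': "(l has_field_derivative p * l (- 1 / \<tau>) * (1 - l (- 1 / \<tau>)) * f (- 1 / \<tau>) ^ 2) (at (- 1 / \<tau>))"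
    and f': "(f has_field_derivative p * u (- 1 / \<tau>) * f (- 1 / \<tau>)) (at (- 1 / \<tau>))"
    and u': "(u has_field_derivative p * (u (- 1 / \<tau>) ^ 2 + l (- 1 / \<tau>) * (1 - l (- 1 / \<tau>)) * f (- 1 / \<tau>) ^ 4 / 4)) (at (- 1 / \<tau>))"
    unfolding hyp_solution_def p_def by blast+
  have s': "((\<lambda>\<tau>. - 1 / \<tau>) has_field_derivative 1 / \<tau> ^ 2) (at \<tau>)"
    using nz by (auto intro!: derivative_eq_intros simp: power2_eq_square)
  note L = DERIV_chain2[where g = "\<lambda>\<tau>. - 1 / \<tau>" and f = l and s = UNIV, OF l' s']
  note F = DERIV_chain2[where g = "\<lambda>\<tau>. - 1 / \<tau>" and f = f and s = UNIV, OF f' s']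
  note U = DERIV_chain2[where g = "\<lambda>\<tau>. - 1 / \<tau>" and f = u and s = UNIV, OF u' s']
  show "\<i> * f (- 1 / \<tau>) / \<tau> \<noteq> 0" using f0 nz by simp
  define ff uu ll where fl: "ff = f (- 1 / \<tau>)" "uu = u (- 1 / \<tau>)" "ll = l (- 1 / \<tau>)"
  have "((\<lambda>\<tau>. 1 - l (- 1 / \<tau>)) has_field_derivative 0 - p * ll * (1 - ll) * ff ^ 2 * (1 / \<tau> ^ 2)) (at \<tau>)"
    unfolding fl by (intro DERIV_diff DERIV_const L)
  moreover have "0 - p * ll * (1 - ll) * ff ^ 2 * (1 / \<tau> ^ 2) = p * (1 - ll) * (1 - (1 - ll)) * (\<i> * ff / \<tau>)\<^sup>2"
    using nz by (simp add: field_simps power2_eq_square)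
  ultimately show "((\<lambda>\<tau>. 1 - l (- 1 / \<tau>)) has_field_derivative \<i>\<pi> * (1 - l (- 1 / \<tau>)) * (1 - (1 - l (- 1 / \<tau>))) * (\<i> * f (- 1 / \<tau>) / \<tau>)\<^sup>2) (at \<tau>)"
    unfolding p_def fl by simp
  have "((\<lambda>\<tau>. \<i> * f (- 1 / \<tau>) / \<tau>) has_field_derivative (\<i> * (p * uu * ff * (1 / \<tau> ^ 2)) * \<tau> - \<i> * ff * 1) / (\<tau> * \<tau>)) (at \<tau>)"
    unfolding fl by (intro DERIV_divide DERIV_cmult F DERIV_ident nz)
  moreover have "(\<i> * (p * uu * ff * (1 / \<tau> ^ 2)) * \<tau> - \<i> * ff * 1) / (\<tau> * \<tau>) = p * (uu / \<tau> ^ 2 - 1 / (p * \<tau>)) * (\<i> * ff / \<tau>)"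
    using nz p by (simp add: field_simps power2_eq_square)
  ultimately show "((\<lambda>\<tau>. \<i> * f (- 1 / \<tau>) / \<tau>) has_field_derivative \<i>\<pi> * (u (- 1 / \<tau>) / \<tau>\<^sup>2 - 1 / (\<i>\<pi> * \<tau>)) * (\<i> * f (- 1 / \<tau>) / \<tau>)) (at \<tau>)"
    unfolding p_def fl by simp
  have d2: "((\<lambda>\<tau>. \<tau> ^ 2) has_field_derivative 2 * \<tau>) (at \<tau>)"
    by (auto intro!: derivative_eq_intros)
  have d1: "((\<lambda>\<tau>. 1 / (p * \<tau>)) has_field_derivative - 1 / (p * \<tau> ^ 2)) (at \<tau>)"
    using nz p by (auto intro!: derivative_eq_intros simp: power2_eq_square)
  have "((\<lambda>\<tau>. u (- 1 / \<tau>) / \<tau> ^ 2 - 1 / (p * \<tau>)) has_field_derivative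
      (p * (uu ^ 2 + ll * (1 - ll) * ff ^ 4 / 4) * (1 / \<tau> ^ 2) * \<tau> ^ 2 - uu * (2 * \<tau>)) / (\<tau> ^ 2 * \<tau> ^ 2) - - 1 / (p * \<tau> ^ 2)) (at \<tau>)"
    unfolding fl by (intro DERIV_diff DERIV_divide U d2 d1) (use nz in auto)
  moreover have "(p * (uu ^ 2 + ll * (1 - ll) * ff ^ 4 / 4) * (1 / \<tau> ^ 2) * \<tau> ^ 2 - uu * (2 * \<tau>)) / (\<tau> ^ 2 * \<tau> ^ 2) - - 1 / (p * \<tau> ^ 2)
     = p * ((uu / \<tau> ^ 2 - 1 / (p * \<tau>))\<^sup>2 + (1 - ll) * (1 - (1 - ll)) * (\<i> * ff / \<tau>) ^ 4 / 4)"
  proof -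
    have "(\<i> * ff / \<tau>) ^ 4 = ff ^ 4 / \<tau> ^ 4"
      by (simp add: power_mult_distrib power_divide)
    then show ?thesis
      using nz p by (simp add: field_simps power2_eq_square power4_eq_xxxx)
  qed
  ultimately show "((\<lambda>\<tau>. u (- 1 / \<tau>) / \<tau> ^ 2 - 1 / (\<i>\<pi> * \<tau>)) has_field_derivative
     \<i>\<pi> * ((u (- 1 / \<tau>) / \<tau>\<^sup>2 - 1 / (\<i>\<pi> * \<tau>))\<^sup>2 +
       (1 - l (- 1 / \<tau>)) * (1 - (1 - l (- 1 / \<tau>))) * (\<i> * f (- 1 / \<tau>) / \<tau>) ^ 4 / 4)) (at \<tau>)"
    unfolding p_def fl by simp
qed

text \<open>On the component of {|l| < 1} that contains the axis, F(l) / f is affine in tau by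
  \<open>hypK_ratio_affine\<close>. The finite limit along the axis excludes a slope, and its value
  1 fixes the constant.\<close>

lemma hyp_solution_axis:
  assumes sol: "hyp_solution f u l" and lt: "\<And>t. t > 0 \<Longrightarrow> norm (l (\<i> * of_real t)) < 1"
    and l0: "((\<lambda>t. l (\<i> * of_real t)) \<longlongrightarrow> 0) at_top" and f1: "((\<lambda>t. f (\<i> * of_real t)) \<longlongrightarrow> 1) at_top"
    and t: "t > 0"
  shows "hypK (l (\<i> * of_real t)) = f (\<i> * of_real t)"
proof -
  define \<Omega> where "\<Omega> = {\<tau> \<in> upper. l \<tau> \<in> ball 0 1}"
  define \<Omega>0 where "\<Omega>0 = connected_component_set \<Omega> \<i>"
  have "continuous_on upper l"
    using sol by (intro continuous_at_imp_continuous_on) (auto simp: hyp_solution_def intro: DERIV_isCont)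
  moreover have "\<Omega> = upper \<inter> l -` ball 0 1" unfolding \<Omega>_def by blast
  ultimately have "open \<Omega>"
    by (simp only: continuous_open_preimage open_upper open_ball)
  then have o: "open \<Omega>0" unfolding \<Omega>0_def by (rule open_connected_component)
  have c: "connected \<Omega>0" unfolding \<Omega>0_def by (rule connected_connected_component)
  have axis: "\<i> * of_real t \<in> \<Omega>0" if "t > 0" for t
  proof -
    have "connected ((\<lambda>t::real. \<i> * of_real t) ` {0<..})"
      by (intro connected_continuous_image continuous_intros) auto
    moreover have "(\<lambda>t::real. \<i> * of_real t) ` {0<..} \<subseteq> \<Omega>"
      using lt by (auto simp: \<Omega>_def)
    moreover have "\<i> \<in> (\<lambda>t::real. \<i> * of_real t) ` {0<..}"
      by (rule image_eqI[of _ _ 1]) auto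
    ultimately have "(\<lambda>t::real. \<i> * of_real t) ` {0<..} \<subseteq> \<Omega>0"
      unfolding \<Omega>0_def by (intro connected_component_maximal)
    then show ?thesis using that by auto
  qed
  have sub: "\<tau> \<in> \<Omega>0 \<Longrightarrow> Im \<tau> > 0 \<and> norm (l \<tau>) < 1" for \<tau>
    using connected_component_subset[of \<Omega> \<i>] by (auto simp: \<Omega>0_def \<Omega>_def)
  obtain \<alpha> \<beta> where ab: "\<And>\<tau>. \<tau> \<in> \<Omega>0 \<Longrightarrow> hypK (l \<tau>) = (\<alpha> + \<beta> * \<tau>) * f \<tau>"
    by (rule hypK_ratio_affine[of \<Omega>0 f l "\<i>\<pi>" u])
       (use o c sub sol in \<open>auto simp: hyp_solution_def\<close>)
  have "((\<lambda>t. hypK (l (\<i> * of_real t)) / f (\<i> * of_real t)) \<longlongrightarrow> hypK 0 / 1) at_top"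
  proof (intro tendsto_divide f1)
    have "isCont hypK 0" by (rule DERIV_isCont[OF DERIV_hypK]) simp
    then show "((\<lambda>t. hypK (l (\<i> * of_real t))) \<longlongrightarrow> hypK 0) at_top"
      by (rule isCont_tendsto_compose) (rule l0)
  qed auto
  moreover have "\<forall>\<^sub>F t in at_top. hypK (l (\<i> * of_real t)) / f (\<i> * of_real t) = \<alpha> + \<beta> * (\<i> * of_real t)"
    using eventually_gt_at_top[of 0]
  proof eventually_elim
    case (elim t)
    have "f (\<i> * of_real t) \<noteq> 0" using sol elim by (simp add: hyp_solution_def)
    then show ?case using ab[OF axis[OF elim]] by simp
  qed
  ultimately have lim: "((\<lambda>t. \<alpha> + \<beta> * (\<i> * of_real t)) \<longlongrightarrow> 1) at_top"
    by (simp add: hypK_0 Lim_transform_eventually)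
  \<comment> \<open>The affine function has the same limit at t and at t + 1, and its values there
    differ by \<beta> times i.\<close>
  have "\<beta> = 0"
  proof -
    have "filterlim (\<lambda>t::real. t + 1) at_top at_top" by real_asymp
    from tendsto_diff[OF filterlim_compose[OF lim this] lim]
    have "((\<lambda>t::real. \<beta> * \<i>) \<longlongrightarrow> 0) at_top" by (simp add: algebra_simps)
    then have "\<beta> * \<i> = 0" by (simp add: tendsto_const_iff)
    then show ?thesis by simp
  qed
  then have "\<alpha> = 1" using lim by (simp add: tendsto_const_iff)
  with \<open>\<beta> = 0\<close> show ?thesis using ab[OF axis[OF t]] by simp
qed

text \<open>On the axis \<open>theta2\<close>, \<open>theta3\<close> and the square of
  \<open>theta4\<close> are real and nonzero, so lambda and 1 - lambda are both quotients of
  positive numbers.\<close>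

lemma modular_lambda_imag:
  assumes "t > 0"
  obtains y where "modular_lambda (\<i> * of_real t) = of_real y" "0 < y" "y < 1"
proof -
  let ?\<tau> = "\<i> * complex_of_real t"
  define a b where "a = theta_real 0 t" and "b = theta_real (1/2) t"
  have \<tau>: "Im ?\<tau> > 0" using assms by simp
  have 3: "theta3 ?\<tau> = of_real a" and 2: "theta2 ?\<tau> = of_real b"
    using theta_series_imag[OF assms] by (simp_all add: theta3_eq theta2_eq a_def b_def)
  define c where "c = theta_real 0 (2 * t) ^ 2 - theta_real (1/2) (2 * t) ^ 2"
  have 4: "theta4 ?\<tau> ^ 2 = of_real c"
    using theta4_double[OF \<tau>] theta_series_imag[of "2 * t" 0] theta_series_imag[of "2 * t" "1/2"] assms
    by (simp add: theta3_eq theta2_eq c_def mult.left_commute)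
  have nz: "a \<noteq> 0" "b \<noteq> 0" "c \<noteq> 0"
    using theta3_nonzero[OF \<tau>] theta2_nonzero[OF \<tau>] theta4_nonzero[OF \<tau>] 2 3 4 by auto
  have l: "modular_lambda ?\<tau> = of_real (b ^ 4 / a ^ 4)"
    by (simp add: modular_lambda_def 2 3)
  have "theta4 ?\<tau> ^ 4 = (theta4 ?\<tau> ^ 2) ^ 2" by (simp flip: power_mult)
  then have "1 - modular_lambda ?\<tau> = of_real (c ^ 2 / a ^ 4)"
    unfolding one_minus_modular_lambda[OF \<tau>] by (simp add: 3 4)
  then have "of_real (1 - b ^ 4 / a ^ 4) = (of_real (c ^ 2 / a ^ 4) :: complex)"
    using l by simp
  then have "1 - b ^ 4 / a ^ 4 = c ^ 2 / a ^ 4" by (simp only: of_real_eq_iff)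
  moreover have "b ^ 4 / a ^ 4 > 0" "c ^ 2 / a ^ 4 > 0"
    using nz by (auto intro!: divide_pos_pos simp: zero_less_power_eq)
  ultimately show ?thesis using l by (intro that[of "b ^ 4 / a ^ 4"]) auto
qed

lemma minus_inverse_imag: "- 1 / (\<i> * of_real t) = \<i> * of_real (1 / t)"
  by (simp add: divide_inverse)

lemma filterlim_imag_cusp: "filterlim (\<lambda>t::real. \<i> * of_real t) cusp at_top"
  by (rule filterlim_cuspI) (simp add: filterlim_ident)

text \<open>By duplication the square of \<open>theta4\<close> at i/t is 2 theta3(2i/t)^2 -
  theta3(i/t)^2. Both terms are asymptotic to t, so it is negligible against theta3(i/t)^2.\<close>

lemma one_minus_lambda_near_0: "((\<lambda>t. 1 - modular_lambda (\<i> / of_real t)) \<longlongrightarrow> 0) at_top"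
proof -
  let ?f = "\<lambda>t. theta3 (\<i> / of_real t) ^ 2 / of_real t"
  have h: "filterlim (\<lambda>t::real. t / 2) at_top at_top" by real_asymp
  have "((\<lambda>t. ((?f (t / 2) - ?f t) / ?f t) ^ 2) \<longlongrightarrow> ((1 - 1) / 1) ^ 2) at_top"
    by (intro tendsto_intros theta3_near_0 filterlim_compose[OF theta3_near_0 h]) auto
  moreover have "\<forall>\<^sub>F t in at_top. ((?f (t / 2) - ?f t) / ?f t) ^ 2 = 1 - modular_lambda (\<i> / of_real t)"
    using eventually_gt_at_top[of 0]
  proof eventually_elim
    case (elim t)
    let ?\<tau> = "\<i> / complex_of_real t"
    have \<tau>: "Im ?\<tau> > 0" using elim by (simp add: Im_divide)
    have "theta4 ?\<tau> ^ 2 = 2 * theta3 (2 * ?\<tau>) ^ 2 - theta3 ?\<tau> ^ 2"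
      using theta4_double[OF \<tau>] theta3_double[OF \<tau>] by simp
    then have "?f (t / 2) - ?f t = theta4 ?\<tau> ^ 2 / of_real t"
      using elim by (simp add: field_simps)
    then have "((?f (t / 2) - ?f t) / ?f t) ^ 2 = (theta4 ?\<tau> ^ 2 / theta3 ?\<tau> ^ 2) ^ 2"
      using elim by simp
    also have "\<dots> = theta4 ?\<tau> ^ 4 / theta3 ?\<tau> ^ 4"
      by (simp add: power_divide flip: power_mult)
    finally show ?case unfolding one_minus_modular_lambda[OF \<tau>] .
  qed
  ultimately show ?thesis by (simp add: Lim_transform_eventually)
qed

lemma theta_axis: "t > 0 \<Longrightarrow> hypK (modular_lambda (\<i> * of_real t)) = theta3 (\<i> * of_real t) ^ 2"
proof (rule hyp_solution_axis[OF hyp_solution_theta])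
  show "norm (modular_lambda (\<i> * of_real t)) < 1" if "t > 0" for t
    using modular_lambda_imag[OF that] by (metis abs_of_pos norm_of_real)
  show "((\<lambda>t. modular_lambda (\<i> * of_real t)) \<longlongrightarrow> 0) at_top"
    by (rule filterlim_compose[OF modular_lambda_tendsto filterlim_imag_cusp])
  show "((\<lambda>t. theta3 (\<i> * of_real t) ^ 2) \<longlongrightarrow> 1) at_top"
    using tendsto_power[OF filterlim_compose[OF theta3_tendsto filterlim_imag_cusp], of 2] by simp
qed

lemma theta_axis_inversion:
  "t > 0 \<Longrightarrow> hypK (1 - modular_lambda (\<i> * of_real (1 / t))) = theta3 (\<i> * of_real (1 / t)) ^ 2 / of_real t"
proof -
  assume t: "t > 0"
  let ?f = "\<lambda>\<tau>. \<i> * theta3 (- 1 / \<tau>) ^ 2 / \<tau>"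
  have f: "?f (\<i> * of_real t) = theta3 (\<i> / of_real t) ^ 2 / of_real t" for t
    unfolding minus_inverse_imag by (simp add: divide_simps)
  have "hypK (1 - modular_lambda (- 1 / (\<i> * of_real t))) = ?f (\<i> * of_real t)"
  proof (rule hyp_solution_axis[OF hyp_solution_inversion[OF hyp_solution_theta] _ _ _ t])
    show "norm (1 - modular_lambda (- 1 / (\<i> * of_real t))) < 1" if t: "t > 0" for t
    proof -
      obtain y where "modular_lambda (\<i> * of_real (1 / t)) = of_real y" "0 < y" "y < 1"
        using modular_lambda_imag[of "1 / t"] t by auto
      then show ?thesis unfolding minus_inverse_imag
        by (metis abs_of_pos diff_gt_0_iff_gt diff_less_eq less_add_same_cancel1 norm_of_real of_real_1 of_real_diff)
    qed
    show "((\<lambda>t. 1 - modular_lambda (- 1 / (\<i> * of_real t))) \<longlongrightarrow> 0) at_top"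
      using one_minus_lambda_near_0 unfolding minus_inverse_imag by simp
    show "((\<lambda>t. ?f (\<i> * of_real t)) \<longlongrightarrow> 1) at_top"
      unfolding f by (rule theta3_near_0)
  qed
  then show ?thesis unfolding f unfolding minus_inverse_imag by simp
qed

text \<open>Separation of variables for y' = - pi y (1 - y) F(y)^2. The disc is convex, lies in the
  unit disc, contains the interval from 0 to 1 and omits both end points.\<close>

lemma hypK_primitive:
  obtains h where "\<And>z. z \<in> ball (1/2) (1/2) \<Longrightarrow> (h has_field_derivative 1 / (z * (1 - z) * hypK z ^ 2)) (at z)"
proof -
  have b: "norm z < 1 \<and> z \<noteq> 0 \<and> z \<noteq> 1" if "z \<in> ball (1/2) (1/2 :: real)" for z :: complex
  proof -
    have "dist (1/2) z < 1/2" using that by simp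
    moreover have "norm z \<le> norm (1/2 :: complex) + norm (1/2 - z)"
      by (metis norm_triangle_sub add.commute norm_minus_commute)
    ultimately show ?thesis by (auto simp: dist_norm)
  qed
  have "(\<lambda>z. 1 / (z * (1 - z) * hypK z ^ 2)) holomorphic_on ball (1/2) (1/2)"
    using b hypK_nonzero
    by (intro holomorphic_intros holomorphic_on_subset[OF holomorphic_hypK]) auto
  from holomorphic_convex_primitive'[OF convex_ball open_ball this] obtain h where
    "\<And>z. z \<in> ball (1/2) (1/2) \<Longrightarrow> (h has_field_derivative 1 / (z * (1 - z) * hypK z ^ 2)) (at z within ball (1/2) (1/2))"
    by blast
  then show ?thesis
    by (intro that) (simp add: at_within_open[OF _ open_ball])
qed

text \<open>Replacing f by F(l) makes the derivative of l along the axis a function of l alone; the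
  primitive \<open>h\<close> then turns t into a linear function.\<close>

lemma primitive_along_axis:
  assumes sol: "hyp_solution f u l" and K: "\<And>t. t > 0 \<Longrightarrow> hypK (l (\<i> * of_real t)) = f (\<i> * of_real t)"
    and b: "\<And>t. t > 0 \<Longrightarrow> l (\<i> * of_real t) \<in> ball (1/2) (1/2)"
    and h: "\<And>z. z \<in> ball (1/2) (1/2) \<Longrightarrow> (h has_field_derivative 1 / (z * (1 - z) * hypK z ^ 2)) (at z)"
  obtains c where "\<And>t. t > 0 \<Longrightarrow> h (l (\<i> * of_real t)) = c - of_real pi * of_real t"
proof -
  have "((\<lambda>t. h (l (\<i> * of_real t)) + of_real pi * of_real t) has_vector_derivative 0) (at t within {0<..})"
    if t: "t \<in> {0<..}" for t :: real
  proof -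
    let ?l = "l (\<i> * of_real t)" and ?f = "f (\<i> * of_real t)"
    have t0: "t > 0" using t by simp
    have nz: "?l \<noteq> 0" "?l \<noteq> 1" using b[OF t0] by (auto simp: dist_norm)
    have f0: "?f \<noteq> 0" and l': "(l has_field_derivative \<i>\<pi> * ?l * (1 - ?l) * ?f ^ 2) (at (\<i> * of_real t))"
      using sol t0 by (simp_all add: hyp_solution_def)
    have "((\<lambda>t. \<i> * complex_of_real t) has_vector_derivative \<i>) (at t)"
      by (rule has_vector_derivative_eq_rhs, rule has_vector_derivative_mult_right, rule has_vector_derivative_of_real, rule DERIV_ident) simp
    from field_vector_diff_chain_at[OF this DERIV_chain[OF h[OF b[OF t0]] l']]
    have "((\<lambda>t. h (l (\<i> * of_real t))) has_vector_derivative
        \<i> * (1 / (?l * (1 - ?l) * hypK ?l ^ 2) * (\<i>\<pi> * ?l * (1 - ?l) * ?f ^ 2))) (at t)"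
      by (simp add: o_def)
    also have "\<i> * (1 / (?l * (1 - ?l) * hypK ?l ^ 2) * (\<i>\<pi> * ?l * (1 - ?l) * ?f ^ 2)) = - of_real pi"
      unfolding K[OF t0] using nz f0 by (simp add: field_simps)
    finally have 1: "((\<lambda>t. h (l (\<i> * of_real t))) has_vector_derivative - of_real pi) (at t)" .
    have 2: "((\<lambda>t. of_real pi * complex_of_real t) has_vector_derivative of_real pi) (at t)"
      by (rule has_vector_derivative_eq_rhs, rule has_vector_derivative_mult_right, rule has_vector_derivative_of_real, rule DERIV_ident) simp
    from has_vector_derivative_add[OF 1 2]
    show ?thesis by (simp add: has_vector_derivative_at_within)
  qed
  from has_vector_derivative_zero_constant[OF _ this] obtain c where
    c: "\<And>t. t \<in> {0<..} \<Longrightarrow> h (l (\<i> * of_real t)) + of_real pi * of_real t = c"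
    by (metis convex_real_interval(3))
  show ?thesis
  proof (rule that)
    fix t :: real assume "t > 0"
    then show "h (l (\<i> * of_real t)) = c - of_real pi * of_real t"
      using c[of t] by (simp add: eq_diff_eq)
  qed
qed

lemma modular_lambda_axis_surj:
  assumes "0 < x" "x < 1"
  obtains t where "t > 0" "modular_lambda (\<i> * of_real t) = of_real x"
proof -
  let ?y = "\<lambda>t. Re (modular_lambda (\<i> * of_real t))"
  have "continuous_on {0<..} ?y"
    by (intro continuous_intros continuous_on_compose2[OF holomorphic_on_imp_continuous_on[OF holomorphic_modular_lambda]]) auto
  then have conn: "connected (?y ` {0<..})"
    by (rule connected_continuous_image) auto
  have "((\<lambda>t. modular_lambda (\<i> * of_real t)) \<longlongrightarrow> 0) at_top"
    by (rule filterlim_compose[OF modular_lambda_tendsto filterlim_imag_cusp])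
  from tendsto_Re[OF this] have "(?y \<longlongrightarrow> 0) at_top" by simp
  from order_tendstoD(2)[OF this assms(1)] have "\<forall>\<^sub>F t in at_top. ?y t < x \<and> t > 0"
    by (intro eventually_conj eventually_gt_at_top)
  from eventually_happens'[OF trivial_limit_at_top_linorder this]
  obtain t1 where t1: "?y t1 < x" "t1 > 0"
    by blast
  from tendsto_Re[OF one_minus_lambda_near_0]
  have "((\<lambda>t. 1 - ?y (1 / t)) \<longlongrightarrow> 0) at_top" by simp
  from order_tendstoD(2)[OF this, of "1 - x"] assms have "\<forall>\<^sub>F t in at_top. 1 - ?y (1 / t) < 1 - x \<and> t > 0"
    by (intro eventually_conj eventually_gt_at_top) (auto elim!: eventually_mono)
  from eventually_happens'[OF trivial_limit_at_top_linorder this]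
  obtain t2 where t2: "1 - ?y (1 / t2) < 1 - x" "t2 > 0"
    by blast
  have "?y t1 \<in> ?y ` {0<..}" "?y (1 / t2) \<in> ?y ` {0<..}"
    using t1 t2 by (intro imageI; simp)+
  from connectedD_interval[OF conn this, of x] t1 t2 have "x \<in> ?y ` {0<..}"
    by simp
  then obtain t where t: "t > 0" "x = ?y t" by auto
  obtain y where "modular_lambda (\<i> * of_real t) = of_real y"
    using modular_lambda_imag[OF t(1)] .
  then show ?thesis using that[OF t(1)] t(2) by simp
qed

text \<open>Applied to both sides, \<open>h\<close> gives linear functions of t of equal slope, so
  ?m t = ?l t' forces t - t' to be one constant \<sigma>. Every positive t has a positive partner t'
  and conversely, because both functions take all values between 0 and 1. A positive \<sigma> fails
  at t = \<sigma>, a negative one at t' = - \<sigma>.\<close>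

lemma modular_lambda_inversion_axis:
  assumes "t > 0"
  shows "1 - modular_lambda (\<i> * of_real (1 / t)) = modular_lambda (\<i> * of_real t)"
proof -
  let ?l = "\<lambda>t. modular_lambda (\<i> * of_real t)"
  let ?m = "\<lambda>t. 1 - modular_lambda (\<i> * of_real (1 / t))"
  have ball: "complex_of_real y \<in> ball (1/2) (1/2)" if "0 < y" "y < 1" for y
  proof -
    have "norm (complex_of_real (1/2 - y)) < 1/2" using that by (simp only: norm_of_real)
    then show ?thesis by (simp add: dist_norm)
  qed
  obtain h where h: "\<And>z. z \<in> ball (1/2) (1/2) \<Longrightarrow> (h has_field_derivative 1 / (z * (1 - z) * hypK z ^ 2)) (at z)"
    by (rule hypK_primitive) blast
  obtain c1 where c1: "\<And>t. t > 0 \<Longrightarrow> h (?l t) = c1 - of_real pi * of_real t"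
  proof (rule primitive_along_axis[OF hyp_solution_theta theta_axis _ h])
    show "modular_lambda (\<i> * of_real t) \<in> ball (1/2) (1/2)" if "t > 0" for t
      using modular_lambda_imag[OF that] ball by metis
  qed auto
  obtain c2 where c2: "\<And>t. t > 0 \<Longrightarrow> h (1 - modular_lambda (- 1 / (\<i> * of_real t))) = c2 - of_real pi * of_real t"
  proof (rule primitive_along_axis[OF hyp_solution_inversion[OF hyp_solution_theta] _ _ h])
    show "hypK (1 - modular_lambda (- 1 / (\<i> * of_real t))) = \<i> * theta3 (- 1 / (\<i> * of_real t)) ^ 2 / (\<i> * of_real t)" if "t > 0" for t
      unfolding minus_inverse_imag using theta_axis_inversion[OF that] by simp
    show "1 - modular_lambda (- 1 / (\<i> * of_real t)) \<in> ball (1/2) (1/2)" if "t > 0" for t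
    proof -
      obtain y where y: "modular_lambda (\<i> * of_real (1 / t)) = of_real y" "0 < y" "y < 1"
        using modular_lambda_imag[of "1 / t"] \<open>t > 0\<close> by (metis zero_less_divide_1_iff)
      then show ?thesis unfolding minus_inverse_imag using ball[of "1 - y"] by simp
    qed
  qed auto
  have c2': "h (?m t) = c2 - of_real pi * of_real t" if "t > 0" for t
    using c2[OF that] unfolding minus_inverse_imag .
  define s where "s = (c2 - c1) / of_real pi"
  have s: "s = of_real (t - t')" if "t > 0" "t' > 0" "?m t = ?l t'" for t t'
  proof -
    have "c2 - of_real pi * of_real t = c1 - of_real pi * of_real t'"
      using c1[OF that(2)] c2'[OF that(1)] that(3) by simp
    then show ?thesis by (simp add: s_def field_simps)
  qed
  have 1: "\<exists>t'>0. ?m t = ?l t'" if t: "t > 0" for t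
  proof -
    obtain y where y: "modular_lambda (\<i> * of_real (1 / t)) = of_real y" "0 < y" "y < 1"
      using modular_lambda_imag[of "1 / t"] t by (metis zero_less_divide_1_iff)
    obtain t' where "t' > 0" "?l t' = of_real (1 - y)"
      by (rule modular_lambda_axis_surj[of "1 - y"]) (use y in auto)
    then show ?thesis using y(1) by (intro exI[of _ t']) simp
  qed
  have 2: "\<exists>t>0. ?m t = ?l t'" if t': "t' > 0" for t'
  proof -
    obtain y where y: "?l t' = of_real y" "0 < y" "y < 1"
      using modular_lambda_imag[OF t'] by metis
    obtain r where "r > 0" "?l r = of_real (1 - y)"
      by (rule modular_lambda_axis_surj[of "1 - y"]) (use y in auto)
    then show ?thesis using y(1) by (intro exI[of _ "1 / r"]) simp
  qed
  have "s \<in> \<real>" using 1[of 1] s[of 1] by auto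
  then obtain \<sigma> where \<sigma>: "s = of_real \<sigma>" by (auto elim: Reals_cases)
  have eq: "\<sigma> = t - t'" if "t > 0" "t' > 0" "?m t = ?l t'" for t t'
    using s[OF that] \<sigma> by (simp only: of_real_eq_iff)
  have "\<not> \<sigma> > 0"
  proof
    assume \<sigma>: "\<sigma> > 0"
    then obtain t' where "t' > 0" "?m \<sigma> = ?l t'" using 1 by blast
    with eq[of \<sigma> t'] \<sigma> show False by simp
  qed
  moreover have "\<not> \<sigma> < 0"
  proof
    assume \<sigma>: "\<sigma> < 0"
    then obtain t where "t > 0" "?m t = ?l (- \<sigma>)" using 2[of "- \<sigma>"] by auto
    with eq[of t "- \<sigma>"] \<sigma> show False by simp
  qed
  ultimately have "\<sigma> = 0" by simp
  obtain t' where "t' > 0" "?m t = ?l t'" using 1[OF assms] by blast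
  with eq[OF assms this] \<open>\<sigma> = 0\<close> show ?thesis by simp
qed

section \<open>Extension from the imaginary axis to the upper half-plane\<close>

lemma imaginary_axis_islimpt: "\<i> islimpt (\<lambda>t::real. \<i> * of_real t) ` {0<..}"
proof -
  let ?U = "(\<lambda>t::real. \<i> * of_real t) ` {0<..}"
  have U: "connected ?U"
    by (intro connected_continuous_image continuous_intros) auto
  have "\<i> \<in> ?U" by (rule image_eqI[of _ _ 1]) auto
  moreover have "2 * \<i> \<in> ?U" by (rule image_eqI[of _ _ 2]) auto
  ultimately have "?U \<noteq> {x}" for x
    using complex_i_not_zero by (metis (no_types, lifting) mult_cancel_right1 numeral_eq_one_iff semiring_norm(85) singletonD)
  with \<open>\<i> \<in> ?U\<close> show ?thesis
    by (intro connected_imp_perfect U)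
qed

lemma eq_on_upper_if_eq_on_axis:
  assumes "f holomorphic_on upper" "g holomorphic_on upper"
    and eq: "\<And>t. t > 0 \<Longrightarrow> f (\<i> * of_real t) = g (\<i> * of_real t)" and "Im \<tau> > 0"
  shows "f \<tau> = g \<tau>"
proof -
  have "f \<tau> - g \<tau> = 0"
    by (rule analytic_continuation[of "\<lambda>\<tau>. f \<tau> - g \<tau>" upper "(\<lambda>t::real. \<i> * of_real t) ` {0<..}" \<i>])
       (use assms open_upper convex_upper imaginary_axis_islimpt in \<open>auto intro!: holomorphic_intros convex_connected\<close>)
  then show ?thesis by simp
qed

lemma holomorphic_inversion:
  assumes "f holomorphic_on upper"
  shows "(\<lambda>\<tau>. f (- 1 / \<tau>)) holomorphic_on upper"
proof (rule holomorphic_on_compose_gen[OF _ assms, unfolded o_def])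
  show "(\<lambda>\<tau>. - 1 / \<tau>) ` upper \<subseteq> upper"
    using Im_minus_inverse by blast
qed (auto intro!: holomorphic_intros)

lemma modular_lambda_inversion:
  assumes "Im \<tau> > 0"
  shows "modular_lambda (- 1 / \<tau>) = 1 - modular_lambda \<tau>"
proof (rule eq_on_upper_if_eq_on_axis[OF _ _ _ assms])
  show "modular_lambda (- 1 / (\<i> * of_real t)) = 1 - modular_lambda (\<i> * of_real t)" if "t > 0" for t
    unfolding minus_inverse_imag modular_lambda_inversion_axis[OF that, symmetric] by simp
qed (intro holomorphic_intros holomorphic_inversion holomorphic_modular_lambda)+

text \<open>On the axis both sides are values of F, at 1 - lambda(i/t) and at lambda(i t), and these
  arguments agree by \<open>modular_lambda_inversion_axis\<close>.\<close>

lemma theta3_sq_inversion: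
  assumes "Im \<tau> > 0"
  shows "theta3 (- 1 / \<tau>) ^ 2 = - \<i> * \<tau> * theta3 \<tau> ^ 2"
proof (rule eq_on_upper_if_eq_on_axis[OF _ _ _ assms])
  show "theta3 (- 1 / (\<i> * of_real t)) ^ 2 = - \<i> * (\<i> * of_real t) * theta3 (\<i> * of_real t) ^ 2" if "t > 0" for t
  proof -
    have "theta3 (\<i> * of_real (1 / t)) ^ 2 / of_real t = theta3 (\<i> * of_real t) ^ 2"
      using theta_axis_inversion[OF that] theta_axis[OF that] modular_lambda_inversion_axis[OF that] by simp
    then show ?thesis unfolding minus_inverse_imag using that by (simp add: field_simps)
  qed
qed (intro holomorphic_intros holomorphic_inversion holomorphic_theta3 holomorphic_inversion[OF holomorphic_theta3, THEN holomorphic_on_power])+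

section \<open>The region around the cusp\<close>

lemma theta_series_cnj: "theta_series a (- cnj \<tau>) = cnj (theta_series a \<tau>)"
proof -
  have "exp (\<i>\<pi> * of_real ((of_int n + a)\<^sup>2) * (- cnj \<tau>)) = cnj (theta_term a \<tau> n)" for n :: int
    by (simp add: exp_cnj)
  then show ?thesis by (simp only: theta_series_def infsum_cnj)
qed

lemma modular_lambda_cnj: "modular_lambda (- cnj \<tau>) = cnj (modular_lambda \<tau>)"
  by (simp only: modular_lambda_def theta2_eq theta3_eq theta_series_cnj complex_cnj_divide complex_cnj_power)

lemma modular_lambda_plus1:
  assumes "Im \<tau> > 0"
  shows "modular_lambda (\<tau> + 1) = - modular_lambda \<tau> / (1 - modular_lambda \<tau>)"
  unfolding one_minus_modular_lambda[OF assms] unfolding modular_lambda_def theta2_plus1[OF assms]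
  using theta3_nonzero[OF assms] theta4_nonzero[OF assms] by (simp add: theta4_def)

lemma modular_lambda_plus2: "modular_lambda (\<tau> + 2) = modular_lambda \<tau>"
  by (simp add: modular_lambda_def theta2_plus2 theta3_plus2 power_mult_distrib)

text \<open>The map is inversion, translation by 1, inversion. On lambda these act as x -> 1 - x, x
  -> - x / (1 - x), x -> 1 - x, with composition 1 / x.\<close>

lemma modular_lambda_reciprocal:
  assumes "Im \<tau> > 0"
  shows "modular_lambda (\<tau> / (1 - \<tau>)) = 1 / modular_lambda \<tau>"
proof -
  let ?l = "modular_lambda \<tau>"
  have nz: "?l \<noteq> 0" "\<tau> \<noteq> 0" "\<tau> \<noteq> 1"
    using assms modular_lambda_nonzero[OF assms] by auto
  have i: "Im (- 1 / \<tau>) > 0" "Im (- 1 / \<tau> + 1) > 0"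
    using Im_minus_inverse[OF assms] by auto
  have "\<tau> / (1 - \<tau>) = - 1 / (- 1 / \<tau> + 1)"
    using nz by (simp add: field_simps)
  then have "modular_lambda (\<tau> / (1 - \<tau>)) = 1 - - (1 - ?l) / (1 - (1 - ?l))"
    by (simp only: modular_lambda_inversion[OF i(2)] modular_lambda_plus1[OF i(1)] modular_lambda_inversion[OF assms])
  also have "\<dots> = 1 / ?l" using nz by (simp add: field_simps)
  finally show ?thesis .
qed

text \<open>The point \<open>- cnj (\<tau> / (1 - \<tau>))\<close> is the mirror image of \<open>\<tau>\<close> in the circle \<open>norm (\<tau> - 1) = 1\<close>.\<close>

lemma norm_modular_lambda_reflection:
  assumes "Im \<tau> > 0"
  shows "norm (modular_lambda (- cnj (\<tau> / (1 - \<tau>)))) = 1 / norm (modular_lambda \<tau>)"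
  unfolding modular_lambda_cnj complex_mod_cnj modular_lambda_reciprocal[OF assms] by (simp add: norm_divide)

lemma circle_reflection:
  assumes "\<tau> \<noteq> 1"
  shows "- cnj (\<tau> / (1 - \<tau>)) - 1 = (\<tau> - 1) / of_real (norm (\<tau> - 1) ^ 2)"
proof -
  have "- cnj (\<tau> / (1 - \<tau>)) - 1 = 1 / cnj (\<tau> - 1)"
    using assms by (simp add: field_simps)
  also have "\<dots> = (\<tau> - 1) / ((\<tau> - 1) * cnj (\<tau> - 1))"
    using assms by simp
  finally show ?thesis unfolding complex_norm_square .
qed

text \<open>Points of the circle are fixed by the reflection, which sends |lambda| to 1 /
  |lambda|.\<close>

lemma norm_modular_lambda_circle:
  assumes "Im \<tau> > 0" "norm (\<tau> - 1) = 1"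
  shows "norm (modular_lambda \<tau>) = 1"
proof -
  have "- cnj (\<tau> / (1 - \<tau>)) = \<tau>"
  proof -
    have "\<tau> \<noteq> 1" using assms by auto
    from circle_reflection[OF this] assms show ?thesis by simp
  qed
  with norm_modular_lambda_reflection[OF assms(1)]
  have "norm (modular_lambda \<tau>) * norm (modular_lambda \<tau>) = 1"
    using modular_lambda_nonzero[OF assms(1)] by (simp add: field_simps)
  then show ?thesis
    by (metis norm_ge_zero abs_of_nonneg abs_square_eq_1 power2_eq_square)
qed

lemma norm_modular_lambda_circle':
  assumes "Im \<tau> > 0" "norm (\<tau> + 1) = 1"
  shows "norm (modular_lambda \<tau>) = 1"
proof -
  have "norm (- cnj \<tau> - 1) = norm (- cnj (\<tau> + 1))" by simp
  also have "\<dots> = 1" using assms(2) by (simp only: norm_minus_cancel complex_mod_cnj)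
  finally have "norm (modular_lambda (- cnj \<tau>)) = 1"
    using norm_modular_lambda_circle[of "- cnj \<tau>"] assms(1) by simp
  then show ?thesis by (simp add: modular_lambda_cnj)
qed

text \<open>With w = 2 the lines Re tau = 1 and Re tau = -1 of the fundamental domain are interior;
  the maximum principle and the identity theorem then need no separate treatment of them.\<close>

definition cusp_region :: "real \<Rightarrow> complex set" where
  "cusp_region w = {\<tau>. Im \<tau> > 0 \<and> \<bar>Re \<tau>\<bar> < w \<and> norm (\<tau> - 1) > 1 \<and> norm (\<tau> + 1) > 1}"

lemma open_cusp_region: "open (cusp_region w)"
  unfolding cusp_region_def
  by (intro open_Collect_conj open_Collect_less continuous_intros)

lemma norm_mono_Im: "0 \<le> Im \<tau> \<Longrightarrow> 0 \<le> s \<Longrightarrow> norm (\<tau> + of_real x) \<le> norm (\<tau> + \<i> * of_real s + of_real x)"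
  unfolding cmod_def by (intro real_sqrt_le_mono) (auto intro!: power_mono)

text \<open>Moving straight up never leaves the region, and every vertical ray reaches the convex
  strip above height 1.\<close>

lemma connected_cusp_region:
  assumes "w > 0"
  shows "connected (cusp_region w)"
proof -
  let ?T = "{\<tau>. Im \<tau> > 1 \<and> \<bar>Re \<tau>\<bar> < w}"
  let ?S = "\<lambda>\<tau>. (\<lambda>s::real. \<tau> + \<i> * of_real s) ` {0..}"
  have T: "?T \<subseteq> cusp_region w"
  proof
    fix \<tau> assume \<tau>: "\<tau> \<in> ?T"
    have "Im (\<tau> - 1) \<le> norm (\<tau> - 1)" "Im (\<tau> + 1) \<le> norm (\<tau> + 1)"
      using abs_Im_le_cmod[of "\<tau> - 1"] abs_Im_le_cmod[of "\<tau> + 1"] by auto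
    with \<tau> show "\<tau> \<in> cusp_region w" by (auto simp: cusp_region_def)
  qed
  have S: "?S \<tau> \<subseteq> cusp_region w" if "\<tau> \<in> cusp_region w" for \<tau>
  proof
    fix z assume "z \<in> ?S \<tau>"
    then obtain s where s: "s \<ge> 0" "z = \<tau> + \<i> * of_real s" by auto
    show "z \<in> cusp_region w"
      using that s norm_mono_Im[of \<tau> s 1] norm_mono_Im[of \<tau> s "-1"] by (auto simp: cusp_region_def)
  qed
  have cT: "connected ?T"
  proof (intro convex_connected)
    have "?T = {\<tau>. Im \<tau> > 1} \<inter> {\<tau>. Re \<tau> < w} \<inter> {\<tau>. Re \<tau> > - w}" by (auto simp: abs_less_iff)
    then show "convex ?T"
      by (simp only:) (intro convex_Int convex_halfspace_Im_gt convex_halfspace_Re_lt convex_halfspace_Re_gt)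
  qed
  have c: "connected (?S \<tau> \<union> ?T)" if "\<tau> \<in> cusp_region w" for \<tau>
  proof (rule connected_Un)
    show "connected (?S \<tau>)"
      by (intro connected_continuous_image continuous_intros) auto
    have "\<tau> + \<i> * of_real 2 \<in> ?S \<tau>" by (rule image_eqI[of _ _ 2]) auto
    moreover have "\<tau> + \<i> * of_real 2 \<in> ?T"
      using that by (auto simp: cusp_region_def)
    ultimately show "?S \<tau> \<inter> ?T \<noteq> {}" by blast
  qed (rule cT)
  have U: "cusp_region w = \<Union> ((\<lambda>\<tau>. ?S \<tau> \<union> ?T) ` cusp_region w)"
  proof (rule subset_antisym)
    show "cusp_region w \<subseteq> \<Union> ((\<lambda>\<tau>. ?S \<tau> \<union> ?T) ` cusp_region w)"
    proof
      fix \<tau> assume "\<tau> \<in> cusp_region w"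
      moreover have "\<tau> \<in> ?S \<tau>" by (rule image_eqI[of _ _ 0]) auto
      ultimately show "\<tau> \<in> \<Union> ((\<lambda>\<tau>. ?S \<tau> \<union> ?T) ` cusp_region w)" by blast
    qed
  qed (use S T in blast)
  have i: "2 * \<i> \<in> ?T" using assms by simp
  have "connected (\<Union> ((\<lambda>\<tau>. ?S \<tau> \<union> ?T) ` cusp_region w))"
  proof (rule connected_Union)
    show "\<Inter> ((\<lambda>\<tau>. ?S \<tau> \<union> ?T) ` cusp_region w) \<noteq> {}"
      using i by blast
  qed (use c in blast)
  then show ?thesis using U by simp
qed

text \<open>Lambda has period 2. A shift by -2 brings in the condition of distance more than 1 from
  the point 3, which Re tau < 2 supplies; the other side is symmetric.\<close>

lemma cusp_region_2_cases:
  assumes "\<tau> \<in> cusp_region 2"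
  shows "\<exists>\<sigma>. \<sigma> \<in> cusp_region 2 \<and> \<bar>Re \<sigma>\<bar> \<le> 1 \<and> modular_lambda \<sigma> = modular_lambda \<tau>"
proof -
  consider "\<bar>Re \<tau>\<bar> \<le> 1" | "Re \<tau> > 1" | "Re \<tau> < -1" by linarith
  then show ?thesis
  proof cases
    case 1
    then show ?thesis using assms by blast
  next
    case 2
    have "norm (\<tau> - 3) > 1"
      using abs_Re_le_cmod[of "\<tau> - 3"] assms by (auto simp: cusp_region_def)
    then have "\<tau> - 2 \<in> cusp_region 2"
      using assms 2 by (auto simp: cusp_region_def algebra_simps)
    moreover have "\<bar>Re (\<tau> - 2)\<bar> \<le> 1" using assms 2 by (auto simp: cusp_region_def)
    ultimately show ?thesis using modular_lambda_plus2[of "\<tau> - 2"] by (intro exI[of _ "\<tau> - 2"]) auto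
  next
    case 3
    have "norm (\<tau> + 3) > 1"
      using abs_Re_le_cmod[of "\<tau> + 3"] assms by (auto simp: cusp_region_def)
    then have "\<tau> + 2 \<in> cusp_region 2"
      using assms 3 by (auto simp: cusp_region_def algebra_simps)
    moreover have "\<bar>Re (\<tau> + 2)\<bar> \<le> 1" using assms 3 by (auto simp: cusp_region_def)
    ultimately show ?thesis using modular_lambda_plus2[of \<tau>] by (intro exI[of _ "\<tau> + 2"]) auto
  qed
qed

lemma modular_lambda_small:
  assumes "\<delta> > 0"
  obtains Y where "Y > 0" "\<And>\<tau>. Im \<tau> > Y \<Longrightarrow> norm (modular_lambda \<tau>) < \<delta>"
proof -
  from tendstoD[OF modular_lambda_tendsto assms] obtain P where P: "eventually P at_top"
      "\<And>\<tau>. P (Im \<tau>) \<Longrightarrow> norm (modular_lambda \<tau>) < \<delta>"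
    by (auto simp: eventually_filtercomap)
  then obtain Y where "\<And>y. y > Y \<Longrightarrow> P y"
    by (auto simp: eventually_at_top_dense)
  with P show ?thesis by (intro that[of "max Y 1"]) auto
qed

text \<open>By periodicity \<open>max\<close> bounds lambda on the whole open region. The maximum
  principle then makes lambda constant there, against its limit 0 at the cusp.\<close>

lemma modular_lambda_no_max:
  assumes \<tau>1: "\<tau>1 \<in> cusp_region 2" "norm (modular_lambda \<tau>1) \<ge> 1"
    and max: "\<And>\<tau>. \<tau> \<in> cusp_region 2 \<Longrightarrow> \<bar>Re \<tau>\<bar> \<le> 1 \<Longrightarrow> norm (modular_lambda \<tau>) \<le> norm (modular_lambda \<tau>1)"
  shows False
proof -
  have sub: "cusp_region 2 \<subseteq> upper" by (auto simp: cusp_region_def)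
  have "modular_lambda constant_on cusp_region 2"
  proof (rule maximum_modulus_principle[OF holomorphic_on_subset[OF holomorphic_modular_lambda sub]])
    show "norm (modular_lambda z) \<le> norm (modular_lambda \<tau>1)" if "z \<in> cusp_region 2" for z
      using cusp_region_2_cases[OF that] max by metis
  qed (use open_cusp_region connected_cusp_region[of 2] \<tau>1 in auto)
  then obtain c where c: "\<And>\<tau>. \<tau> \<in> cusp_region 2 \<Longrightarrow> modular_lambda \<tau> = c"
    by (auto simp: constant_on_def)
  obtain Y where Y: "Y > 0" "\<And>\<tau>. Im \<tau> > Y \<Longrightarrow> norm (modular_lambda \<tau>) < 1"
    using modular_lambda_small[of 1] by auto
  define z where "z = \<i> * of_real (Y + 2)"
  have "z \<in> cusp_region 2"
    using abs_Im_le_cmod[of "z - 1"] abs_Im_le_cmod[of "z + 1"] Y(1)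
    by (auto simp: cusp_region_def z_def)
  then have "norm c < 1" using Y(2)[of z] c by (simp add: z_def)
  then show False using c[OF \<tau>1(1)] \<tau>1(2) by simp
qed

text \<open>The two circles are tangent at 0: with tau = x + i y and |x| <= 1, lying outside both
  forces |x| < y^2. Hence Im (-1/tau) = y / (x^2 + y^2) is at least 1 / (2 y), and the inversion
  carries this corner to the cusp at infinity.\<close>

lemma modular_lambda_near_cusp_0:
  assumes "\<delta> > 0"
  obtains e where "0 < e" "\<And>\<tau>. \<tau> \<in> cusp_region 2 \<Longrightarrow> \<bar>Re \<tau>\<bar> \<le> 1 \<Longrightarrow> Im \<tau> < e \<Longrightarrow> norm (modular_lambda \<tau> - 1) < \<delta>"
proof -
  obtain Y where Y: "Y > 0" "\<And>\<tau>. Im \<tau> > Y \<Longrightarrow> norm (modular_lambda \<tau>) < \<delta>"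
    using modular_lambda_small[OF assms] by auto
  show ?thesis
  proof (rule that[of "min 1 (1 / (2 * Y))"])
    show "0 < min 1 (1 / (2 * Y))" using Y by simp
    fix \<tau> assume \<tau>: "\<tau> \<in> cusp_region 2" "\<bar>Re \<tau>\<bar> \<le> 1" "Im \<tau> < min 1 (1 / (2 * Y))"
    define x y where "x = Re \<tau>" and "y = Im \<tau>"
    have y: "0 < y" "y < 1" "2 * Y * y < 1" and x: "\<bar>x\<bar> \<le> 1"
      using \<tau> Y by (auto simp: cusp_region_def x_def y_def field_simps)
    have "1 < norm (\<tau> - 1) ^ 2" "1 < norm (\<tau> + 1) ^ 2"
      using \<tau> by (auto simp: cusp_region_def intro!: one_less_power)
    then have c: "1 < (x - 1)\<^sup>2 + y\<^sup>2" "1 < (x + 1)\<^sup>2 + y\<^sup>2"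
      by (simp_all add: cmod_power2 x_def y_def)
    have x2: "x\<^sup>2 \<le> \<bar>x\<bar>"
      using x mult_left_le[of "\<bar>x\<bar>" "\<bar>x\<bar>"] by (simp add: power2_eq_square abs_mult[symmetric])
    have "2 * \<bar>x\<bar> < x\<^sup>2 + y\<^sup>2"
      using c by (simp add: power2_eq_square algebra_simps abs_if)
    then have xy: "\<bar>x\<bar> < y\<^sup>2" using x2 by simp
    then have "x\<^sup>2 \<le> y\<^sup>2" using x2 by simp
    then have "x\<^sup>2 + y\<^sup>2 \<le> 2 * y\<^sup>2" by simp
    then have "Y * (x\<^sup>2 + y\<^sup>2) \<le> Y * (2 * y\<^sup>2)" using Y(1) by (intro mult_left_mono) auto
    also have "\<dots> = y * (2 * Y * y)" by (simp add: power2_eq_square)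
    also have "\<dots> < y * 1" using y by (intro mult_strict_left_mono) auto
    finally have "Y * (x\<^sup>2 + y\<^sup>2) < y" by simp
    moreover have "x\<^sup>2 + y\<^sup>2 > 0" using y by (intro add_nonneg_pos) auto
    ultimately have "Y < y / (x\<^sup>2 + y\<^sup>2)" by (simp add: pos_less_divide_eq)
    also have "\<dots> = Im (- 1 / \<tau>)" by (simp add: Im_divide x_def y_def)
    finally have "norm (modular_lambda (- 1 / \<tau>)) < \<delta>" by (rule Y(2))
    moreover have "Im \<tau> > 0" using y by (simp add: y_def)
    ultimately show "norm (modular_lambda \<tau> - 1) < \<delta>"
      by (simp only: modular_lambda_inversion norm_minus_commute)
  qed
qed

text \<open>A value of modulus above 1 could come neither from great height, where lambda is small,
  nor from near 0, where lambda is close to 1. So the supremum is attained on the compact set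
  \<open>K\<close>, and off the circles, where |lambda| = 1: at a point of the open region, which
  \<open>modular_lambda_no_max\<close> excludes.\<close>

lemma norm_modular_lambda_le_1:
  assumes \<tau>0: "\<tau>0 \<in> cusp_region 2" "\<bar>Re \<tau>0\<bar> \<le> 1"
  shows "norm (modular_lambda \<tau>0) \<le> 1"
proof (rule ccontr)
  assume "\<not> ?thesis"
  then have gt: "norm (modular_lambda \<tau>0) > 1" by simp
  define \<delta> where "\<delta> = norm (modular_lambda \<tau>0) - 1"
  have \<delta>: "\<delta> > 0" using gt by (simp add: \<delta>_def)
  obtain Y where Y: "Y > 0" "\<And>\<tau>. Im \<tau> > Y \<Longrightarrow> norm (modular_lambda \<tau>) < 1"
    using modular_lambda_small[of 1] by auto
  obtain e where e: "0 < e" "\<And>\<tau>. \<tau> \<in> cusp_region 2 \<Longrightarrow> \<bar>Re \<tau>\<bar> \<le> 1 \<Longrightarrow> Im \<tau> < e \<Longrightarrow> norm (modular_lambda \<tau> - 1) < \<delta>"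
    using modular_lambda_near_cusp_0[OF \<delta>] by auto
  have low: "norm (modular_lambda \<tau>) < norm (modular_lambda \<tau>0)"
    if "\<tau> \<in> cusp_region 2" "\<bar>Re \<tau>\<bar> \<le> 1" "Im \<tau> < e" for \<tau>
    using e(2)[OF that] norm_triangle_ineq[of "modular_lambda \<tau> - 1" 1] by (simp add: \<delta>_def)
  have high: "norm (modular_lambda \<tau>) < norm (modular_lambda \<tau>0)" if "Im \<tau> > Y" for \<tau>
    using Y(2)[OF that] gt by simp
  define K where "K = {\<tau>. \<bar>Re \<tau>\<bar> \<le> 1 \<and> e \<le> Im \<tau> \<and> Im \<tau> \<le> Y \<and> 1 \<le> norm (\<tau> - 1) \<and> 1 \<le> norm (\<tau> + 1)}"
  have K_upper: "K \<subseteq> upper" using e(1) by (auto simp: K_def)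
  have "closed K"
    unfolding K_def by (intro closed_Collect_conj closed_Collect_le continuous_intros)
  moreover have "bounded K"
  proof (rule boundedI)
    fix z assume "z \<in> K"
    then show "norm z \<le> 1 + Y"
      using cmod_le[of z] e(1) by (auto simp: K_def)
  qed
  ultimately have "compact K" by (simp add: compact_eq_bounded_closed)
  moreover have K: "\<tau> \<in> K" if "\<tau> \<in> cusp_region 2" "\<bar>Re \<tau>\<bar> \<le> 1" "norm (modular_lambda \<tau>) \<ge> norm (modular_lambda \<tau>0)" for \<tau>
    using low[of \<tau>] high[of \<tau>] that unfolding K_def cusp_region_def by fastforce
  have "\<tau>0 \<in> K" by (rule K[OF \<tau>0]) simp
  moreover have "continuous_on K (\<lambda>\<tau>. norm (modular_lambda \<tau>))"
    by (intro continuous_intros holomorphic_on_imp_continuous_on holomorphic_on_subset[OF holomorphic_modular_lambda K_upper])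
  ultimately obtain \<tau>1 where \<tau>1: "\<tau>1 \<in> K" "\<And>\<tau>. \<tau> \<in> K \<Longrightarrow> norm (modular_lambda \<tau>) \<le> norm (modular_lambda \<tau>1)"
    using continuous_attains_sup[of K "\<lambda>\<tau>. norm (modular_lambda \<tau>)"] by auto
  have ge: "norm (modular_lambda \<tau>1) \<ge> norm (modular_lambda \<tau>0)"
    using \<tau>1(2)[OF \<open>\<tau>0 \<in> K\<close>] .
  have "Im \<tau>1 > 0" using \<tau>1(1) K_upper by auto
  moreover have "norm (\<tau>1 - 1) \<noteq> 1" "norm (\<tau>1 + 1) \<noteq> 1"
    using norm_modular_lambda_circle[of \<tau>1] norm_modular_lambda_circle'[of \<tau>1] gt ge \<open>Im \<tau>1 > 0\<close> by auto
  ultimately have "\<tau>1 \<in> cusp_region 2"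
    using \<tau>1(1) by (auto simp: K_def cusp_region_def)
  then show False
  proof (rule modular_lambda_no_max)
    show "norm (modular_lambda \<tau>) \<le> norm (modular_lambda \<tau>1)" if "\<tau> \<in> cusp_region 2" "\<bar>Re \<tau>\<bar> \<le> 1" for \<tau>
      using K[OF that] \<tau>1(2) ge by (meson linorder_le_cases order_trans)
  qed (use gt ge in simp)
qed

text \<open>Since 1 is already an upper bound, a value of modulus 1 would itself be a
  maximum.\<close>

lemma norm_modular_lambda_less_1:
  assumes "\<tau> \<in> cusp_region 2"
  shows "norm (modular_lambda \<tau>) < 1"
proof (rule ccontr)
  assume *: "\<not> ?thesis"
  then have ge: "1 \<le> norm (modular_lambda \<tau>)" by simp
  show False
    by (rule modular_lambda_no_max[OF assms ge], rule order_trans[OF norm_modular_lambda_le_1 ge])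
qed

text \<open>The identity theorem on the connected region, starting from \<open>theta_axis\<close>;
  the bound |lambda| < 1 on all of the region is what makes F(lambda) holomorphic there.\<close>

lemma hypK_modular_lambda:
  assumes "\<tau> \<in> cusp_region 2"
  shows "hypK (modular_lambda \<tau>) = theta3 \<tau> ^ 2"
proof -
  let ?U = "(\<lambda>t::real. \<i> * of_real t) ` {0<..}"
  have sub: "cusp_region 2 \<subseteq> upper" by (auto simp: cusp_region_def)
  have axis: "?U \<subseteq> cusp_region 2"
  proof
    fix z assume "z \<in> ?U"
    then obtain t :: real where t: "z = \<i> * of_real t" "t > 0" by auto
    have "sqrt 1 < sqrt (1 + t\<^sup>2)" using t by (intro real_sqrt_less_mono) simp
    then have "1 < norm (z - 1)" "1 < norm (z + 1)" by (simp_all add: t(1) cmod_def)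
    then show "z \<in> cusp_region 2" using t by (simp add: cusp_region_def)
  qed
  have "(\<lambda>\<tau>. hypK (modular_lambda \<tau>)) holomorphic_on cusp_region 2"
    by (rule holomorphic_on_compose_gen[OF holomorphic_on_subset[OF holomorphic_modular_lambda sub] holomorphic_hypK, unfolded o_def])
       (use norm_modular_lambda_less_1 in auto)
  then have "(\<lambda>\<tau>. hypK (modular_lambda \<tau>) - theta3 \<tau> ^ 2) holomorphic_on cusp_region 2"
    by (intro holomorphic_intros holomorphic_on_subset[OF holomorphic_theta3 sub])
  then have "hypK (modular_lambda \<tau>) - theta3 \<tau> ^ 2 = 0"
  proof (rule analytic_continuation[OF _ open_cusp_region _ axis])
    show "connected (cusp_region 2)" by (rule connected_cusp_region) simp
    have "\<i> \<in> ?U" by (rule image_eqI[of _ _ 1]) auto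
    then show "\<i> \<in> cusp_region 2" using axis by blast
    show "\<i> islimpt ?U" by (rule imaginary_axis_islimpt)
    show "hypK (modular_lambda z) - theta3 z ^ 2 = 0" if "z \<in> ?U" for z
      using that theta_axis by auto
  qed (rule assms)
  then show ?thesis by simp
qed

text \<open>Reflection in the circle around 1 takes the semicircle over [0, 1] to the line Re = 0. A
  point of the fundamental domain inside that circle therefore has its mirror image in the strip 0
  <= Re <= 1 outside both circles, where |lambda| < 1; so at the point itself |lambda| > 1. The
  circle around -1 is handled by the symmetry tau -> - cnj tau.\<close>

lemma around_infinity_cusp_region:
  assumes "around_infinity \<tau>"
  shows "\<tau> \<in> cusp_region 2"
proof -
  have \<tau>: "Im \<tau> > 0" "\<bar>Re \<tau>\<bar> \<le> 1" "norm (\<tau> - 1/2) \<ge> 1/2" "norm (\<tau> + 1/2) \<ge> 1/2" "norm (modular_lambda \<tau>) < 1"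
    using assms by (auto simp: around_infinity_def Gamma2_fundamental_domain_def)
  have *: "norm (\<tau> - 1) > 1" if \<tau>: "Im \<tau> > 0" "\<bar>Re \<tau>\<bar> \<le> 1" "norm (\<tau> - 1/2) \<ge> 1/2" "norm (modular_lambda \<tau>) < 1" for \<tau>
  proof (rule ccontr)
    assume "\<not> norm (\<tau> - 1) > 1"
    moreover have "norm (\<tau> - 1) \<noteq> 1" using norm_modular_lambda_circle[of \<tau>] \<tau> by auto
    ultimately have lt: "norm (\<tau> - 1) < 1" by simp
    have t1: "\<tau> \<noteq> 1" using \<tau> by auto
    define r where "r = norm (\<tau> - 1) ^ 2"
    have r: "0 < r" "r < 1" using t1 lt by (auto simp: r_def power_less_one_iff)
    define \<sigma> where "\<sigma> = - cnj (\<tau> / (1 - \<tau>))"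
    have \<sigma>1: "\<sigma> - 1 = (\<tau> - 1) / of_real r"
      unfolding \<sigma>_def r_def by (rule circle_reflection[OF t1])
    have "Re (\<sigma> - 1) = (Re \<tau> - 1) / r" "Im (\<sigma> - 1) = Im \<tau> / r" unfolding \<sigma>1 by simp_all
    then have Re: "Re \<sigma> = 1 + (Re \<tau> - 1) / r" and Im: "Im \<sigma> = Im \<tau> / r" by (simp_all add: algebra_simps)
    have "norm (\<sigma> - 1) ^ 2 = 1 / r"
    proof -
      have "norm (\<sigma> - 1) = norm (\<tau> - 1) / r" unfolding \<sigma>1 using r by (simp add: norm_divide)
      then have "norm (\<sigma> - 1) ^ 2 = r / r ^ 2" by (simp only: power_divide r_def[symmetric])
      then show ?thesis using r by (simp add: power2_eq_square)
    qed
    then have n1: "norm (\<sigma> - 1) ^ 2 > 1" using r by simp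
    have "(1/2)\<^sup>2 \<le> norm (\<tau> - 1/2) ^ 2" using \<tau>(3) by (intro power_mono) auto
    then have "(1/2)\<^sup>2 \<le> (Re \<tau> - 1/2)\<^sup>2 + (Im \<tau>)\<^sup>2" by (simp only: cmod_power2) simp
    moreover have "r = (Re \<tau> - 1)\<^sup>2 + (Im \<tau>)\<^sup>2" by (simp add: r_def cmod_power2)
    ultimately have "r + (Re \<tau> - 1) \<ge> 0"
      by (simp add: power2_eq_square algebra_simps)
    then have R0: "Re \<sigma> \<ge> 0" unfolding Re using r by (simp add: field_simps)
    have R1: "Re \<sigma> \<le> 1" unfolding Re using r \<tau>(2) by (simp add: field_simps)
    have I: "Im \<sigma> > 0" unfolding Im using r \<tau> by simp
    have "1 < (Re \<sigma> + 1)\<^sup>2 + (Im \<sigma>)\<^sup>2"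
    proof -
      have "1 \<le> (Re \<sigma> + 1)\<^sup>2" using R0 power_mono[of 1 "Re \<sigma> + 1" 2] by simp
      moreover have "(Im \<sigma>)\<^sup>2 > 0" using I by simp
      ultimately show ?thesis by linarith
    qed
    then have n2: "norm (\<sigma> + 1) ^ 2 > 1" by (simp add: cmod_power2)
    have "norm (\<sigma> - 1) > 1" "norm (\<sigma> + 1) > 1"
      using n1 n2 by (auto intro: power_less_imp_less_base[of 1 2, simplified])
    then have "\<sigma> \<in> cusp_region 2" using R0 R1 I by (simp add: cusp_region_def)
    then have "norm (modular_lambda \<sigma>) < 1" by (rule norm_modular_lambda_less_1)
    then have "1 / norm (modular_lambda \<tau>) < 1"
      unfolding \<sigma>_def norm_modular_lambda_reflection[OF \<tau>(1)] .
    then show False using \<tau> modular_lambda_nonzero[OF \<tau>(1)] by (simp add: field_simps)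
  qed
  have 1: "norm (\<tau> - 1) > 1" using *[of \<tau>] \<tau> by auto
  have e: "norm (- cnj \<tau> - of_real x) = norm (\<tau> + of_real x)" for x
  proof -
    have "- cnj \<tau> - of_real x = - cnj (\<tau> + of_real x)" by simp
    then show ?thesis by (simp only: norm_minus_cancel complex_mod_cnj)
  qed
  have "norm (- cnj \<tau> - 1) > 1"
    using *[of "- cnj \<tau>"] \<tau> e[of "1/2"] by (simp add: modular_lambda_cnj)
  then have 2: "norm (\<tau> + 1) > 1" using e[of 1] by simp
  show ?thesis using 1 2 \<tau> by (simp add: cusp_region_def)
qed

section \<open>The Gauss product and the Eisenstein series of weight 2\<close>

definition lambert :: "nat \<Rightarrow> complex \<Rightarrow> complex" where
  "lambert k \<tau> = (\<Sum>n. of_nat (Suc n) ^ k * nome \<tau> ^ Suc n / (1 - nome \<tau> ^ Suc n))"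

lemma E2_lambert: "E2 \<tau> = 1 - 24 * lambert 1 \<tau>"
  by (simp add: E2_def lambert_def)

lemma E4_lambert: "E4 \<tau> = 1 + 240 * lambert 3 \<tau>"
  by (simp add: E4_def lambert_def)

lemma E6_lambert: "E6 \<tau> = 1 - 504 * lambert 5 \<tau>"
  by (simp add: E6_def lambert_def)

lemma norm_nome: "norm (nome \<tau>) = exp (- (2 * pi * Im \<tau>))"
  by (simp add: nome_def)

lemma norm_nome_less_1: "Im \<tau> > 0 \<Longrightarrow> norm (nome \<tau>) < 1"
  by (simp add: norm_nome)

lemma summable_power_exp:
  fixes c :: real
  assumes "c > 0"
  shows "summable (\<lambda>n. real n ^ k * exp (- c) ^ n)"
proof (rule summable_comparison_test_bigo)
  have e: "exp a ^ n = exp (a * real n)" for a :: real and n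
    by (simp add: exp_of_nat2_mult)
  have "summable (\<lambda>n. exp (- c / 2) ^ n)"
    using assms by (intro summable_geometric) simp
  then show "summable (\<lambda>n. norm (exp (- c / 2 * real n)))"
    unfolding e by (simp only: real_norm_def abs_exp_cancel)
  have "(\<lambda>n. real n ^ k * exp (- c * real n)) \<in> O(\<lambda>n. exp (- c / 2 * real n))"
    using assms by real_asymp
  then show "(\<lambda>n. real n ^ k * exp (- c) ^ n) \<in> O(\<lambda>n. exp (- c / 2 * real n))"
    unfolding e .
qed

lemma summable_power_less_1:
  fixes r :: real
  assumes "0 \<le> r" "r < 1"
  shows "summable (\<lambda>n. real n ^ k * r ^ n)"
proof (cases "r = 0")
  case True
  then show ?thesis
    by (intro summable_finite[of "{0}"]) auto
next
  case False
  then show ?thesis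
    using summable_power_exp[of "- ln r" k] assms by simp
qed

lemma norm_one_minus_power_ge:
  fixes q :: "'a :: real_normed_div_algebra"
  assumes "norm q \<le> r" "r < 1" "n > 0"
  shows "1 - r \<le> norm (1 - q ^ n)" "1 - r \<le> norm (1 + q ^ n)"
proof -
  have "0 \<le> r" using assms(1) norm_ge_zero order_trans by blast
  have "norm (q ^ n) \<le> r ^ n"
    using assms by (simp add: norm_power power_mono)
  also have "r ^ n \<le> r"
    using power_decreasing[of 1 n r] assms \<open>0 \<le> r\<close> by simp
  finally show "1 - r \<le> norm (1 - q ^ n)" "1 - r \<le> norm (1 + q ^ n)"
    using norm_triangle_ineq2[of 1 "q ^ n"] norm_diff_ineq[of 1 "q ^ n"] by auto
qed

lemma one_pm_power_nonzero:
  fixes q :: "'a :: real_normed_div_algebra"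
  assumes "norm q < 1" "n > 0"
  shows "1 - q ^ n \<noteq> 0" "1 + q ^ n \<noteq> 0"
  using norm_one_minus_power_ge[of q "norm q" n] assms by auto

lemma norm_lambert_term:
  assumes "norm q \<le> r" "r < 1"
  shows "norm (of_nat (Suc n) ^ k * q ^ Suc n / (1 - q ^ Suc n) :: complex) \<le> (real (Suc n) ^ k * r ^ Suc n) / (1 - r)"
proof -
  have r0: "0 \<le> r" using assms(1) norm_ge_zero order_trans by blast
  have "norm (q ^ Suc n) \<le> r ^ Suc n"
    unfolding norm_power using assms by (intro power_mono) auto
  then have "real (Suc n) ^ k * norm (q ^ Suc n) \<le> real (Suc n) ^ k * r ^ Suc n"
    by (intro mult_left_mono) auto
  then have "real (Suc n) ^ k * norm (q ^ Suc n) / norm (1 - q ^ Suc n) \<le> (real (Suc n) ^ k * r ^ Suc n) / (1 - r)"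
    using norm_one_minus_power_ge(1)[OF assms, of "Suc n"] assms r0
    by (intro frac_le) auto
  then show ?thesis by (simp only: norm_divide norm_mult norm_power norm_of_nat)
qed

lemma summable_lambert_majorant:
  assumes "0 \<le> r" "r < 1"
  shows "summable (\<lambda>n. (real (Suc n) ^ k * r ^ Suc n) / (1 - r))"
  using summable_Suc_iff[THEN iffD2, OF summable_power_less_1[OF assms, of k]]
  by (intro summable_divide)

lemma summable_lambert:
  assumes "norm (q :: complex) < 1"
  shows "summable (\<lambda>n. norm (of_nat (Suc n) ^ k * q ^ Suc n / (1 - q ^ Suc n)))"
  by (rule summable_comparison_test'[OF summable_lambert_majorant[of "norm q" k]])
     (use assms norm_lambert_term[OF order.refl assms] in auto)

lemma lambert_sums:
  assumes "Im \<tau> > 0"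
  shows "(\<lambda>n. of_nat (Suc n) ^ k * nome \<tau> ^ Suc n / (1 - nome \<tau> ^ Suc n)) sums lambert k \<tau>"
  unfolding lambert_def
  by (intro summable_sums summable_norm_cancel[OF summable_lambert] norm_nome_less_1 assms)

lemma lambert_tendsto: "(lambert k \<longlongrightarrow> 0) cusp"
proof -
  define C where "C = (\<Sum>n. 2 * (real (Suc n) ^ k * (1/2) ^ n))"
  have sC: "summable (\<lambda>n. 2 * (real (Suc n) ^ k * (1/2) ^ n))"
  proof -
    have "summable (\<lambda>n. real (Suc n) ^ k * (1/2) ^ Suc n)"
      using summable_Suc_iff[THEN iffD2, OF summable_power_less_1[of "1/2" k]] by simp
    from summable_mult[OF this, of 4] show ?thesis by (simp add: mult_ac)
  qed
  have "norm (lambert k \<tau>) \<le> C * exp (- pi * Im \<tau>)" if \<tau>: "Im \<tau> \<ge> 1" for \<tau>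
  proof -
    define r where "r = norm (nome \<tau>)"
    have "exp (- (2 * pi * Im \<tau>)) \<le> exp (- 1)"
      using \<tau> pi_gt3 mult_mono[of 3 pi 1 "Im \<tau>"] by simp
    also have "exp (- 1 :: real) \<le> 1/2"
      using exp_ge_add_one_self[of "1::real"] by (simp add: exp_minus field_simps)
    finally have r: "0 \<le> r" "r \<le> 1/2" by (simp_all add: r_def norm_nome)
    have b: "norm (of_nat (Suc n) ^ k * nome \<tau> ^ Suc n / (1 - nome \<tau> ^ Suc n)) \<le> r * (2 * (real (Suc n) ^ k * (1/2) ^ n))" for n
    proof -
      have "norm (of_nat (Suc n) ^ k * nome \<tau> ^ Suc n / (1 - nome \<tau> ^ Suc n)) \<le> (real (Suc n) ^ k * r ^ Suc n) / (1 - r)"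
        using r by (intro norm_lambert_term) (auto simp: r_def)
      also have "\<dots> \<le> (real (Suc n) ^ k * (r * (1/2) ^ n)) / (1/2)"
        using r by (intro frac_le mult_left_mono) (auto intro!: mult_left_mono power_mono)
      finally show ?thesis by (simp add: mult_ac)
    qed
    have "norm (lambert k \<tau>) \<le> (\<Sum>n. r * (2 * (real (Suc n) ^ k * (1/2) ^ n)))"
      unfolding lambert_def by (intro norm_suminf_le b summable_mult sC)
    also have "\<dots> = C * r"
      unfolding C_def using suminf_mult[OF sC, of r] by (simp add: mult.commute)
    also have "\<dots> \<le> C * exp (- pi * Im \<tau>)"
    proof (rule mult_left_mono)
      show "r \<le> exp (- pi * Im \<tau>)" using \<tau> by (simp add: r_def norm_nome)
      show "C \<ge> 0" unfolding C_def by (intro suminf_nonneg sC) auto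
    qed
    finally show ?thesis .
  qed
  from decay_cusp[OF this, of 0] show ?thesis by simp
qed

text \<open>Partial products of Gauss's product. Each factor has the elementary logarithmic
  derivative that makes \<open>theta4\<close> accessible to Lambert series.\<close>

definition gauss_prod :: "complex \<Rightarrow> nat \<Rightarrow> complex" where
  "gauss_prod x n = (\<Prod>j<n. (1 - x ^ Suc j) / (1 + x ^ Suc j))"

lemma gauss_prod_nonzero: "norm x < 1 \<Longrightarrow> gauss_prod x n \<noteq> 0"
  unfolding gauss_prod_def using one_pm_power_nonzero[of x "Suc _"] by (auto simp del: power_Suc)

text \<open>The term s = 0 is the partial product itself, because 2 / (1 + x^0) = 1; every term with
  s >= 1 carries x^(s (n+1)) and dies out as n grows.\<close>

definition shanks_term :: "complex \<Rightarrow> nat \<Rightarrow> nat \<Rightarrow> complex" where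
  "shanks_term x s n = (-1) ^ s * (gauss_prod x n / gauss_prod x s) * (2 / (1 + x ^ s)) * x ^ (s * Suc n)"

text \<open>
  Shanks' finite form of the Gauss product: passing from n to n + 1, the differences of the
  terms telescope over s.
\<close>

lemma shanks_telescope:
  assumes x: "norm x < 1"
  shows "(\<Sum>s\<le>m. shanks_term x s (Suc n) - shanks_term x s n)
    = - 2 * gauss_prod x n / (1 + x ^ Suc n) * (-1) ^ m * x ^ (Suc m * Suc n) / gauss_prod x m"
proof (induction m)
  case 0
  have nz: "1 + x ^ Suc n \<noteq> 0" using one_pm_power_nonzero[OF x, of "Suc n"] by simp
  define y where "y = x ^ Suc n"
  have "shanks_term x 0 (Suc n) - shanks_term x 0 n = gauss_prod x n * ((1 - y) / (1 + y) - 1)"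
    by (simp add: shanks_term_def gauss_prod_def y_def algebra_simps)
  also have "(1 - y) / (1 + y) - 1 = - 2 * y / (1 + y)"
    using nz[folded y_def] by (simp add: field_simps)
  finally show ?case by (simp add: y_def gauss_prod_def)
next
  case (Suc m)
  define y z where "y = x ^ Suc n" and "z = x ^ Suc m"
  define G g where "G = gauss_prod x n" and "g = gauss_prod x m"
  define w where "w = x ^ (Suc m * Suc n)"
  have nz: "1 + y \<noteq> 0" "1 + z \<noteq> 0" "1 - z \<noteq> 0" "g \<noteq> 0"
    using one_pm_power_nonzero[OF x, of "Suc n"] one_pm_power_nonzero[OF x, of "Suc m"] gauss_prod_nonzero[OF x]
    by (auto simp: y_def z_def g_def)
  have G': "gauss_prod x (Suc n) = G * ((1 - y) / (1 + y))" "gauss_prod x (Suc m) = g * ((1 - z) / (1 + z))"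
    by (simp_all add: gauss_prod_def G_def g_def y_def z_def)
  have p: "x ^ (Suc m * Suc (Suc n)) = w * z" "x ^ (Suc (Suc m) * Suc n) = w * y"
    by (simp_all add: w_def y_def z_def algebra_simps flip: power_add)
  have "(\<Sum>s\<le>Suc m. shanks_term x s (Suc n) - shanks_term x s n)
    = - 2 * G / (1 + y) * (-1) ^ m * w / g
      + ((-1) ^ Suc m * (G * ((1 - y) / (1 + y)) / (g * ((1 - z) / (1 + z)))) * (2 / (1 + z)) * (w * z)
        - (-1) ^ Suc m * (G / (g * ((1 - z) / (1 + z)))) * (2 / (1 + z)) * w)"
    unfolding sum.atMost_Suc Suc.IH unfolding shanks_term_def G' p
    by (simp only: G_def g_def y_def z_def w_def)
  also have "\<dots> = (-1) ^ m * G * w / g * (- 2 / (1 + y) - (1 - y) / (1 + y) * (2 / (1 - z)) * z + 2 / (1 - z))"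
  proof -
    \<comment> \<open>The factor 2 / (1 + z) equals Z K, so the Z contributed by the new factor of
      the product cancels.\<close>
    define Y Z K where "Y = (1 - y) / (1 + y)" and "Z = (1 - z) / (1 + z)" and "K = 2 / (1 - z)"
    have Z: "2 / (1 + z) = Z * K" "Z \<noteq> 0"
      using nz unfolding Z_def K_def by (simp add: divide_simps; simp add: algebra_simps)+
    have c: "e * (A / (g * Z)) * (Z * K) = e * (A * K / g)" for e A
      using Z(2) by simp
    show ?thesis
      unfolding Y_def[symmetric] Z_def[symmetric] K_def[symmetric] Z(1) c
      by (simp add: algebra_simps)
  qed
  also have "- 2 / (1 + y) - (1 - y) / (1 + y) * (2 / (1 - z)) * z + 2 / (1 - z) = 2 * y / (1 + y) * ((1 + z) / (1 - z))"
    using nz by (simp add: divide_simps) (simp add: algebra_simps)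
  also have "(-1) ^ m * G * w / g * (2 * y / (1 + y) * ((1 + z) / (1 - z)))
      = - 2 * G / (1 + y) * (-1) ^ Suc m * (w * y) / (g * ((1 - z) / (1 + z)))"
    by (simp add: mult_ac)
  finally show ?case unfolding p G' by (simp only: G_def y_def)
qed

text \<open>In the step from n to n + 1, with y = x^(n+1) and w = x^((n+1)^2), telescoping
  contributes 2 (-1)^(n+1) w / (1 + y) and the new term 2 (-1)^(n+1) w y / (1 + y). Together they
  are the next term of the theta series.\<close>

lemma shanks_identity:
  assumes x: "norm x < 1"
  shows "1 + 2 * (\<Sum>s<n. (-1) ^ Suc s * x ^ (Suc s)\<^sup>2) = (\<Sum>s\<le>n. shanks_term x s n)"
proof (induction n)
  case 0
  then show ?case by (simp add: shanks_term_def gauss_prod_def)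
next
  case (Suc n)
  define y where "y = x ^ Suc n"
  have nz: "1 + y \<noteq> 0" "gauss_prod x n \<noteq> 0" "gauss_prod x (Suc n) \<noteq> 0"
    using one_pm_power_nonzero[OF x, of "Suc n"] gauss_prod_nonzero[OF x] by (auto simp: y_def)
  define w where "w = x ^ (Suc n * Suc n)"
  have p: "x ^ (Suc n * Suc (Suc n)) = w * y"
  proof -
    have "Suc n * Suc (Suc n) = Suc n * Suc n + Suc n" by simp
    then show ?thesis by (simp only: w_def y_def power_add)
  qed
  have "(\<Sum>s\<le>Suc n. shanks_term x s (Suc n))
    = (\<Sum>s\<le>n. shanks_term x s n) + (\<Sum>s\<le>n. shanks_term x s (Suc n) - shanks_term x s n) + shanks_term x (Suc n) (Suc n)"
    by (simp add: sum_subtractf)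
  also have "\<dots> = 1 + 2 * (\<Sum>s<n. (-1) ^ Suc s * x ^ (Suc s)\<^sup>2)
      + (- 2 * gauss_prod x n / (1 + y) * (-1) ^ n * w / gauss_prod x n)
      + (-1) ^ Suc n * (gauss_prod x (Suc n) / gauss_prod x (Suc n)) * (2 / (1 + y)) * (w * y)"
    unfolding Suc.IH shanks_telescope[OF x] unfolding shanks_term_def p by (simp only: y_def w_def)
  also have "\<dots> = 1 + 2 * (\<Sum>s<n. (-1) ^ Suc s * x ^ (Suc s)\<^sup>2) + 2 * ((-1) ^ Suc n * w)"
    using nz by (simp add: divide_simps) (simp add: algebra_simps)
  also have "w = x ^ (Suc n)\<^sup>2" by (simp only: w_def power2_eq_square)
  finally show ?case by (simp only: sum.lessThan_Suc distrib_left add.assoc)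
qed

text \<open>Each factor is 1 - 2 x^(j+1) / (1 + x^(j+1)), of norm at most exp (2 r^j / (1 - r)); the
  exponents form a geometric series. The bound depends on neither s nor n.\<close>

lemma norm_gauss_prod_ratio:
  assumes "norm x \<le> r" "r < 1" "s \<le> n"
  shows "norm (gauss_prod x n / gauss_prod x s) \<le> exp (2 / (1 - r) ^ 2)"
proof -
  have r0: "0 \<le> r" using assms(1) norm_ge_zero order_trans by blast
  have x: "norm x < 1" using assms by simp
  have "gauss_prod x n = gauss_prod x s * (\<Prod>j=s..<n. (1 - x ^ Suc j) / (1 + x ^ Suc j))"
    unfolding gauss_prod_def atLeast0LessThan[symmetric]
    by (rule prod.atLeastLessThan_concat[symmetric]) (use assms(3) in auto)
  then have "gauss_prod x n / gauss_prod x s = (\<Prod>j=s..<n. (1 - x ^ Suc j) / (1 + x ^ Suc j))"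
    using gauss_prod_nonzero[OF x] by simp
  also have "norm \<dots> \<le> (\<Prod>j=s..<n. exp (2 / (1 - r) * r ^ j))"
    unfolding prod_norm[symmetric]
  proof (rule prod_mono, intro conjI norm_ge_zero)
    fix j
    have nx: "norm (x ^ Suc j) \<le> r ^ j"
    proof -
      have "norm (x ^ Suc j) \<le> r ^ Suc j"
        unfolding norm_power using assms by (intro power_mono) auto
      also have "\<dots> \<le> r ^ j" using r0 assms by (intro power_decreasing) auto
      finally show ?thesis .
    qed
    have ge: "1 - r \<le> norm (1 + x ^ Suc j)"
      using norm_one_minus_power_ge(2)[of x r "Suc j"] assms by simp
    have nz: "1 + x ^ Suc j \<noteq> 0" using one_pm_power_nonzero[OF x, of "Suc j"] by simp
    have "(1 - x ^ Suc j) / (1 + x ^ Suc j) = 1 + - 2 * x ^ Suc j / (1 + x ^ Suc j)"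
      using nz by (simp add: field_simps)
    also have "norm \<dots> \<le> 1 + norm (- 2 * x ^ Suc j / (1 + x ^ Suc j))"
      using norm_triangle_ineq[of 1 "- 2 * x ^ Suc j / (1 + x ^ Suc j)"] by simp
    also have "norm (- 2 * x ^ Suc j / (1 + x ^ Suc j)) = 2 * norm (x ^ Suc j) / norm (1 + x ^ Suc j)"
      by (simp add: norm_divide norm_mult del: power_Suc)
    also have "\<dots> \<le> 2 * r ^ j / (1 - r)"
      using nx ge assms r0 by (intro frac_le mult_left_mono) auto
    also have "1 + 2 * r ^ j / (1 - r) \<le> exp (2 / (1 - r) * r ^ j)"
      using exp_ge_add_one_self[of "2 / (1 - r) * r ^ j"] by simp
    finally show "norm ((1 - x ^ Suc j) / (1 + x ^ Suc j)) \<le> exp (2 / (1 - r) * r ^ j)" by simp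
  qed
  also have "\<dots> = exp (2 / (1 - r) * (\<Sum>j=s..<n. r ^ j))"
    by (simp add: exp_sum sum_distrib_left)
  also have "\<dots> \<le> exp (2 / (1 - r) * (1 / (1 - r)))"
  proof -
    have "(\<Sum>j=s..<n. r ^ j) \<le> (\<Sum>j. r ^ j)"
      using assms r0 by (intro sum_le_suminf summable_geometric) auto
    also have "\<dots> = 1 / (1 - r)" using assms r0 by (intro suminf_geometric) auto
    finally have "2 / (1 - r) * (\<Sum>j=s..<n. r ^ j) \<le> 2 / (1 - r) * (1 / (1 - r))"
      using assms by (intro mult_left_mono) auto
    then show ?thesis by simp
  qed
  also have "2 / (1 - r) * (1 / (1 - r)) = 2 / (1 - r) ^ 2" by (simp add: power2_eq_square)
  finally show ?thesis .
qed

lemma shanks_remainder: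
  assumes "norm x \<le> r" "r < 1"
  shows "norm (gauss_prod x n - (1 + 2 * (\<Sum>s<n. (-1) ^ Suc s * x ^ (Suc s)\<^sup>2)))
    \<le> exp (2 / (1 - r) ^ 2) * (2 / (1 - r)) * (r ^ n / (1 - r))"
proof -
  have r0: "0 \<le> r" using assms(1) norm_ge_zero order_trans by blast
  have x: "norm x < 1" using assms by simp
  let ?C = "exp (2 / (1 - r) ^ 2) * (2 / (1 - r))"
  have C: "?C \<ge> 0" using assms by simp
  have "{..n} = insert 0 {1..n}" by auto
  then have "(\<Sum>s\<le>n. shanks_term x s n) = shanks_term x 0 n + (\<Sum>s=1..n. shanks_term x s n)"
    by simp
  moreover have "shanks_term x 0 n = gauss_prod x n"
    by (simp add: shanks_term_def gauss_prod_def[of x 0])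
  ultimately have "gauss_prod x n - (1 + 2 * (\<Sum>s<n. (-1) ^ Suc s * x ^ (Suc s)\<^sup>2)) = - (\<Sum>s=1..n. shanks_term x s n)"
    unfolding shanks_identity[OF x] by simp
  then have "norm (gauss_prod x n - (1 + 2 * (\<Sum>s<n. (-1) ^ Suc s * x ^ (Suc s)\<^sup>2))) = norm (\<Sum>s=1..n. shanks_term x s n)"
    by (simp only: norm_minus_cancel)
  also have "\<dots> \<le> (\<Sum>s=1..n. norm (shanks_term x s n))" by (rule norm_sum)
  also have "\<dots> \<le> (\<Sum>s=1..n. ?C * (r ^ n * r ^ s))"
  proof (rule sum_mono)
    fix s assume s: "s \<in> {1..n}"
    have 1: "norm (gauss_prod x n / gauss_prod x s) \<le> exp (2 / (1 - r) ^ 2)"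
      using s by (intro norm_gauss_prod_ratio assms) auto
    have 2: "norm (2 / (1 + x ^ s)) \<le> 2 / (1 - r)"
      using norm_one_minus_power_ge(2)[OF assms, of s] s assms by (simp add: norm_divide frac_le)
    have 3: "norm (x ^ (s * Suc n)) \<le> r ^ n * r ^ s"
    proof -
      have "norm (x ^ (s * Suc n)) \<le> r ^ (s * Suc n)"
        unfolding norm_power using assms by (intro power_mono) auto
      \<comment> \<open>For s >= 1 one has s (n+1) >= n + s; this frees the factor r^n that tends to
        0.\<close>
      also have "\<dots> \<le> r ^ (n + s)"
        using s assms r0 by (intro power_decreasing) auto
      finally show ?thesis by (simp add: power_add)
    qed
    have "norm (shanks_term x s n) = norm (gauss_prod x n / gauss_prod x s) * norm (2 / (1 + x ^ s)) * norm (x ^ (s * Suc n))"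
      by (simp only: shanks_term_def norm_mult norm_power) simp
    also have "\<dots> \<le> ?C * (r ^ n * r ^ s)"
      using 1 2 3 C r0 by (intro mult_mono) auto
    finally show "norm (shanks_term x s n) \<le> ?C * (r ^ n * r ^ s)" .
  qed
  also have "\<dots> = ?C * (r ^ n * (\<Sum>s=1..n. r ^ s))"
    by (simp add: sum_distrib_left)
  also have "\<dots> \<le> ?C * (r ^ n * (1 / (1 - r)))"
  proof -
    have "(\<Sum>s=1..n. r ^ s) \<le> (\<Sum>s. r ^ s)"
      using assms r0 by (intro sum_le_suminf summable_geometric) auto
    also have "\<dots> = 1 / (1 - r)" using assms r0 by (intro suminf_geometric) auto
    finally show ?thesis using C r0 by (intro mult_left_mono) auto
  qed
  finally show ?thesis by simp
qed

lemma theta4_series: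
  assumes "Im \<tau> > 0"
  shows "theta4 \<tau> = 1 + 2 * (\<Sum>s. (-1) ^ Suc s * exp (\<i>\<pi> * \<tau>) ^ (Suc s)\<^sup>2)"
proof -
  let ?x = "exp (\<i>\<pi> * \<tau>)"
  let ?t = "\<lambda>n::int. exp (\<i>\<pi> * of_real ((of_int n + 0)\<^sup>2) * (\<tau> + 1))"
  let ?f = "\<lambda>s::nat. (-1) ^ Suc s * ?x ^ (Suc s)\<^sup>2"
  have s: "?t summable_on A" for A
    using assms by (intro summable_theta) simp
  have t: "?t (int (Suc s)) = ?f s" "?t (- int (Suc s)) = ?f s" for s
  proof -
    have "\<i>\<pi> * of_real ((of_int (int (Suc s)) + 0)\<^sup>2) * (\<tau> + 1)
        = of_nat ((Suc s)\<^sup>2) * (\<i>\<pi> * \<tau>) + of_nat ((Suc s)\<^sup>2) * (of_real pi * \<i>)"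
      by (simp add: algebra_simps)
    then have "?t (int (Suc s)) = ?x ^ (Suc s)\<^sup>2 * (-1) ^ ((Suc s)\<^sup>2)"
      by (simp only: exp_add exp_of_nat_mult exp_pi_i)
    also have "(-1) ^ ((Suc s)\<^sup>2) = ((-1) ^ Suc s :: complex)"
      by (simp add: uminus_power_if)
    finally show "?t (int (Suc s)) = ?f s" by (simp only: mult.commute)
    moreover have "?t (- int (Suc s)) = ?t (int (Suc s))"
      by (simp only: of_int_minus add_0_right power2_minus)
    ultimately show "?t (- int (Suc s)) = ?f s" by simp
  qed
  have t': "?f (nat n - 1) = ?t n" if "n \<ge> 1" for n
  proof -
    have "int (Suc (nat n - 1)) = n" using that by simp
    with t(1)[of "nat n - 1"] show ?thesis by (simp only:)
  qed
  have t'': "?f (nat (- n) - 1) = ?t n" if "n \<le> - 1" for n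
  proof -
    have "- int (Suc (nat (- n) - 1)) = n" using that by simp
    with t(2)[of "nat (- n) - 1"] show ?thesis by (simp only:)
  qed
  have P: "infsum ?t {1..} = infsum ?f UNIV"
    by (rule infsum_reindex_bij_witness[where i = "\<lambda>s. int (Suc s)" and j = "\<lambda>n. nat n - 1"])
       (simp_all only: t' atLeast_iff, auto)
  have N: "infsum ?t {..-1} = infsum ?f UNIV"
    by (rule infsum_reindex_bij_witness[where i = "\<lambda>s. - int (Suc s)" and j = "\<lambda>n. nat (- n) - 1"])
       (simp_all only: t'' atMost_iff, auto)
  have sf: "?f summable_on UNIV"
    by (rule summable_on_reindex_bij_witness[where i = "\<lambda>s. int (Suc s)" and j = "\<lambda>n. nat n - 1", THEN iffD1, OF _ _ _ _ _ s[of "{1..}"]])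
       (simp_all only: t' atLeast_iff, auto)
  have U: "(UNIV :: int set) = {0} \<union> ({1..} \<union> {..-1})" by auto
  have "theta4 \<tau> = infsum ?t ({0} \<union> ({1..} \<union> {..-1}))"
    unfolding theta4_def theta3_eq theta_series_def by (subst U) simp
  also have "\<dots> = infsum ?t {0} + (infsum ?t {1..} + infsum ?t {..-1})"
    by (subst infsum_Un_disjoint[OF s s], force, subst infsum_Un_disjoint[OF s s], auto)
  also have "\<dots> = 1 + 2 * infsum ?f UNIV" unfolding P N by simp
  also have "infsum ?f UNIV = suminf ?f"
    using has_sum_imp_sums[OF has_sum_infsum[OF sf]] by (rule sums_unique)
  finally show ?thesis .
qed

lemma exp_pi_double: "exp (\<i>\<pi> * (2 * \<tau>)) = nome \<tau>"
  by (simp add: nome_def mult_ac)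

text \<open>The product differs from the partial theta sums by a uniformly small remainder.
  Uniformity on Im tau >= e is what allows the limit to be differentiated in
  \<open>dlog_theta4_sums\<close>.\<close>

lemma gauss_prod_uniform_limit:
  assumes "e > 0"
  shows "uniform_limit {\<tau>. Im \<tau> \<ge> e} (\<lambda>n \<tau>. gauss_prod (exp (\<i>\<pi> * \<tau>)) n) theta4 sequentially"
proof -
  let ?A = "{\<tau>. Im \<tau> \<ge> e}" and ?x = "\<lambda>\<tau>. exp (\<i>\<pi> * \<tau>)"
  define r where "r = exp (- (pi * e))"
  have r: "0 < r" "r < 1" using assms by (auto simp: r_def)
  have x: "norm (?x \<tau>) \<le> r" if "\<tau> \<in> ?A" for \<tau>
    using that by (simp add: r_def)
  let ?S = "\<lambda>n \<tau>. 1 + 2 * (\<Sum>s<n. (-1) ^ Suc s * ?x \<tau> ^ (Suc s)\<^sup>2)"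
  have "uniform_limit ?A (\<lambda>n \<tau>. \<Sum>s<n. (-1) ^ Suc s * ?x \<tau> ^ (Suc s)\<^sup>2) (\<lambda>\<tau>. \<Sum>s. (-1) ^ Suc s * ?x \<tau> ^ (Suc s)\<^sup>2) sequentially"
  proof (rule Weierstrass_m_test)
    fix n \<tau> assume \<tau>: "\<tau> \<in> ?A"
    have "norm ((-1) ^ Suc n * ?x \<tau> ^ (Suc n)\<^sup>2) = norm (?x \<tau>) ^ (Suc n)\<^sup>2"
      by (simp add: norm_mult norm_power del: norm_exp_eq_Re)
    also have "\<dots> \<le> r ^ (Suc n)\<^sup>2" by (rule power_mono[OF x[OF \<tau>]]) simp
    also have "\<dots> \<le> r ^ n"
      using r by (intro power_decreasing) (auto simp: power2_eq_square)
    finally show "norm ((-1) ^ Suc n * ?x \<tau> ^ (Suc n)\<^sup>2) \<le> r ^ n" .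
  next
    show "summable (\<lambda>n. r ^ n)" using r by simp
  qed
  then have "uniform_limit ?A ?S (\<lambda>\<tau>. 1 + 2 * (\<Sum>s. (-1) ^ Suc s * ?x \<tau> ^ (Suc s)\<^sup>2)) sequentially"
    by (intro uniform_limit_intros bounded_linear.uniform_limit[OF bounded_linear_mult_right])
  also have "?this \<longleftrightarrow> uniform_limit ?A ?S theta4 sequentially"
    by (rule uniform_limit_cong') (use theta4_series assms in auto)
  finally have S: "uniform_limit ?A ?S theta4 sequentially" .
  let ?C = "exp (2 / (1 - r) ^ 2) * (2 / (1 - r)) / (1 - r)"
  have R: "uniform_limit ?A (\<lambda>n \<tau>. gauss_prod (?x \<tau>) n - ?S n \<tau>) (\<lambda>_. 0) sequentially"
  proof (rule uniform_limitI)
    fix d :: real assume d: "d > 0"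
    have "(\<lambda>n. ?C * r ^ n) \<longlonglongrightarrow> ?C * 0"
      using r by (intro tendsto_intros LIMSEQ_realpow_zero) auto
    then have "\<forall>\<^sub>F n in sequentially. ?C * r ^ n < d"
      using d by (intro order_tendstoD) auto
    then show "\<forall>\<^sub>F n in sequentially. \<forall>\<tau>\<in>?A. dist (gauss_prod (?x \<tau>) n - ?S n \<tau>) 0 < d"
    proof eventually_elim
      case (elim n)
      show ?case
      proof
        fix \<tau> assume "\<tau> \<in> ?A"
        from shanks_remainder[OF x[OF this] r(2), of n] elim
        show "dist (gauss_prod (?x \<tau>) n - ?S n \<tau>) 0 < d" by (simp add: mult_ac del: power_Suc)
      qed
    qed
  qed
  from uniform_limit_add[OF R S] show ?thesis by simp
qed

text \<open>With y = x^(j+1) a factor (1 - y) / (1 + y) has logarithmic derivative -2 i pi (j+1) y /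
  (1 - y^2). Locally uniform convergence of the products carries this over to the limit.\<close>

lemma dlog_theta4_sums:
  assumes "Im \<tau> > 0"
  shows "(\<lambda>j. - 2 * (of_nat (Suc j) * exp (\<i>\<pi> * \<tau>) ^ Suc j / (1 - exp (\<i>\<pi> * \<tau>) ^ (2 * Suc j))))
    sums (deriv theta4 \<tau> / theta4 \<tau> / (\<i>\<pi>))"
proof -
  define p where "p = \<i>\<pi>"
  have p: "p \<noteq> 0" by (simp add: p_def)
  let ?x = "\<lambda>\<tau>. exp (p * \<tau>)"
  let ?L = "\<lambda>\<tau> j. - 2 * (of_nat (Suc j) * ?x \<tau> ^ Suc j / (1 - ?x \<tau> ^ (2 * Suc j)))"
  have x1: "norm (?x \<tau>) < 1" if "Im \<tau> > 0" for \<tau>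
    using that by (simp add: p_def)
  have fac: "((\<lambda>\<tau>. (1 - ?x \<tau> ^ Suc j) / (1 + ?x \<tau> ^ Suc j)) has_field_derivative
      (1 - ?x \<tau> ^ Suc j) / (1 + ?x \<tau> ^ Suc j) * (p * ?L \<tau> j)) (at \<tau>)" if "Im \<tau> > 0" for \<tau> j
  proof -
    define y where "y = ?x \<tau> ^ Suc j"
    have nz: "1 - y \<noteq> 0" "1 + y \<noteq> 0"
      using one_pm_power_nonzero[OF x1[OF that], of "Suc j"] by (simp_all add: y_def)
    have y': "((\<lambda>\<tau>. ?x \<tau> ^ Suc j) has_field_derivative of_nat (Suc j) * p * y) (at \<tau>)"
    proof -
      have "?x \<tau> ^ Suc j = exp (of_nat (Suc j) * (p * \<tau>))" for \<tau>
        by (simp only: exp_of_nat_mult)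
      then show ?thesis unfolding y_def
        by (auto intro!: derivative_eq_intros simp del: of_nat_Suc)
    qed
    have "((\<lambda>\<tau>. (1 - ?x \<tau> ^ Suc j) / (1 + ?x \<tau> ^ Suc j)) has_field_derivative
      ((0 - of_nat (Suc j) * p * y) * (1 + y) - (1 - y) * (0 + of_nat (Suc j) * p * y)) / ((1 + y) * (1 + y))) (at \<tau>)"
      unfolding y_def by (intro DERIV_divide DERIV_diff DERIV_add DERIV_const y'[unfolded y_def]) (use nz in \<open>simp add: y_def\<close>)
    moreover have "((0 - N * p * y) * (1 + y) - (1 - y) * (0 + N * p * y)) / ((1 + y) * (1 + y))
       = (1 - y) / (1 + y) * (p * (- 2 * (N * y / ((1 - y) * (1 + y)))))" for N
      using nz by (simp add: divide_simps) (simp add: algebra_simps)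
    moreover have "?x \<tau> ^ (2 * Suc j) = y ^ 2" unfolding y_def by (simp only: power_mult mult.commute)
    then have "1 - ?x \<tau> ^ (2 * Suc j) = (1 - y) * (1 + y)"
      by (simp add: power2_eq_square algebra_simps)
    ultimately show ?thesis by (simp only: y_def)
  qed
  have D: "((\<lambda>\<tau>. gauss_prod (?x \<tau>) n) has_field_derivative gauss_prod (?x \<tau>) n * (p * (\<Sum>j<n. ?L \<tau> j))) (at \<tau>)"
    if "Im \<tau> > 0" for \<tau> n
  proof (induction n)
    case (Suc n)
    have e: "gauss_prod (?x \<tau>) (Suc n) = gauss_prod (?x \<tau>) n * ((1 - ?x \<tau> ^ Suc n) / (1 + ?x \<tau> ^ Suc n))" for \<tau>
      by (simp add: gauss_prod_def)
    show ?case unfolding e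
      by (rule back_subst[of "\<lambda>x. (_ has_field_derivative x) _", OF DERIV_mult[OF Suc.IH fac[OF that, of n]]])
         (simp only: sum.lessThan_Suc distrib_left mult_ac)
  qed (simp add: gauss_prod_def)
  have "\<exists>g'. \<forall>\<tau>\<in>upper. (theta4 has_field_derivative g' \<tau>) (at \<tau>)
      \<and> (\<lambda>n. gauss_prod (?x \<tau>) n * (p * (\<Sum>j<n. ?L \<tau> j))) \<longlonglongrightarrow> g' \<tau>"
  proof (rule has_complex_derivative_uniform_sequence[OF open_upper D])
    fix \<tau> assume \<tau>: "\<tau> \<in> upper"
    have sub: "cball \<tau> (Im \<tau> / 2) \<subseteq> {z. Im z \<ge> Im \<tau> / 2}"
    proof
      fix z assume "z \<in> cball \<tau> (Im \<tau> / 2)"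
      then have "\<bar>Im (\<tau> - z)\<bar> \<le> Im \<tau> / 2"
        using abs_Im_le_cmod[of "\<tau> - z"] by (simp add: dist_norm)
      then have "Im \<tau> / 2 \<le> Im z" by (simp only: minus_complex.sel)
      then show "z \<in> {z. Im z \<ge> Im \<tau> / 2}" by simp
    qed
    show "\<exists>d>0. cball \<tau> d \<subseteq> upper \<and> uniform_limit (cball \<tau> d) (\<lambda>n \<tau>. gauss_prod (?x \<tau>) n) theta4 sequentially"
    proof (intro exI conjI)
      show "Im \<tau> / 2 > 0" using \<tau> by simp
      show "cball \<tau> (Im \<tau> / 2) \<subseteq> upper" using sub \<tau> by auto
      show "uniform_limit (cball \<tau> (Im \<tau> / 2)) (\<lambda>n \<tau>. gauss_prod (?x \<tau>) n) theta4 sequentially"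
        unfolding p_def using \<tau> by (intro uniform_limit_on_subset[OF gauss_prod_uniform_limit sub]) auto
    qed
  qed auto
  then obtain g' where g': "(theta4 has_field_derivative g') (at \<tau>)"
      "(\<lambda>n. gauss_prod (?x \<tau>) n * (p * (\<Sum>j<n. ?L \<tau> j))) \<longlonglongrightarrow> g'"
    using assms by auto
  have G: "(\<lambda>n. gauss_prod (?x \<tau>) n) \<longlonglongrightarrow> theta4 \<tau>"
    using tendsto_uniform_limitI[OF gauss_prod_uniform_limit[OF assms], of \<tau>] by (simp add: p_def)
  have "(\<lambda>n. gauss_prod (?x \<tau>) n * (p * (\<Sum>j<n. ?L \<tau> j)) / gauss_prod (?x \<tau>) n / p) \<longlonglongrightarrow> g' / theta4 \<tau> / p"
    using p theta4_nonzero[OF assms] by (intro tendsto_divide g'(2) G) auto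
  moreover have "g * (p * S) / g / p = S" if "g \<noteq> 0" for g S
    using p that by simp
  note this[OF gauss_prod_nonzero[OF x1[OF assms]]]
  ultimately have "(\<lambda>n. \<Sum>j<n. ?L \<tau> j) \<longlonglongrightarrow> g' / theta4 \<tau> / p" by (simp only:)
  moreover have "g' = deriv theta4 \<tau>" using DERIV_imp_deriv[OF g'(1)] by simp
  ultimately show ?thesis unfolding sums_def p_def by simp
qed

lemma dlog_theta4:
  assumes "Im \<tau> > 0"
  shows "deriv theta4 \<tau> / theta4 \<tau> / (\<i>\<pi>) = theta_dlog \<tau> / 2 - theta2 \<tau> ^ 4 / 4"
proof -
  define p where "p = \<i>\<pi>"
  have p: "p \<noteq> 0" by (simp add: p_def)
  have nz: "theta4 \<tau> \<noteq> 0" by (rule theta4_nonzero[OF assms])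
  have "((\<lambda>\<tau>. theta4 \<tau> ^ 4) has_field_derivative 4 * theta4 \<tau> ^ 3 * deriv theta4 \<tau>) (at \<tau>)"
    by (auto intro!: derivative_eq_intros has_deriv_upper holomorphic_theta4 assms)
  from DERIV_unique[OF this DERIV_theta4_pow4[OF assms]]
  have "4 * theta4 \<tau> ^ 3 * deriv theta4 \<tau> = p * (2 * theta_dlog \<tau> - theta2 \<tau> ^ 4) * theta4 \<tau> ^ 4"
    by (simp only: p_def)
  then have "theta4 \<tau> ^ 3 * (4 * deriv theta4 \<tau>) = theta4 \<tau> ^ 3 * (p * (2 * theta_dlog \<tau> - theta2 \<tau> ^ 4) * theta4 \<tau>)"
    by (simp add: power4_eq_xxxx power3_eq_cube mult_ac)
  then have "4 * deriv theta4 \<tau> = p * (2 * theta_dlog \<tau> - theta2 \<tau> ^ 4) * theta4 \<tau>"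
    using nz by simp
  then have "deriv theta4 \<tau> = p * ((2 * theta_dlog \<tau> - theta2 \<tau> ^ 4) / 4) * theta4 \<tau>"
    by (simp add: field_simps)
  then show ?thesis using nz p unfolding p_def[symmetric] by (simp add: diff_divide_distrib)
qed

text \<open>At 2 tau the variable exp (i pi tau) of the Gauss product becomes
  \<open>nome \<tau>\<close>, and y / (1 - y^2) = y / (1 - y) - y^2 / (1 - y^2) splits its
  logarithmic derivative into two Lambert series.\<close>

lemma lambert_1_double:
  assumes "Im \<tau> > 0"
  shows "- 2 * (lambert 1 \<tau> - lambert 1 (2 * \<tau>)) = theta_dlog (2 * \<tau>) / 2 - theta2 (2 * \<tau>) ^ 4 / 4"
proof -
  let ?q = "nome \<tau>"
  have 2: "Im (2 * \<tau>) > 0" using assms by simp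
  have q2: "nome (2 * \<tau>) = ?q ^ 2"
    by (simp add: nome_def mult_ac flip: exp_of_nat_mult)
  have "(\<lambda>j. - 2 * (of_nat (Suc j) ^ 1 * ?q ^ Suc j / (1 - ?q ^ Suc j) - of_nat (Suc j) ^ 1 * nome (2 * \<tau>) ^ Suc j / (1 - nome (2 * \<tau>) ^ Suc j)))
     sums (- 2 * (lambert 1 \<tau> - lambert 1 (2 * \<tau>)))"
    by (intro sums_mult sums_diff lambert_sums assms 2)
  moreover have "- 2 * (of_nat (Suc j) ^ 1 * ?q ^ Suc j / (1 - ?q ^ Suc j) - of_nat (Suc j) ^ 1 * nome (2 * \<tau>) ^ Suc j / (1 - nome (2 * \<tau>) ^ Suc j))
     = - 2 * (of_nat (Suc j) * ?q ^ Suc j / (1 - ?q ^ (2 * Suc j)))" for j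
  proof -
    define y where "y = ?q ^ Suc j"
    have nz: "1 - y \<noteq> 0" "1 + y \<noteq> 0"
      using one_pm_power_nonzero[OF norm_nome_less_1[OF assms], of "Suc j"] by (simp_all add: y_def)
    have e: "?q ^ (2 * Suc j) = y ^ 2" "(?q ^ 2) ^ Suc j = y ^ 2"
      unfolding y_def by (simp_all only: power_mult[symmetric] mult.commute)
    have f: "1 - y ^ 2 = (1 - y) * (1 + y)" by (simp add: power2_eq_square algebra_simps)
    have "N ^ 1 * y / (1 - y) - N ^ 1 * y ^ 2 / ((1 - y) * (1 + y)) = N * y / ((1 - y) * (1 + y))" for N
      using nz by (simp add: divide_simps) (simp add: algebra_simps power2_eq_square)
    then show ?thesis unfolding q2 e f y_def[symmetric] by simp
  qed
  ultimately have "(\<lambda>j. - 2 * (of_nat (Suc j) * ?q ^ Suc j / (1 - ?q ^ (2 * Suc j)))) sums (- 2 * (lambert 1 \<tau> - lambert 1 (2 * \<tau>)))"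
    by (simp only:)
  moreover note dlog_theta4_sums[OF 2, unfolded exp_pi_double dlog_theta4[OF 2]]
  ultimately show ?thesis by (rule sums_unique2)
qed

text \<open>Passing from 2 tau to tau adds 6 u(2 tau) - 3 theta2(2 tau)^4 to either side, so the
  difference \<open>C\<close> is invariant under doubling; at the cusp both sides tend to 1.\<close>

lemma E2_theta:
  assumes "Im \<tau> > 0"
  shows "E2 \<tau> = 6 * theta_dlog \<tau> + theta4 \<tau> ^ 4 - theta2 \<tau> ^ 4"
proof -
  define C where "C \<tau> = E2 \<tau> - (6 * theta_dlog \<tau> + theta4 \<tau> ^ 4 - theta2 \<tau> ^ 4)" for \<tau>
  have "C \<tau> = 1 - 24 * 0 - (6 * 0 + 1 ^ 4 - 0)"
  proof (rule doubling_invariant[OF _ _ assms])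
    show "(C \<longlongrightarrow> 1 - 24 * 0 - (6 * 0 + 1 ^ 4 - 0)) cusp"
      unfolding C_def[abs_def] E2_lambert
      using theta_dlog_decay[of 0] theta2_pow4_decay[of 0]
      by (intro tendsto_intros lambert_tendsto theta4_tendsto) simp_all
  next
    fix \<tau> :: complex assume \<tau>: "Im \<tau> > 0"
    then have 2: "Im (2 * \<tau>) > 0" by simp
    define X Y u where XY: "X = theta3 (2 * \<tau>) ^ 2" "Y = theta2 (2 * \<tau>) ^ 2" "u = theta_dlog (2 * \<tau>)"
    have sq: "x ^ 4 = (x\<^sup>2)\<^sup>2" for x :: complex by (simp flip: power_mult)
    have t: "theta4 \<tau> ^ 4 = (X - Y)\<^sup>2" "theta2 \<tau> ^ 4 = 4 * X * Y" "theta2 (2 * \<tau>) ^ 4 = Y\<^sup>2" "theta4 (2 * \<tau>) ^ 4 = X\<^sup>2 - Y\<^sup>2"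
    proof -
      show "theta4 \<tau> ^ 4 = (X - Y)\<^sup>2" unfolding sq theta4_double[OF \<tau>] XY ..
      show "theta2 \<tau> ^ 4 = 4 * X * Y"
        unfolding sq theta2_double[OF \<tau>] XY by (simp add: power_mult_distrib)
      show t2: "theta2 (2 * \<tau>) ^ 4 = Y\<^sup>2" unfolding sq XY ..
      show "theta4 (2 * \<tau>) ^ 4 = X\<^sup>2 - Y\<^sup>2"
        using jacobi_identity[OF 2] unfolding t2 unfolding sq[of "theta3 _"] XY by (simp add: algebra_simps)
    qed
    have l: "lambert 1 \<tau> = lambert 1 (2 * \<tau>) - (u / 4 - Y\<^sup>2 / 8)"
      using lambert_1_double[OF \<tau>] unfolding t XY(3)[symmetric] by (simp add: field_simps)
    have "theta_dlog \<tau> = 2 * u + Y * (X - Y)"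
      unfolding theta_dlog_double[OF \<tau>] XY ..
    note td = this
    show "C (2 * \<tau>) = C \<tau>"
      unfolding C_def E2_lambert l t XY(3)[symmetric] td by (simp add: power2_eq_square field_simps)
  qed
  then show ?thesis by (simp add: C_def)
qed

section \<open>Ramanujan's differential equations\<close>

definition lam :: "complex \<Rightarrow> nat \<Rightarrow> complex" where
  "lam q n = q ^ n / (1 - q ^ n)"

text \<open>Up to constants y / (1 - y) is a cotangent of log y; this is the addition formula of the
  cotangent.\<close>

lemma lam_mult:
  assumes "norm q < 1" "m \<ge> 1" "n \<ge> 1"
  shows "lam q m * lam q n = lam q (m + n) * (1 + lam q m + lam q n)"
proof -
  define x y where "x = q ^ m" and "y = q ^ n"
  have "1 - x \<noteq> 0" "1 - y \<noteq> 0" "1 - x * y \<noteq> 0"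
    using one_pm_power_nonzero[OF assms(1), of m] one_pm_power_nonzero[OF assms(1), of n]
      one_pm_power_nonzero[OF assms(1), of "m + n"] assms by (simp_all add: x_def y_def power_add)
  then have "x / (1 - x) * (y / (1 - y)) = x * y / (1 - x * y) * (1 + x / (1 - x) + y / (1 - y))"
    by (simp add: divide_simps) (simp add: algebra_simps)
  then show ?thesis by (simp only: lam_def x_def y_def power_add)
qed

lemma norm_lam:
  assumes "norm q < 1" "n \<ge> 1"
  shows "norm (lam q n) \<le> 1 / (1 - norm q) * norm q ^ n"
  using norm_lambert_term[OF order.refl assms(1), of "n - 1" 0] assms(2) by (simp add: lam_def)

lemma summable_on_ge_1_iff:
  "(f :: nat \<Rightarrow> 'a :: {comm_monoid_add, topological_space}) summable_on {1..} \<longleftrightarrow> (\<lambda>n. f (Suc n)) summable_on UNIV"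
  by (rule summable_on_reindex_bij_witness[where i = Suc and j = "\<lambda>n. n - 1"]) auto

lemma infsum_ge_1:
  "infsum (f :: nat \<Rightarrow> 'a :: {comm_monoid_add, t2_space}) {1..} = infsum (\<lambda>n. f (Suc n)) UNIV"
  by (rule infsum_reindex_bij_witness[where i = Suc and j = "\<lambda>n. n - 1"]) auto

lemma summable_lam:
  assumes "norm q < 1"
  shows "(\<lambda>n. of_nat n ^ k * lam q n) summable_on {1..}"
  unfolding summable_on_ge_1_iff
  by (intro norm_summable_imp_summable_on) (use summable_lambert[OF assms, of k] in \<open>simp add: lam_def\<close>)

lemma infsum_lam:
  assumes "Im \<tau> > 0"
  shows "(\<Sum>\<^sub>\<infinity>n\<in>{1..}. of_nat n ^ k * lam (nome \<tau>) n) = lambert k \<tau>"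
proof -
  have "((\<lambda>n. of_nat (Suc n) ^ k * nome \<tau> ^ Suc n / (1 - nome \<tau> ^ Suc n)) has_sum lambert k \<tau>) UNIV"
    by (intro norm_summable_imp_has_sum summable_lambert norm_nome_less_1 lambert_sums assms)
  then show ?thesis
    unfolding infsum_ge_1 lam_def by (intro infsumI) simp
qed

lemma infsum_diff:
  fixes f g :: "'a \<Rightarrow> complex"
  assumes "f summable_on A" "g summable_on A"
  shows "(\<Sum>\<^sub>\<infinity>x\<in>A. f x - g x) = infsum f A - infsum g A" and summable_on_diff: "(\<lambda>x. f x - g x) summable_on A"
  using infsum_add[of f A "\<lambda>x. - g x"] summable_on_add[of f A "\<lambda>x. - g x"] assms
  by (simp_all add: infsum_uminus summable_on_uminus)

lemma infsum_pairs_by_sum: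
  fixes h :: "nat \<times> nat \<Rightarrow> complex"
  assumes "h summable_on {1..} \<times> {1..}"
  shows "infsum h ({1..} \<times> {1..}) = (\<Sum>\<^sub>\<infinity>n\<in>{1..}. \<Sum>a\<in>{1..<n}. h (a, n - a))"
    and "(\<lambda>n. \<Sum>a\<in>{1..<n}. h (a, n - a)) summable_on {1..}"
proof -
  have s: "(\<lambda>(n, a). h (a, n - a)) summable_on (SIGMA n:{1..}. {1..<n}) \<longleftrightarrow> h summable_on {1..} \<times> {1..}"
    by (rule summable_on_reindex_bij_witness[where i = "\<lambda>(a, b). (a + b, a)" and j = "\<lambda>(n, a). (a, n - a)"]) auto
  have "infsum h ({1..} \<times> {1..}) = infsum (\<lambda>(n, a). h (a, n - a)) (SIGMA n:{1..}. {1..<n})"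
    by (rule infsum_reindex_bij_witness[where j = "\<lambda>(a, b). (a + b, a)" and i = "\<lambda>(n, a). (a, n - a)"]) auto
  also have "\<dots> = (\<Sum>\<^sub>\<infinity>n\<in>{1..}. \<Sum>\<^sub>\<infinity>a\<in>{1..<n}. h (a, n - a))"
    by (rule infsum_Sigma'_banach[symmetric]) (use assms s in auto)
  finally show "infsum h ({1..} \<times> {1..}) = (\<Sum>\<^sub>\<infinity>n\<in>{1..}. \<Sum>a\<in>{1..<n}. h (a, n - a))" by simp
  have "(\<lambda>n. \<Sum>\<^sub>\<infinity>a\<in>{1..<n}. h (a, n - a)) summable_on {1..}"
    by (rule summable_on_Sigma_banach) (use assms s in auto)
  then show "(\<lambda>n. \<Sum>a\<in>{1..<n}. h (a, n - a)) summable_on {1..}" by simp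
qed

lemma infsum_pairs_diagonal_split:
  fixes h :: "nat \<times> nat \<Rightarrow> complex"
  assumes s: "h summable_on {1..} \<times> {1..}" and sym: "\<And>a b. h (a, b) = h (b, a)" and diag: "\<And>a. h (a, a) = 0"
  shows "infsum h ({1..} \<times> {1..}) = 2 * (\<Sum>\<^sub>\<infinity>(d, b)\<in>{1..} \<times> {1..}. h (b + d, b))"
proof -
  let ?U = "{(a, b). 1 \<le> b \<and> b < (a :: nat)}" and ?L = "{(a, b). 1 \<le> a \<and> a < (b :: nat)}"
  have U: "(\<Sum>\<^sub>\<infinity>(d, b)\<in>{1..} \<times> {1..}. h (b + d, b)) = infsum h ?U"
    by (rule infsum_reindex_bij_witness[where j = "\<lambda>(d, b). (b + d, b)" and i = "\<lambda>(a, b). (a - b, b)"]) auto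
  have L: "infsum h ?L = infsum h ?U"
    by (rule infsum_reindex_bij_witness[where i = "\<lambda>(a, b). (b, a)" and j = "\<lambda>(a, b). (b, a)"]) (auto intro: sym)
  have "infsum h ({1..} \<times> {1..}) = infsum h (?U \<union> ?L)"
    by (rule infsum_cong_neutral) (use diag in \<open>auto simp: not_less le_eq_less_or_eq\<close>)
  also have "\<dots> = infsum h ?U + infsum h ?L"
    by (intro infsum_Un_disjoint summable_on_subset_banach[OF s]) auto
  finally show ?thesis unfolding U L mult_2 .
qed

text \<open>
  A Liouville type identity; it rests on \<open>lam_mult\<close>, which makes the inner sum over b telescope.
\<close>

lemma liouville_lam:
  assumes q: "norm q < 1" and p: "even p" "p > 0"
  shows "(\<Sum>\<^sub>\<infinity>(a, b)\<in>{1..} \<times> {1..}. ((of_nat a - of_nat b) ^ p - (of_nat a + of_nat b) ^ p) * (lam q a * lam q b))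
    = (\<Sum>\<^sub>\<infinity>n\<in>{1..}. 2 * (of_nat n ^ p * lam q n ^ 2) - 2 * ((\<Sum>d\<in>{1..<n}. of_nat d ^ p) * lam q n)
        - of_nat (n - 1) * of_nat n ^ p * lam q n)"
proof -
  let ?N = "{1..} :: nat set" and ?u = "lam q"
  let ?plus = "\<lambda>a b. (of_nat a + of_nat b) ^ p * (?u a * ?u b)" and ?minus = "\<lambda>a b. (of_nat a - of_nat b) ^ p * (?u a * ?u b)"
  let ?x = "\<lambda>d b. of_nat d ^ p * (?u b * ?u (b + d))" and ?y = "\<lambda>d b. of_nat d ^ p * ?u (b + d)"
  let ?A = "\<lambda>d. of_nat d ^ p * (\<Sum>\<^sub>\<infinity>b\<in>?N. ?u b * ?u (b + d))" and ?B = "\<lambda>d. of_nat d ^ p * (\<Sum>\<^sub>\<infinity>b\<in>?N. ?u (b + d))"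
  define r where "r = norm q"
  define C where "C = 1 / (1 - r)"
  have r: "0 \<le> r" "r < 1" and C: "C \<ge> 0" using q by (auto simp: r_def C_def)
  have u: "norm (?u n) \<le> C * r ^ n" if "n \<ge> 1" for n
    using norm_lam[OF q that] by (simp add: C_def r_def)
  define M where "M n = complex_of_real (real n ^ p * r ^ n)" for n
  have nM: "norm (M n) = real n ^ p * r ^ n" for n
    unfolding M_def norm_of_real using r(1) by simp
  have M: "M summable_on ?N"
    unfolding summable_on_ge_1_iff
    by (intro norm_summable_imp_summable_on, unfold nM)
       (rule summable_Suc_iff[THEN iffD2, OF summable_power_less_1[OF r]])
  have "(\<lambda>z. norm (case z of (a, b) \<Rightarrow> M a * M b)) summable_on ?N \<times> ?N"
    using summable_on_product_complex[OF M M] summable_on_iff_abs_summable_on_complex by blast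
  then have MM: "(\<lambda>(a, b). norm (M a) * norm (M b)) summable_on ?N \<times> ?N"
    by (simp add: case_prod_unfold norm_mult)
  have dom: "(\<lambda>(a, b). h a b) summable_on ?N \<times> ?N"
    if h: "\<And>a b. 1 \<le> a \<Longrightarrow> 1 \<le> b \<Longrightarrow> norm (h a b) \<le> K * (norm (M a) * norm (M b))" for h :: "nat \<Rightarrow> nat \<Rightarrow> complex" and K
  proof -
    have "(\<lambda>z. K * (case z of (a, b) \<Rightarrow> norm (M a) * norm (M b))) summable_on ?N \<times> ?N"
      by (intro summable_on_cmult_right MM)
    then have "(\<lambda>z. norm (case z of (a, b) \<Rightarrow> h a b)) summable_on ?N \<times> ?N"
      by (rule summable_on_comparison_test) (use h in auto)
    then show ?thesis by (rule abs_summable_summable)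
  qed
  have rM: "r ^ n \<le> norm (M n)" if "n \<ge> 1" for n
    unfolding nM using that r by (simp add: mult_le_cancel_right1)
  \<comment> \<open>Adding (a-1)(b-1) >= 0 and ab >= 1 gives a + b <= 2ab. The weight thus splits
    into a factor in a and one in b, so that products M(a) M(b) dominate all the double
    series.\<close>
  have pq: "(real a + real b) ^ p \<le> 2 ^ p * (real a ^ p * real b ^ p)" if "a \<ge> 1" "b \<ge> 1" for a b
  proof -
    have "(real a - 1) * (real b - 1) + (real a * real b - 1) \<ge> 0"
      using that by (intro add_nonneg_nonneg mult_nonneg_nonneg) (auto simp: mult_ge1_I)
    then have "real a + real b \<le> 2 * (real a * real b)"
      by (simp add: algebra_simps)
    then have "(real a + real b) ^ p \<le> (2 * (real a * real b)) ^ p" by (intro power_mono) auto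
    then show ?thesis by (simp add: power_mult_distrib)
  qed
  have uu: "norm (?u a * ?u b) \<le> C ^ 2 * (r ^ a * r ^ b)" if "a \<ge> 1" "b \<ge> 1" for a b
    using mult_mono[OF u[OF that(1)] u[OF that(2)]] C r by (simp add: norm_mult power2_eq_square mult_ac)
  have both: "norm (c * (?u a * ?u b)) \<le> 2 ^ p * C ^ 2 * (norm (M a) * norm (M b))"
    if "a \<ge> 1" "b \<ge> 1" "norm c \<le> (real a + real b) ^ p" for a b c
  proof -
    have "norm (c * (?u a * ?u b)) \<le> (2 ^ p * (real a ^ p * real b ^ p)) * (C ^ 2 * (r ^ a * r ^ b))"
      unfolding norm_mult[of c] using that pq[OF that(1,2)] uu[OF that(1,2)]
      by (intro mult_mono) (auto intro: order_trans)
    also have "\<dots> = 2 ^ p * C ^ 2 * (norm (M a) * norm (M b))" by (simp add: nM mult_ac)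
    finally show ?thesis .
  qed
  have sP: "(\<lambda>(a, b). ?plus a b) summable_on ?N \<times> ?N"
  proof (rule dom[OF both])
    show "norm ((of_nat a + of_nat b :: complex) ^ p) \<le> (real a + real b) ^ p" for a b
      unfolding norm_power by (intro power_mono) (auto intro: order_trans[OF norm_triangle_ineq])
  qed
  have sM: "(\<lambda>(a, b). ?minus a b) summable_on ?N \<times> ?N"
  proof (rule dom[OF both])
    show "norm ((of_nat a - of_nat b :: complex) ^ p) \<le> (real a + real b) ^ p" for a b
      unfolding norm_power by (intro power_mono) (auto intro: order_trans[OF norm_triangle_ineq4])
  qed
  have s1: "(\<lambda>(d, b). ?y d b) summable_on ?N \<times> ?N"
  proof (rule dom)
    fix d b :: nat assume db: "1 \<le> d" "1 \<le> b"
    have "norm (?y d b) \<le> real d ^ p * (C * r ^ (b + d))"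
      unfolding norm_mult norm_power norm_of_nat using db by (intro mult_left_mono u) auto
    also have "\<dots> = C * (norm (M d) * r ^ b)" by (simp add: nM power_add mult_ac)
    also have "\<dots> \<le> C * (norm (M d) * norm (M b))"
      using C rM[OF db(2)] by (intro mult_left_mono) auto
    finally show "norm (?y d b) \<le> C * (norm (M d) * norm (M b))" .
  qed
  have s2: "(\<lambda>(d, b). ?x d b) summable_on ?N \<times> ?N"
  proof (rule dom)
    fix d b :: nat assume db: "1 \<le> d" "1 \<le> b"
    have "norm (?x d b) \<le> real d ^ p * ((C * r ^ b) * (C * r ^ (b + d)))"
      unfolding norm_mult norm_power norm_of_nat using db C r by (intro mult_left_mono mult_mono u) auto
    also have "\<dots> = C ^ 2 * (norm (M d) * r ^ b) * r ^ b" by (simp add: nM power_add power2_eq_square mult_ac)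
    also have "\<dots> \<le> C ^ 2 * (norm (M d) * norm (M b)) * 1"
      using C rM[OF db(2)] r by (intro mult_mono mult_left_mono power_le_one) auto
    finally show "norm (?x d b) \<le> C ^ 2 * (norm (M d) * norm (M b))" by simp
  qed
  have su: "?u summable_on A" if "A \<subseteq> ?N" for A
    using summable_on_subset_banach[OF summable_lam[OF q, of 0] that] by simp
  have sud: "(\<lambda>b. ?u (b + d)) summable_on ?N" and iud: "infsum (\<lambda>b. ?u (b + d)) ?N = infsum ?u {d + 1..}" for d
  proof -
    have "(\<lambda>b. ?u (b + d)) summable_on ?N \<longleftrightarrow> ?u summable_on {d + 1..}"
      by (rule summable_on_reindex_bij_witness[where j = "\<lambda>b. b + d" and i = "\<lambda>b. b - d"]) auto
    then show "(\<lambda>b. ?u (b + d)) summable_on ?N" using su[of "{d + 1..}"] by auto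
    show "infsum (\<lambda>b. ?u (b + d)) ?N = infsum ?u {d + 1..}"
      by (rule infsum_reindex_bij_witness[where j = "\<lambda>b. b + d" and i = "\<lambda>b. b - d"]) auto
  qed
  have inner: "(\<Sum>\<^sub>\<infinity>b\<in>?N. ?u b * ?u (b + d)) = ?u d * (\<Sum>a\<in>{1..d}. ?u a) - (\<Sum>\<^sub>\<infinity>b\<in>?N. ?u (b + d))" if d: "d \<ge> 1" for d
  proof -
    have "(\<Sum>\<^sub>\<infinity>b\<in>?N. ?u b * ?u (b + d)) = (\<Sum>\<^sub>\<infinity>b\<in>?N. ?u d * (?u b - ?u (b + d)) - ?u (b + d))"
    proof (rule infsum_cong)
      fix b assume "b \<in> ?N"
      then have "?u b * ?u d = ?u (b + d) * (1 + ?u b + ?u d)" using lam_mult[OF q, of b d] d by simp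
      then show "?u b * ?u (b + d) = ?u d * (?u b - ?u (b + d)) - ?u (b + d)" by (simp add: algebra_simps)
    qed
    also have "\<dots> = (\<Sum>\<^sub>\<infinity>b\<in>?N. ?u d * (?u b - ?u (b + d))) - (\<Sum>\<^sub>\<infinity>b\<in>?N. ?u (b + d))"
      by (intro infsum_diff summable_on_cmult_right summable_on_diff su sud) auto
    also have "(\<Sum>\<^sub>\<infinity>b\<in>?N. ?u d * (?u b - ?u (b + d))) = ?u d * (infsum ?u ?N - infsum ?u {d + 1..})"
      unfolding infsum_cmult_right' using infsum_diff[OF su[OF order.refl] sud[of d]] iud by simp
    also have "infsum ?u ?N = (\<Sum>a\<in>{1..d}. ?u a) + infsum ?u {d + 1..}"
    proof -
      have "?N = {1..d} \<union> {d + 1..}" by auto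
      then have "infsum ?u ?N = infsum ?u ({1..d} \<union> {d + 1..})" by simp
      also have "\<dots> = infsum ?u {1..d} + infsum ?u {d + 1..}"
        by (intro infsum_Un_disjoint su) auto
      finally show ?thesis by simp
    qed
    finally show ?thesis by simp
  qed
  let ?G = "\<lambda>n. (\<Sum>d\<in>{1..<n}. of_nat d ^ p) * ?u n"
  have G: "(\<Sum>\<^sub>\<infinity>(d, b)\<in>?N \<times> ?N. ?y d b) = infsum ?G ?N" "?G summable_on ?N"
  proof -
    have e: "(\<Sum>a\<in>{1..<n}. case (a, n - a) of (d, b) \<Rightarrow> ?y d b) = ?G n" for n
      unfolding sum_distrib_right by (intro sum.cong) auto
    show "(\<Sum>\<^sub>\<infinity>(d, b)\<in>?N \<times> ?N. ?y d b) = infsum ?G ?N" "?G summable_on ?N"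
      using infsum_pairs_by_sum[OF s1] unfolding e by simp_all
  qed
  \<comment> \<open>On the line a + b = n, \<open>lam_mult\<close> takes lam n out of the product;
    the two remaining sums over a < n coincide by the symmetry a -> n - a.\<close>
  let ?P = "\<lambda>n. of_nat n ^ p * ?u n * (of_nat (n - 1) + 2 * (\<Sum>a\<in>{1..<n}. ?u a))"
  have P: "(\<Sum>\<^sub>\<infinity>(a, b)\<in>?N \<times> ?N. ?plus a b) = infsum ?P ?N" "?P summable_on ?N"
  proof -
    have e: "(\<Sum>a\<in>{1..<n}. case (a, n - a) of (a, b) \<Rightarrow> ?plus a b) = ?P n" for n
    proof -
      have "(\<Sum>a\<in>{1..<n}. case (a, n - a) of (a, b) \<Rightarrow> ?plus a b)
          = (\<Sum>a\<in>{1..<n}. of_nat n ^ p * ?u n * (1 + ?u a + ?u (n - a)))"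
      proof (rule sum.cong)
        fix a assume a: "a \<in> {1..<n}"
        have "of_nat a + of_nat (n - a) = (of_nat n :: complex)" using a by (simp add: of_nat_diff)
        moreover have "?u a * ?u (n - a) = ?u n * (1 + ?u a + ?u (n - a))"
        proof -
          have "a \<ge> 1" "n - a \<ge> 1" "a + (n - a) = n" using a by auto
          with lam_mult[OF q, of a "n - a"] show ?thesis by (simp only:)
        qed
        ultimately show "(case (a, n - a) of (a, b) \<Rightarrow> ?plus a b) = of_nat n ^ p * ?u n * (1 + ?u a + ?u (n - a))"
          by (simp add: mult.assoc)
      qed simp
      also have "\<dots> = of_nat n ^ p * ?u n * ((\<Sum>a\<in>{1..<n}. 1) + (\<Sum>a\<in>{1..<n}. ?u a) + (\<Sum>a\<in>{1..<n}. ?u (n - a)))"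
        by (simp only: sum_distrib_left[symmetric] sum.distrib)
      also have "(\<Sum>a\<in>{1..<n}. ?u (n - a)) = (\<Sum>a\<in>{1..<n}. ?u a)"
        by (rule sum.reindex_bij_witness[where i = "\<lambda>a. n - a" and j = "\<lambda>a. n - a"]) auto
      finally show ?thesis by simp
    qed
    show "(\<Sum>\<^sub>\<infinity>(a, b)\<in>?N \<times> ?N. ?plus a b) = infsum ?P ?N" "?P summable_on ?N"
      using infsum_pairs_by_sum[OF sP] unfolding e by simp_all
  qed
  let ?R = "\<lambda>d. of_nat d ^ p * (?u d * (\<Sum>a\<in>{1..d}. ?u a))"
  have split: "?A d + ?B d = ?R d" if "d \<in> ?N" for d
  proof -
    have "d \<ge> 1" using that by simp
    then show ?thesis unfolding inner[OF \<open>d \<ge> 1\<close>] right_diff_distrib by (simp only: diff_add_cancel)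
  qed
  have a1: "(\<lambda>d. ?A d) summable_on ?N"
    using summable_on_Sigma_banach[OF s2] by (simp add: infsum_cmult_right')
  have a2: "(\<lambda>d. ?B d) summable_on ?N"
    using summable_on_Sigma_banach[OF s1] by (simp add: infsum_cmult_right')
  have "(\<lambda>d. ?A d + ?B d) summable_on ?N"
    by (intro summable_on_add a1 a2)
  then have sR: "?R summable_on ?N" using split by (subst (asm) summable_on_cong) auto
  have Rsum: "(\<Sum>\<^sub>\<infinity>(d, b)\<in>?N \<times> ?N. ?x d b) + infsum ?G ?N = infsum ?R ?N"
  proof -
    have "(\<Sum>\<^sub>\<infinity>(d, b)\<in>?N \<times> ?N. ?x d b) = (\<Sum>\<^sub>\<infinity>d\<in>?N. ?A d)"
      using infsum_Sigma'_banach[OF s2] by (simp add: infsum_cmult_right')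
    moreover have "infsum ?G ?N = (\<Sum>\<^sub>\<infinity>d\<in>?N. ?B d)"
      unfolding G(1)[symmetric] using infsum_Sigma'_banach[OF s1] by (simp add: infsum_cmult_right')
    moreover have "(\<Sum>\<^sub>\<infinity>d\<in>?N. ?A d) + (\<Sum>\<^sub>\<infinity>d\<in>?N. ?B d) = infsum ?R ?N"
      unfolding infsum_add[OF a1 a2, symmetric] by (rule infsum_cong) (rule split)
    ultimately show ?thesis by (simp only:)
  qed
  \<comment> \<open>The weight (a - b)^p is symmetric because p is even and vanishes on the diagonal
    because p > 0. So the pairs (b + d, b) count twice and carry the weight d^p.\<close>
  have Minus: "(\<Sum>\<^sub>\<infinity>(a, b)\<in>?N \<times> ?N. ?minus a b) = 2 * (infsum ?R ?N - infsum ?G ?N)"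
  proof -
    have "(\<Sum>\<^sub>\<infinity>(a, b)\<in>?N \<times> ?N. ?minus a b)
       = 2 * (\<Sum>\<^sub>\<infinity>(d, b)\<in>?N \<times> ?N. case (b + d, b) of (a, b) \<Rightarrow> ?minus a b)"
    proof (rule infsum_pairs_diagonal_split[OF sM])
      show "(case (a, b) of (a, b) \<Rightarrow> ?minus a b) = (case (b, a) of (a, b) \<Rightarrow> ?minus a b)" for a b
      proof -
        have "(of_nat a - of_nat b :: complex) ^ p = (of_nat b - of_nat a) ^ p"
          using p(1) by (metis minus_diff_eq power_minus_even)
        then show ?thesis by (simp add: mult_ac)
      qed
      show "(case (a, a) of (a, b) \<Rightarrow> ?minus a b) = 0" for a
        using p(2) by simp
    qed
    also have "(\<Sum>\<^sub>\<infinity>(d, b)\<in>?N \<times> ?N. case (b + d, b) of (a, b) \<Rightarrow> ?minus a b)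
       = (\<Sum>\<^sub>\<infinity>(d, b)\<in>?N \<times> ?N. ?x d b)"
      by (rule infsum_cong) (auto simp: mult_ac)
    also have "\<dots> = infsum ?R ?N - infsum ?G ?N" using Rsum by (simp add: eq_diff_eq)
    finally show ?thesis .
  qed
  let ?T = "\<lambda>n. 2 * (of_nat n ^ p * ?u n ^ 2) - 2 * ?G n - of_nat (n - 1) * of_nat n ^ p * ?u n"
  \<comment> \<open>The sum in \<open>?R\<close> runs up to n, the one in \<open>?P\<close> only up
    to n - 1: the common part cancels and the term a = n leaves the square of lam n.\<close>
  have T: "?T n = 2 * (?R n - ?G n) - ?P n" if "n \<in> ?N" for n
  proof -
    have "{1..n} = insert n {1..<n}" using that by auto
    then have "(\<Sum>a\<in>{1..n}. ?u a) = ?u n + (\<Sum>a\<in>{1..<n}. ?u a)" by simp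
    then show ?thesis by (simp add: power2_eq_square algebra_simps)
  qed
  have "(\<Sum>\<^sub>\<infinity>(a, b)\<in>?N \<times> ?N. ((of_nat a - of_nat b) ^ p - (of_nat a + of_nat b) ^ p) * (?u a * ?u b))
     = (\<Sum>\<^sub>\<infinity>z\<in>?N \<times> ?N. (case z of (a, b) \<Rightarrow> ?minus a b) - (case z of (a, b) \<Rightarrow> ?plus a b))"
    by (rule infsum_cong) (auto simp: left_diff_distrib)
  also have "\<dots> = 2 * (infsum ?R ?N - infsum ?G ?N) - infsum ?P ?N"
    unfolding infsum_diff[OF sM sP] Minus P(1) ..
  also have "\<dots> = (\<Sum>\<^sub>\<infinity>n\<in>?N. 2 * (?R n - ?G n) - ?P n)"
    by (subst infsum_diff[OF summable_on_cmult_right[OF summable_on_diff[OF sR G(2)]] P(2)])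
       (simp only: infsum_cmult_right' infsum_diff[OF sR G(2)])
  also have "\<dots> = infsum ?T ?N" by (rule infsum_cong) (rule T[symmetric])
  finally show "(\<Sum>\<^sub>\<infinity>(a, b)\<in>?N \<times> ?N. ((of_nat a - of_nat b) ^ p - (of_nat a + of_nat b) ^ p) * (?u a * ?u b)) = infsum ?T ?N" .
qed

lemma summable_lam_sq:
  assumes q: "norm q < 1"
  shows "(\<lambda>n. of_nat n ^ k * lam q n ^ 2) summable_on {1..}"
proof -
  have "(\<lambda>n. norm (of_nat n ^ k * lam q n)) summable_on {1..}"
    by (rule summable_on_iff_abs_summable_on_complex[THEN iffD1, OF summable_lam[OF q]])
  then have "(\<lambda>n. 1 / (1 - norm q) * norm (of_nat n ^ k * lam q n)) summable_on {1..}"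
    by (rule summable_on_cmult_right)
  then have "(\<lambda>n. norm (of_nat n ^ k * lam q n ^ 2)) summable_on {1..}"
  proof (rule summable_on_comparison_test)
    fix n :: nat assume n: "n \<in> {1..}"
    have "norm (lam q n) \<le> 1 / (1 - norm q) * norm q ^ n" using norm_lam[OF q] n by simp
    also have "\<dots> \<le> 1 / (1 - norm q) * 1" using q by (intro mult_left_mono power_le_one) auto
    finally have "norm (of_nat n ^ k * lam q n) * norm (lam q n) \<le> norm (of_nat n ^ k * lam q n) * (1 / (1 - norm q))"
      by (intro mult_left_mono) auto
    then show "norm (of_nat n ^ k * lam q n ^ 2) \<le> 1 / (1 - norm q) * norm (of_nat n ^ k * lam q n)"
      by (simp add: norm_mult norm_power power2_eq_square mult_ac)
  qed auto
  then show ?thesis by (rule abs_summable_summable)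
qed

text \<open>Applying y d/dy to y / (1 - y) gives y / (1 - y) plus its square; the derivative of a
  Lambert series therefore also produces this series of squares.\<close>

definition lambert_sq :: "nat \<Rightarrow> complex \<Rightarrow> complex" where
  "lambert_sq k \<tau> = (\<Sum>\<^sub>\<infinity>n\<in>{1..}. of_nat n ^ k * lam (nome \<tau>) n ^ 2)"

lemma has_sum_lam:
  assumes "Im \<tau> > 0"
  shows "((\<lambda>n. of_nat n ^ k * lam (nome \<tau>) n) has_sum lambert k \<tau>) {1..}"
  using has_sum_infsum[OF summable_lam[OF norm_nome_less_1[OF assms], of k]] unfolding infsum_lam[OF assms] .

lemma has_sum_lam_sq:
  assumes "Im \<tau> > 0"
  shows "((\<lambda>n. of_nat n ^ k * lam (nome \<tau>) n ^ 2) has_sum lambert_sq k \<tau>) {1..}"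
  unfolding lambert_sq_def by (intro has_sum_infsum summable_lam_sq norm_nome_less_1 assms)

lemma DERIV_lambert:
  assumes "Im \<tau> > 0"
  shows "(lambert k has_field_derivative 2 * of_real pi * \<i> * (lambert (Suc k) \<tau> + lambert_sq (Suc k) \<tau>)) (at \<tau>)"
proof -
  define p where "p = 2 * complex_of_real pi * \<i>"
  let ?f = "\<lambda>n \<tau>. of_nat (Suc n) ^ k * nome \<tau> ^ Suc n / (1 - nome \<tau> ^ Suc n)"
  let ?f' = "\<lambda>n \<tau>. p * (of_nat (Suc n) ^ Suc k * lam (nome \<tau>) (Suc n) + of_nat (Suc n) ^ Suc k * lam (nome \<tau>) (Suc n) ^ 2)"
  have "\<exists>g g'. \<forall>\<tau>\<in>upper. (\<lambda>n. ?f n \<tau>) sums g \<tau> \<and> (\<lambda>n. ?f' n \<tau>) sums g' \<tau> \<and> (g has_field_derivative g' \<tau>) (at \<tau>)"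
  proof (rule series_and_derivative_comparison_local[OF open_upper])
    fix n \<tau> assume "\<tau> \<in> upper"
    then have \<tau>: "Im \<tau> > 0" by simp
    define y where "y = nome \<tau> ^ Suc n"
    have nz: "1 - y \<noteq> 0"
      using one_pm_power_nonzero(1)[OF norm_nome_less_1[OF \<tau>], of "Suc n"] by (simp add: y_def)
    have y': "((\<lambda>\<tau>. nome \<tau> ^ Suc n) has_field_derivative of_nat (Suc n) * p * y) (at \<tau>)"
    proof -
      have "nome \<tau> ^ Suc n = exp (of_nat (Suc n) * (p * \<tau>))" for \<tau>
        by (simp only: exp_of_nat_mult nome_def p_def)
      then show ?thesis unfolding y_def
        by (auto intro!: derivative_eq_intros simp del: of_nat_Suc)
    qed
    have "(?f n has_field_derivative
       (of_nat (Suc n) ^ k * (of_nat (Suc n) * p * y) * (1 - y) - of_nat (Suc n) ^ k * y * (0 - of_nat (Suc n) * p * y)) / ((1 - y) * (1 - y))) (at \<tau>)"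
      unfolding y_def by (intro DERIV_divide DERIV_diff DERIV_const DERIV_cmult y'[unfolded y_def]) (use nz in \<open>simp add: y_def\<close>)
    moreover have "(N ^ k * (N * p * y) * (1 - y) - N ^ k * y * (0 - N * p * y)) / ((1 - y) * (1 - y))
       = p * (N ^ Suc k * (y / (1 - y)) + N ^ Suc k * (y / (1 - y)) ^ 2)" for N
      using nz by (simp add: divide_simps power2_eq_square) (simp add: algebra_simps)
    ultimately show "(?f n has_field_derivative ?f' n \<tau>) (at \<tau>)"
      by (simp only: lam_def y_def)
  next
    fix \<tau> assume \<tau>: "\<tau> \<in> upper"
    define r where "r = exp (- (pi * Im \<tau>))"
    have r: "0 \<le> r" "r < 1" using \<tau> by (auto simp: r_def)
    have "norm (?f n y) \<le> (real (Suc n) ^ k * r ^ Suc n) / (1 - r)" if "y \<in> ball \<tau> (Im \<tau> / 2) \<inter> upper" for n y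
    proof (rule norm_lambert_term[OF _ r(2)])
      have "\<bar>Im (\<tau> - y)\<bar> < Im \<tau> / 2"
        using abs_Im_le_cmod[of "\<tau> - y"] that by (simp add: dist_norm)
      then have "Im \<tau> \<le> 2 * Im y" by (simp only: minus_complex.sel)
      then have "pi * Im \<tau> \<le> pi * (2 * Im y)" by (intro mult_left_mono) auto
      then show "norm (nome y) \<le> r" by (simp add: norm_nome r_def)
    qed
    then show "\<exists>d h. 0 < d \<and> summable h \<and> (\<forall>\<^sub>F n in sequentially. \<forall>y\<in>ball \<tau> d \<inter> upper. norm (?f n y) \<le> h n)"
      using \<tau> summable_lambert_majorant[OF r, of k]
      by (intro exI[of _ "Im \<tau> / 2"] exI[of _ "\<lambda>n. (real (Suc n) ^ k * r ^ Suc n) / (1 - r)"]) auto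
  qed
  then obtain g g' where g: "\<And>\<tau>. Im \<tau> > 0 \<Longrightarrow> (\<lambda>n. ?f n \<tau>) sums g \<tau>" "\<And>\<tau>. Im \<tau> > 0 \<Longrightarrow> (\<lambda>n. ?f' n \<tau>) sums g' \<tau>"
     "\<And>\<tau>. Im \<tau> > 0 \<Longrightarrow> (g has_field_derivative g' \<tau>) (at \<tau>)"
    by auto
  have "(lambert k has_field_derivative g' \<tau>) (at \<tau>)"
    by (rule has_field_derivative_transform_within_open[OF g(3)[OF assms] open_upper])
       (use assms g(1) lambert_sums sums_unique2 in blast)+
  moreover have "((\<lambda>n. p * (of_nat n ^ Suc k * lam (nome \<tau>) n + of_nat n ^ Suc k * lam (nome \<tau>) n ^ 2)) has_sum p * (lambert (Suc k) \<tau> + lambert_sq (Suc k) \<tau>)) {1..}"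
    by (intro has_sum_cmult_right has_sum_add has_sum_lam has_sum_lam_sq assms)
  then have "((\<lambda>n. ?f' n \<tau>) has_sum p * (lambert (Suc k) \<tau> + lambert_sq (Suc k) \<tau>)) UNIV"
    by (subst has_sum_reindex_bij_witness[where S = UNIV and T = "{1..}" and j = Suc and i = "\<lambda>n. n - 1"]) auto
  then have "(\<lambda>n. ?f' n \<tau>) sums (p * (lambert (Suc k) \<tau> + lambert_sq (Suc k) \<tau>))"
    by (rule has_sum_imp_sums)
  with g(2)[OF assms] have "g' \<tau> = p * (lambert (Suc k) \<tau> + lambert_sq (Suc k) \<tau>)"
    by (rule sums_unique2)
  ultimately show ?thesis by (simp only: p_def)
qed

lemma sum_squares_lt: "6 * (\<Sum>d\<in>{1..<Suc n}. of_nat d ^ 2) = (of_nat n * (of_nat n + 1) * (2 * of_nat n + 1) :: complex)"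
  by (induction n) (simp_all add: power2_eq_square algebra_simps)

lemma sum_fourth_powers_lt: "30 * (\<Sum>d\<in>{1..<Suc n}. of_nat d ^ 4) =
    (of_nat n * (of_nat n + 1) * (2 * of_nat n + 1) * (3 * of_nat n ^ 2 + 3 * of_nat n - 1) :: complex)"
  by (induction n) (simp_all add: power2_eq_square power4_eq_xxxx algebra_simps)

text \<open>\<open>liouville_lam\<close> with p = 2: since (a-b)^2 - (a+b)^2 = - 4ab, the double
  series is a product of two Lambert series. On the other side - 2 times the sum of d^2 over d < n,
  minus (n-1) n^2, is - 5/3 n^3 + 2 n^2 - n/3.\<close>

lemma lambert_sq_2:
  assumes "Im \<tau> > 0"
  shows "lambert_sq 2 \<tau> + lambert 2 \<tau> = - 2 * lambert 1 \<tau> ^ 2 + 5 / 6 * lambert 3 \<tau> + lambert 1 \<tau> / 6"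
proof -
  let ?q = "nome \<tau>"
  let ?v = "\<lambda>k n. of_nat n ^ k * lam ?q n" and ?w = "\<lambda>n. of_nat n ^ 2 * lam ?q n ^ 2"
  let ?S = "2 * lambert_sq 2 \<tau> + (- 5 / 3) * lambert 3 \<tau> + 2 * lambert 2 \<tau> + (- 1 / 3) * lambert 1 \<tau>"
  note q = norm_nome_less_1[OF assms]
  have "(\<Sum>\<^sub>\<infinity>(a, b)\<in>{1..} \<times> {1..}. ((of_nat a - of_nat b) ^ 2 - (of_nat a + of_nat b) ^ 2) * (lam ?q a * lam ?q b))
      = (\<Sum>\<^sub>\<infinity>z\<in>{1..} \<times> {1..}. - 4 * (case z of (a, b) \<Rightarrow> (of_nat a ^ 1 * lam ?q a) * (of_nat b ^ 1 * lam ?q b)))"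
    by (rule infsum_cong) (auto simp: power2_eq_square algebra_simps)
  also have "\<dots> = - 4 * (lambert 1 \<tau> * lambert 1 \<tau>)"
    unfolding infsum_cmult_right' infsum_product_complex[OF summable_lam[OF q] summable_lam[OF q]] infsum_lam[OF assms] ..
  finally have L: "(\<Sum>\<^sub>\<infinity>n\<in>{1..}. 2 * ?w n - 2 * ((\<Sum>d\<in>{1..<n}. of_nat d ^ 2) * lam ?q n)
        - of_nat (n - 1) * of_nat n ^ 2 * lam ?q n) = - 4 * (lambert 1 \<tau> * lambert 1 \<tau>)"
    using liouville_lam[OF q, of 2] by simp
  have e: "2 * ?w n - 2 * ((\<Sum>d\<in>{1..<n}. of_nat d ^ 2) * lam ?q n) - of_nat (n - 1) * of_nat n ^ 2 * lam ?q n
    = 2 * ?w n + (- 5 / 3) * ?v 3 n + 2 * ?v 2 n + (- 1 / 3) * ?v 1 n"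
    if n: "n \<in> {1..}" for n
  proof -
    obtain m where m: "n = Suc m" using n by (cases n) auto
    define N where "N = (of_nat n :: complex)"
    have N: "of_nat m = N - 1" by (simp add: N_def m)
    have s: "(\<Sum>d\<in>{1..<n}. of_nat d ^ 2) = (N - 1) * N * (2 * N - 1) / 6"
      using sum_squares_lt[of m] unfolding m[symmetric] N by (simp add: field_simps)
    have n1: "of_nat (n - 1) = N - 1" using N m by simp
    show ?thesis unfolding s n1 N_def[symmetric] by (simp add: field_simps power2_eq_square power3_eq_cube)
  qed
  have "((\<lambda>n. 2 * ?w n + (- 5 / 3) * ?v 3 n + 2 * ?v 2 n + (- 1 / 3) * ?v 1 n)
     has_sum ?S) {1..}"
    by (intro has_sum_add has_sum_cmult_right has_sum_lam has_sum_lam_sq assms)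
  from infsumI[OF this] have *: "?S = - 4 * (lambert 1 \<tau> * lambert 1 \<tau>)"
    unfolding L[symmetric] by (simp only: e cong: infsum_cong)
  have "lambert_sq 2 \<tau> + lambert 2 \<tau> = ?S / 2
      + 5 / 6 * lambert 3 \<tau> + lambert 1 \<tau> / 6"
    by (simp add: field_simps)
  then show ?thesis unfolding * by (simp add: power2_eq_square)
qed

text \<open>The same with p = 4: (a-b)^4 - (a+b)^4 = - 8 (a^3 b + a b^3), and the sum of fourth
  powers turns the linear part into - 7/5 n^5 + 2 n^4 - 2/3 n^3 + n/15.\<close>

lemma lambert_sq_4:
  assumes "Im \<tau> > 0"
  shows "lambert_sq 4 \<tau> + lambert 4 \<tau> = - 8 * lambert 1 \<tau> * lambert 3 \<tau> + 7 / 10 * lambert 5 \<tau> + lambert 3 \<tau> / 3 - lambert 1 \<tau> / 30"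
proof -
  let ?q = "nome \<tau>"
  let ?v = "\<lambda>k n. of_nat n ^ k * lam ?q n" and ?w = "\<lambda>n. of_nat n ^ 4 * lam ?q n ^ 2"
  let ?S = "2 * lambert_sq 4 \<tau> + (- 7 / 5) * lambert 5 \<tau> + 2 * lambert 4 \<tau> + (- 2 / 3) * lambert 3 \<tau> + 1 / 15 * lambert 1 \<tau>"
  note q = norm_nome_less_1[OF assms]
  let ?h = "\<lambda>i j z. (case z of (a, b) \<Rightarrow> (of_nat a ^ i * lam ?q a) * (of_nat b ^ j * lam ?q b))"
  have s: "?h i j summable_on {1..} \<times> {1..}" for i j
    by (rule summable_on_product_complex[OF summable_lam[OF q] summable_lam[OF q]])
  have v: "infsum (?h i j) ({1..} \<times> {1..}) = lambert i \<tau> * lambert j \<tau>" for i j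
    unfolding infsum_product_complex[OF summable_lam[OF q] summable_lam[OF q]] infsum_lam[OF assms] ..
  have "(\<Sum>\<^sub>\<infinity>(a, b)\<in>{1..} \<times> {1..}. ((of_nat a - of_nat b) ^ 4 - (of_nat a + of_nat b) ^ 4) * (lam ?q a * lam ?q b))
      = (\<Sum>\<^sub>\<infinity>z\<in>{1..} \<times> {1..}. - 8 * (?h 3 1 z + ?h 1 3 z))"
    by (rule infsum_cong) (auto simp: power4_eq_xxxx power3_eq_cube algebra_simps)
  also have "\<dots> = - 8 * (lambert 3 \<tau> * lambert 1 \<tau> + lambert 1 \<tau> * lambert 3 \<tau>)"
    unfolding infsum_cmult_right' infsum_add[OF s s] v ..
  finally have L: "(\<Sum>\<^sub>\<infinity>n\<in>{1..}. 2 * ?w n - 2 * ((\<Sum>d\<in>{1..<n}. of_nat d ^ 4) * lam ?q n)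
        - of_nat (n - 1) * of_nat n ^ 4 * lam ?q n) = - 8 * (lambert 3 \<tau> * lambert 1 \<tau> + lambert 1 \<tau> * lambert 3 \<tau>)"
    using liouville_lam[OF q, of 4] by simp
  have e: "2 * ?w n - 2 * ((\<Sum>d\<in>{1..<n}. of_nat d ^ 4) * lam ?q n) - of_nat (n - 1) * of_nat n ^ 4 * lam ?q n
    = 2 * ?w n + (- 7 / 5) * ?v 5 n + 2 * ?v 4 n
      + (- 2 / 3) * ?v 3 n + 1 / 15 * ?v 1 n"
    if n: "n \<in> {1..}" for n
  proof -
    obtain m where m: "n = Suc m" using n by (cases n) auto
    define N where "N = (of_nat n :: complex)"
    have N: "of_nat m = N - 1" by (simp add: N_def m)
    have s: "(\<Sum>d\<in>{1..<n}. of_nat d ^ 4) = (N - 1) * N * (2 * N - 1) * (3 * (N - 1) ^ 2 + 3 * (N - 1) - 1) / 30"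
      using sum_fourth_powers_lt[of m] unfolding m[symmetric] N by (simp add: field_simps)
    have n1: "of_nat (n - 1) = N - 1" using N m by simp
    have N5: "N ^ 5 = N * N * N * N * N" by (simp add: numeral_eq_Suc)
    show ?thesis unfolding s n1 N_def[symmetric] N5
      by (simp add: field_simps power2_eq_square power3_eq_cube power4_eq_xxxx)
  qed
  have "((\<lambda>n. 2 * ?w n + (- 7 / 5) * ?v 5 n + 2 * ?v 4 n
      + (- 2 / 3) * ?v 3 n + 1 / 15 * ?v 1 n)
     has_sum ?S) {1..}"
    by (intro has_sum_add has_sum_cmult_right has_sum_lam has_sum_lam_sq assms)
  from infsumI[OF this] have *: "?S
      = - 8 * (lambert 3 \<tau> * lambert 1 \<tau> + lambert 1 \<tau> * lambert 3 \<tau>)"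
    unfolding L[symmetric] by (simp only: e cong: infsum_cong)
  have "lambert_sq 4 \<tau> + lambert 4 \<tau> = ?S / 2
      + 7 / 10 * lambert 5 \<tau> + lambert 3 \<tau> / 3 - lambert 1 \<tau> / 30"
    by (simp add: field_simps)
  then show ?thesis unfolding * by simp
qed

text \<open>Here D is twice q d/dq, so Ramanujan's denominator 12 appears as 6.\<close>

lemma DERIV_E2:
  assumes "Im \<tau> > 0"
  shows "(E2 has_field_derivative \<i>\<pi> * ((E2 \<tau> ^ 2 - E4 \<tau>) / 6)) (at \<tau>)"
proof -
  define p where "p = \<i>\<pi>"
  have "((\<lambda>\<tau>. 1 - 24 * lambert 1 \<tau>) has_field_derivative 0 - 24 * (2 * of_real pi * \<i> * (lambert 2 \<tau> + lambert_sq 2 \<tau>))) (at \<tau>)"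
    using DERIV_lambert[OF assms, of 1] by (intro DERIV_diff DERIV_const DERIV_cmult) (simp add: numeral_2_eq_2)
  also have "2 * of_real pi * \<i> * (lambert 2 \<tau> + lambert_sq 2 \<tau>) = 2 * p * (lambert_sq 2 \<tau> + lambert 2 \<tau>)"
    by (simp add: p_def)
  also have "0 - 24 * (2 * p * (lambert_sq 2 \<tau> + lambert 2 \<tau>)) = p * ((E2 \<tau> ^ 2 - E4 \<tau>) / 6)"
    unfolding lambert_sq_2[OF assms] E2_lambert E4_lambert by (simp add: field_simps power2_eq_square)
  finally show ?thesis unfolding p_def E2_lambert[abs_def] .
qed

lemma DERIV_E4:
  assumes "Im \<tau> > 0"
  shows "(E4 has_field_derivative \<i>\<pi> * (2 * (E2 \<tau> * E4 \<tau> - E6 \<tau>) / 3)) (at \<tau>)"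
proof -
  define p where "p = \<i>\<pi>"
  have "((\<lambda>\<tau>. 1 + 240 * lambert 3 \<tau>) has_field_derivative 0 + 240 * (2 * of_real pi * \<i> * (lambert 4 \<tau> + lambert_sq 4 \<tau>))) (at \<tau>)"
    using DERIV_lambert[OF assms, of 3] by (intro DERIV_add DERIV_const DERIV_cmult) (simp add: numeral_eq_Suc)
  also have "2 * of_real pi * \<i> * (lambert 4 \<tau> + lambert_sq 4 \<tau>) = 2 * p * (lambert_sq 4 \<tau> + lambert 4 \<tau>)"
    by (simp add: p_def)
  also have "0 + 240 * (2 * p * (lambert_sq 4 \<tau> + lambert 4 \<tau>)) = p * (2 * (E2 \<tau> * E4 \<tau> - E6 \<tau>) / 3)"
    unfolding lambert_sq_4[OF assms] E2_lambert E4_lambert E6_lambert by (simp add: field_simps)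
  finally show ?thesis unfolding p_def E4_lambert[abs_def] .
qed

text \<open>Ramanujan's equation read as E4 = E2^2 - 6 D E2. Inserting \<open>E2_theta\<close> and
  the derivatives of the theta constants, all terms with u cancel.\<close>

lemma E4_theta:
  assumes "Im \<tau> > 0"
  shows "E4 \<tau> = theta2 \<tau> ^ 8 + theta2 \<tau> ^ 4 * theta4 \<tau> ^ 4 + theta4 \<tau> ^ 8"
proof -
  define p where "p = \<i>\<pi>"
  have p: "p \<noteq> 0" by (simp add: p_def)
  define b c u where "b = theta2 \<tau> ^ 4" and "c = theta4 \<tau> ^ 4" and "u = theta_dlog \<tau>"
  have "((\<lambda>\<tau>. 6 * theta_dlog \<tau> + theta4 \<tau> ^ 4 - theta2 \<tau> ^ 4) has_field_derivative
      6 * (p * (u ^ 2 + b * c / 4)) + p * (2 * u - b) * c - p * (2 * u + c) * b) (at \<tau>)"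
    unfolding p_def b_def c_def u_def deriv_theta_dlog[OF assms, symmetric]
    by (intro DERIV_diff DERIV_add DERIV_cmult DERIV_theta4_pow4 DERIV_theta2_pow4 has_deriv_upper holomorphic_theta_dlog assms)
  from upper_deriv_unique[OF E2_theta assms DERIV_E2[OF assms] this]
  have "p * ((E2 \<tau> ^ 2 - E4 \<tau>) / 6) = p * (6 * (u ^ 2 + b * c / 4) + (2 * u - b) * c - (2 * u + c) * b)"
    by (simp add: p_def algebra_simps)
  then have "(E2 \<tau> ^ 2 - E4 \<tau>) / 6 = 6 * (u ^ 2 + b * c / 4) + (2 * u - b) * c - (2 * u + c) * b"
    using p by simp
  then have "E4 \<tau> = E2 \<tau> ^ 2 - 6 * (6 * (u ^ 2 + b * c / 4) + (2 * u - b) * c - (2 * u + c) * b)"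
    by (simp add: field_simps)
  also have "E2 \<tau> = 6 * u + c - b" by (simp add: E2_theta[OF assms] b_def c_def u_def)
  also have "(6 * u + c - b) ^ 2 - 6 * (6 * (u ^ 2 + b * c / 4) + (2 * u - b) * c - (2 * u + c) * b) = b ^ 2 + b * c + c ^ 2"
    by (simp add: field_simps power2_eq_square)
  finally have "E4 \<tau> = b ^ 2 + b * c + c ^ 2" .
  then show ?thesis by (simp add: b_def c_def flip: power_mult)
qed

text \<open>As for E4, now from E6 = E2 E4 - (3/2) D E4.\<close>

lemma E6_theta:
  assumes "Im \<tau> > 0"
  shows "E6 \<tau> = (theta4 \<tau> ^ 4 - theta2 \<tau> ^ 4) * (2 * theta2 \<tau> ^ 4 + theta4 \<tau> ^ 4) * (theta2 \<tau> ^ 4 + 2 * theta4 \<tau> ^ 4) / 2"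
proof -
  define p where "p = \<i>\<pi>"
  have p: "p \<noteq> 0" by (simp add: p_def)
  define b c u where "b = theta2 \<tau> ^ 4" and "c = theta4 \<tau> ^ 4" and "u = theta_dlog \<tau>"
  have E4: "E4 \<tau> = (theta2 \<tau> ^ 4 * theta2 \<tau> ^ 4 + theta2 \<tau> ^ 4 * theta4 \<tau> ^ 4) + theta4 \<tau> ^ 4 * theta4 \<tau> ^ 4" if "Im \<tau> > 0" for \<tau>
    unfolding E4_theta[OF that] by (simp flip: power_add)
  have "((\<lambda>\<tau>. (theta2 \<tau> ^ 4 * theta2 \<tau> ^ 4 + theta2 \<tau> ^ 4 * theta4 \<tau> ^ 4) + theta4 \<tau> ^ 4 * theta4 \<tau> ^ 4) has_field_derivative
      (p * (2 * u + c) * b * b + p * (2 * u + c) * b * b + (p * (2 * u + c) * b * c + p * (2 * u - b) * c * b)) + (p * (2 * u - b) * c * c + p * (2 * u - b) * c * c)) (at \<tau>)"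
    unfolding p_def b_def c_def u_def
    by (intro DERIV_add DERIV_mult DERIV_theta4_pow4 DERIV_theta2_pow4 assms)
  from upper_deriv_unique[OF E4 assms DERIV_E4[OF assms] this]
  have "p * (2 * (E2 \<tau> * E4 \<tau> - E6 \<tau>) / 3) = p * (2 * (2 * u + c) * b * b + (2 * u + c) * b * c + (2 * u - b) * c * b + 2 * (2 * u - b) * c * c)"
    by (simp add: p_def algebra_simps)
  then have "2 * (E2 \<tau> * E4 \<tau> - E6 \<tau>) / 3 = 2 * (2 * u + c) * b * b + (2 * u + c) * b * c + (2 * u - b) * c * b + 2 * (2 * u - b) * c * c"
    using p by (simp only: mult_cancel_left) simp
  then have "E6 \<tau> = E2 \<tau> * E4 \<tau> - 3 / 2 * (2 * (2 * u + c) * b * b + (2 * u + c) * b * c + (2 * u - b) * c * b + 2 * (2 * u - b) * c * c)"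
    by (simp add: field_simps)
  also have "E2 \<tau> = 6 * u + c - b" by (simp add: E2_theta[OF assms] b_def c_def u_def)
  also have "E4 \<tau> = b * b + b * c + c * c" unfolding E4[OF assms] b_def c_def ..
  also have "(6 * u + c - b) * (b * b + b * c + c * c) - 3 / 2 * (2 * (2 * u + c) * b * b + (2 * u + c) * b * c + (2 * u - b) * c * b + 2 * (2 * u - b) * c * c)
      = (c - b) * (2 * b + c) * (b + 2 * c) / 2" by (simp add: field_simps)
  finally have "E6 \<tau> = (c - b) * (2 * b + c) * (b + 2 * c) / 2" .
  then show ?thesis by (simp add: b_def c_def)
qed

section \<open>The series at a quadratic irrationality\<close>

text \<open>The inversion exchanges the boundary lines Re = 1, -1 with the two semicircles, so it
  preserves the fundamental domain; the condition on 1 - lambda becomes the one on lambda at the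
  image.\<close>

lemma around_infinity_inversion:
  assumes "around_infinity \<tau>" "norm (1 - modular_lambda \<tau>) < 1"
  shows "around_infinity (- 1 / \<tau>)"
proof -
  define x y where "x = Re \<tau>" and "y = Im \<tau>"
  have \<tau>: "y > 0" "\<bar>x\<bar> \<le> 1" "norm (\<tau> - 1/2) \<ge> 1/2" "norm (\<tau> + 1/2) \<ge> 1/2"
    using assms by (auto simp: around_infinity_def Gamma2_fundamental_domain_def x_def y_def)
  have nz: "\<tau> \<noteq> 0" using \<tau> by (auto simp: y_def)
  have "(1/2)\<^sup>2 \<le> norm (\<tau> - 1/2) ^ 2" "(1/2)\<^sup>2 \<le> norm (\<tau> + 1/2) ^ 2" using \<tau> by (intro power_mono; simp)+
  then have "(1/2)\<^sup>2 \<le> (x - 1/2)\<^sup>2 + y\<^sup>2" "(1/2)\<^sup>2 \<le> (x + 1/2)\<^sup>2 + y\<^sup>2"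
    unfolding x_def y_def by (simp_all only: cmod_power2) simp_all
  then have d: "\<bar>x\<bar> \<le> x\<^sup>2 + y\<^sup>2"
    by (simp add: power2_eq_square algebra_simps abs_if)
  have pos: "x\<^sup>2 + y\<^sup>2 > 0" using \<tau>(1) by (intro add_nonneg_pos) auto
  have Im: "Im (- 1 / \<tau>) > 0" using Im_minus_inverse[of \<tau>] \<tau> by (simp add: y_def)
  have "Re (- 1 / \<tau>) = - x / (x\<^sup>2 + y\<^sup>2)"
    by (simp add: Re_divide x_def y_def)
  then have Re: "\<bar>Re (- 1 / \<tau>)\<bar> \<le> 1"
    using d pos by (simp add: abs_divide)
  have shift: "norm (- 1 / \<tau> + of_real s / 2) \<ge> 1 / 2" if "s = 1 \<or> s = - 1" for s :: real
  proof -
    have "norm \<tau> \<le> norm (of_real s * \<tau> - 2)"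
    proof -
      have "x\<^sup>2 + y\<^sup>2 \<le> (s * x - 2)\<^sup>2 + (s * y)\<^sup>2"
        using that \<tau>(2) by (auto simp: power2_eq_square algebra_simps)
      then show ?thesis
        unfolding cmod_def x_def y_def by (intro real_sqrt_le_mono) simp
    qed
    moreover have "- 1 / \<tau> + of_real s / 2 = (of_real s * \<tau> - 2) / (2 * \<tau>)"
      using nz by (simp add: field_simps)
    ultimately show ?thesis
      using nz by (simp add: norm_divide norm_mult field_simps)
  qed
  have "norm (modular_lambda (- 1 / \<tau>)) < 1"
    using assms(2) modular_lambda_inversion[of \<tau>] \<tau>(1) by (simp only: y_def)
  then show ?thesis
    using Im Re shift[of 1] shift[of "- 1"] unfolding around_infinity_def Gamma2_fundamental_domain_def
    by (simp only: mem_Collect_eq) simp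
qed

text \<open>Since 1/2 is fixed by x -> 1 - x, both tau and -1/tau lie in the region with lambda =
  1/2, and the square of \<open>theta3\<close> is F(1/2) at both. The factor - i tau of the
  inversion formula must then be 1.\<close>

lemma modular_lambda_half:
  assumes "around_infinity \<tau>" "modular_lambda \<tau> = 1/2"
  shows "\<tau> = \<i>"
proof -
  have \<tau>: "Im \<tau> > 0" using assms(1) by (simp add: around_infinity_def Gamma2_fundamental_domain_def)
  have r: "\<tau> \<in> cusp_region 2" "- 1 / \<tau> \<in> cusp_region 2"
    using around_infinity_inversion[of \<tau>] assms by (auto intro!: around_infinity_cusp_region)
  have "modular_lambda (- 1 / \<tau>) = 1/2"
    unfolding modular_lambda_inversion[OF \<tau>] assms(2) by simp
  with hypK_modular_lambda[OF r(2)] hypK_modular_lambda[OF r(1)] assms(2)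
  have "theta3 (- 1 / \<tau>) ^ 2 = theta3 \<tau> ^ 2" by (simp only:)
  then have "- \<i> * \<tau> * theta3 \<tau> ^ 2 = 1 * theta3 \<tau> ^ 2" unfolding theta3_sq_inversion[OF \<tau>] by simp
  then have "- \<i> * \<tau> = 1" using theta3_nonzero[OF \<tau>] by (simp only: mult_cancel_right) simp
  then have "\<i> * (- \<i> * \<tau>) = \<i>" by simp
  then show ?thesis by simp
qed

text \<open>Differentiate the inversion formula for the square of \<open>theta3\<close> at its fixed
  point i.\<close>

lemma theta_dlog_i: "theta_dlog \<i> = 1 / (2 * of_real pi)"
proof -
  have i: "Im \<i> > 0" by simp
  let ?f = "\<lambda>\<tau>. theta3 \<tau> ^ 2" and ?f' = "\<i>\<pi> * theta_dlog \<i> * theta3 \<i> ^ 2"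
  have m: "- 1 / \<i> = \<i>" by (simp add: complex_eq_iff)
  have s: "((\<lambda>\<tau>. - 1 / \<tau>) has_field_derivative - 1) (at \<i>)"
    by (auto intro!: derivative_eq_intros)
  have "(?f has_field_derivative ?f') (at (- 1 / \<i>))"
    using DERIV_theta3_sq[OF i] unfolding m .
  from DERIV_chain2[where g = "\<lambda>\<tau>. - 1 / \<tau>" and f = ?f and s = UNIV, OF this s]
  have 1: "((\<lambda>\<tau>. theta3 (- 1 / \<tau>) ^ 2) has_field_derivative ?f' * - 1) (at \<i>)" .
  have 2: "((\<lambda>\<tau>. - \<i> * \<tau> * theta3 \<tau> ^ 2) has_field_derivative - \<i> * 1 * theta3 \<i> ^ 2 + ?f' * (- \<i> * \<i>)) (at \<i>)"
    by (intro DERIV_mult DERIV_cmult DERIV_ident DERIV_theta3_sq[OF i])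
  have "?f' * - 1 = - \<i> * 1 * theta3 \<i> ^ 2 + ?f' * (- \<i> * \<i>)"
    by (rule upper_deriv_unique[OF theta3_sq_inversion i 1 2])
  then have "\<i> * theta3 \<i> ^ 2 * (2 * of_real pi * theta_dlog \<i>) = \<i> * theta3 \<i> ^ 2 * 1"
    by (simp add: algebra_simps)
  then have "2 * of_real pi * theta_dlog \<i> = 1"
    using theta3_nonzero[OF i] by (simp only: mult_cancel_left) simp
  then show ?thesis by (simp add: field_simps)
qed

text \<open>Differentiate F(lambda)^2 = theta3^4 with respect to tau: D lambda is lambda (1 -
  lambda) theta3^4, and D theta3^4 is 2 u theta3^4.\<close>

lemma deriv_hypK_sq:
  assumes "\<tau> \<in> cusp_region 2"
  shows "modular_lambda \<tau> * (1 - modular_lambda \<tau>) * deriv (\<lambda>z. (hypK z)\<^sup>2) (modular_lambda \<tau>) = 2 * theta_dlog \<tau>"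
proof -
  let ?l = "modular_lambda \<tau>" and ?a = "theta3 \<tau> ^ 4"
  have \<tau>: "Im \<tau> > 0" using assms by (simp add: cusp_region_def)
  have l1: "norm ?l < 1" by (rule norm_modular_lambda_less_1[OF assms])
  have a0: "?a \<noteq> 0" using theta3_nonzero[OF \<tau>] by simp
  have d: "((\<lambda>z. (hypK z)\<^sup>2) has_field_derivative 2 * hypK ?l * deriv hypK ?l) (at ?l)"
    using DERIV_power[OF deriv_hypK[OF l1], of 2] by (simp add: mult_ac)
  have "((\<lambda>\<tau>. (hypK (modular_lambda \<tau>))\<^sup>2) has_field_derivative
      deriv (\<lambda>z. (hypK z)\<^sup>2) ?l * (\<i>\<pi> * ?l * (1 - ?l) * ?a)) (at \<tau>)"
    using DERIV_chain2[where f = "\<lambda>z. (hypK z)\<^sup>2" and g = modular_lambda and s = UNIV, OF d DERIV_modular_lambda[OF \<tau>]]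
    unfolding DERIV_imp_deriv[OF d] .
  then have "((\<lambda>\<tau>. theta3 \<tau> ^ 4) has_field_derivative
      deriv (\<lambda>z. (hypK z)\<^sup>2) ?l * (\<i>\<pi> * ?l * (1 - ?l) * ?a)) (at \<tau>)"
    by (rule has_field_derivative_transform_within_open[OF _ open_cusp_region assms])
       (simp add: hypK_modular_lambda flip: power_mult)
  from DERIV_unique[OF this DERIV_theta3_pow4[OF \<tau>]]
  have "(\<i>\<pi> * ?a) * (?l * (1 - ?l) * deriv (\<lambda>z. (hypK z)\<^sup>2) ?l) = (\<i>\<pi> * ?a) * (2 * theta_dlog \<tau>)"
    by (simp add: mult_ac)
  then show ?thesis using a0 by (simp only: mult_cancel_left) simp
qed

text \<open>The roots are primitive sixth roots of unity, for l^3 = -1. Hence g2 does not vanish in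
  the open unit disc.\<close>

lemma norm_1_if_quadratic:
  fixes l :: complex
  assumes "l\<^sup>2 - l + 1 = 0"
  shows "norm l = 1"
proof -
  have "l ^ 3 + 1 = (l + 1) * (l\<^sup>2 - l + 1)"
    by (simp add: power2_eq_square power3_eq_cube algebra_simps)
  with assms have "l ^ 3 = - 1" by (simp add: eq_neg_iff_add_eq_0)
  then have "norm l ^ 3 = 1" by (simp flip: norm_power)
  then show ?thesis using power_eq_1_iff[of "norm l" 3] by simp
qed

text \<open>With a = theta3^4 one has E4 = a^2 Q, E6 = a^3 P / 2 and 3 g3 / (2 g2) = P / (6 Q), so
  the coefficient of s2 undoes E4 / E6 up to 1 / (3a). In E2 = 6 u + a (1 - 2l) the second part
  cancels (2l - 1) / 3 and the first cancels the derivative term 2 u; only the part 3 / (pi Im tau)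
  survives.\<close>

lemma around_infinity_identity:
  assumes ar: "around_infinity \<tau>"
  defines "l \<equiv> modular_lambda \<tau>"
  defines "g2 \<equiv> 4 / 3 * (l\<^sup>2 - l + 1)" and "g3 \<equiv> 4 / 27 * (l + 1) * (2 * l - 1) * (l - 2)"
  shows "- (hypK l)\<^sup>2 * ((2 * l - 1) / 3 + 3 * g3 / (2 * g2) * s2 \<tau>)
      + l * (1 - l) * deriv (\<lambda>z. (hypK z)\<^sup>2) l = 1 / of_real (pi * Im \<tau>)"
proof -
  have r: "\<tau> \<in> cusp_region 2" by (rule around_infinity_cusp_region[OF ar])
  then have \<tau>: "Im \<tau> > 0" by (simp add: cusp_region_def)
  have l1: "norm l < 1" using ar by (simp add: around_infinity_def l_def)
  define a where "a = theta3 \<tau> ^ 4"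
  have a0: "a \<noteq> 0" using theta3_nonzero[OF \<tau>] by (simp add: a_def)
  have b: "theta2 \<tau> ^ 4 = a * l" using a0 by (simp add: a_def l_def modular_lambda_def)
  have c: "theta4 \<tau> ^ 4 = a * (1 - l)"
    using a0 one_minus_modular_lambda[OF \<tau>] by (simp add: a_def l_def)
  define Y where "Y = 1 / complex_of_real (pi * Im \<tau>)"
  define u where "u = theta_dlog \<tau>"
  define P where "P = (l + 1) * (2 * l - 1) * (l - 2)"
  define Q where "Q = l\<^sup>2 - l + 1"
  have Q0: "Q \<noteq> 0" using norm_1_if_quadratic[of l] l1 by (auto simp: Q_def)
  have E2: "E2 \<tau> = 6 * u + a * (1 - 2 * l)"
    unfolding E2_theta[OF \<tau>] b c u_def by (simp add: algebra_simps)
  have sq: "x ^ 8 = (x ^ 4)\<^sup>2" for x :: complex by (simp flip: power_mult)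
  have E4: "E4 \<tau> = a\<^sup>2 * Q"
    unfolding E4_theta[OF \<tau>] sq b c Q_def by (simp add: power2_eq_square algebra_simps)
  have E6: "E6 \<tau> = a ^ 3 * P / 2"
    unfolding E6_theta[OF \<tau>] b c P_def by (simp add: power3_eq_cube algebra_simps)
  have F: "(hypK l)\<^sup>2 = a"
    unfolding l_def hypK_modular_lambda[OF r] a_def by (simp flip: power_mult)
  have D: "l * (1 - l) * deriv (\<lambda>z. (hypK z)\<^sup>2) l = 2 * u"
    unfolding l_def u_def by (rule deriv_hypK_sq[OF r])
  have s2: "s2 \<tau> = a\<^sup>2 * Q / (a ^ 3 * P / 2) * (6 * u + a * (1 - 2 * l) - 3 * Y)"
    unfolding s2_def E2 E4 E6 Y_def by simp
  have g: "3 * g3 / (2 * g2) = P / (6 * Q)"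
  proof -
    have "g2 = 4 / 3 * Q" "g3 = 4 / 27 * P" by (simp_all only: g2_def g3_def P_def Q_def mult.assoc)
    then show ?thesis by (simp only:) simp
  qed
  have "- a * ((2 * l - 1) / 3 + P / (6 * Q) * (a\<^sup>2 * Q / (a ^ 3 * P / 2) * (6 * u + a * (1 - 2 * l) - 3 * Y))) + 2 * u = Y"
  proof (cases "P = 0")
    case False
    have "P / (6 * Q) * (a\<^sup>2 * Q / (a ^ 3 * P / 2) * X) = X / (3 * a)" for X
      using False Q0 a0 by (simp add: power2_eq_square power3_eq_cube)
    then show ?thesis using a0 by (simp only:) (simp add: field_simps)
  next
    \<comment> \<open>E6 and g3 vanish together. Of the roots -1, 1/2 and 2 only 1/2 lies in the
      unit disc, and there the bracket is 0, so that 2 u alone must equal 1 / (pi Im tau) = 1 /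
      pi.\<close>
    case True
    have "l \<noteq> - 1" "l \<noteq> 2" using l1 by auto
    moreover have "l + 1 = 0 \<or> 2 * l - 1 = 0 \<or> l - 2 = 0"
      using True unfolding P_def by (simp only: mult_eq_0_iff disj_assoc)
    ultimately have l: "l = 1/2" by (auto simp: eq_neg_iff_add_eq_0 field_simps)
    then have "\<tau> = \<i>" using modular_lambda_half[OF ar] by (simp add: l_def)
    then have "2 * u = Y" by (simp add: u_def Y_def theta_dlog_i)
    then show ?thesis unfolding True l by simp
  qed
  then show ?thesis unfolding F D s2 g Y_def .
qed

theorem theorem4:
  fixes a b c d :: int and \<tau> l F g2 g3 :: complex
  assumes "Gcd {a, b, c} = 1" and "a > 0"
    and "- d = b\<^sup>2 - 4 * a * c" and "- d < 0"
    and "\<tau> = (- of_int b + csqrt (of_int (- d))) / (2 * of_int a)"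
    and "around_infinity \<tau>"
    and "l = modular_lambda \<tau>"
    and "F = hyp2F1 (1 / 2) (1 / 2) 1 l"
    and "g2 = 4 / 3 * (l\<^sup>2 - l + 1)"
    and "g3 = 4 / 27 * (l + 1) * (2 * l - 1) * (l - 2)"
  shows "- F\<^sup>2 * ((2 * l - 1) / 3 + 3 * g3 / (2 * g2) * s2 \<tau>)
           + l * (1 - l) * deriv (\<lambda>z. (hyp2F1 (1 / 2) (1 / 2) 1 z)\<^sup>2) l
         = of_real (2 * of_int a / (pi * sqrt (of_int d)))"
proof -
  \<comment> \<open>\<open>csqrt\<close> picks the root i sqrt d with positive imaginary part,
    whence Im tau = sqrt d / (2 a).\<close>
  have "csqrt (of_int (- d)) = csqrt (of_real (- real_of_int d))" by simp
  also have "\<dots> = \<i> * of_real (sqrt (real_of_int d))"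
    using assms(4) by (subst csqrt_of_real_nonpos) auto
  finally have "\<tau> = (of_real (- real_of_int b) + \<i> * of_real (sqrt (real_of_int d))) / of_real (2 * real_of_int a)"
    unfolding assms(5) by simp
  then have "Im \<tau> = sqrt (real_of_int d) / (2 * real_of_int a)"
    by (simp only: Im_divide_of_real) simp
  then have "1 / (pi * Im \<tau>) = 2 * of_int a / (pi * sqrt (of_int d))"
    by (simp only:) simp
  then have "1 / complex_of_real (pi * Im \<tau>) = of_real (2 * of_int a / (pi * sqrt (of_int d)))"
    by (metis of_real_1 of_real_divide)
  with around_infinity_identity[OF assms(6)] show ?thesis
    unfolding assms(7-10) by simp
qed

end
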